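(* Let $n\ge 1$ be an integer and let $N=p_1^{k_1}\cdots p_r^{k_r}$ with $r\ge 1$, $p_1>\dots>p_r$ primes and $k_1,\dots,k_r\ge 1$ integers. Let $m\in\mathbb{N}$, $\epsilon\in[0,1]$, and let $S\subseteq(\mathbb{Z}/N\mathbb{Z})^n$ be an $(m,\epsilon)$-Kakeya set. Then $$|S|\ge C_{N,n}\,\epsilon\, m^n,$$ where $$C_{N,n}=\left(\prod_{j=1}^{r-1}\frac{1}{k_j\log(p_j)+1}\ \prod_{i=1}^r\frac{1}{2\left(k_i+\lceil\log_{p_i}(n)\rceil\right)}\right)^n.$$
   Context: For $N=p_1^{k_1}\cdots p_r^{k_r}$ ($p_i$ distinct primes), the projective space $\mathbb{P}(\mathbb{Z}/N\mathbb{Z})^{n-1}$ consists of the vectors $u\in(\mathbb{Z}/N\mathbb{Z})^n$ such that, for every $i\in\{1,\dots,r\}$, $u \bmod p_i^{k_i}$ has at least one coordinate that is a unit, taken up to multiplication by units in $(\mathbb{Z}/N\mathbb{Z})^\times$. One representative in $(\mathbb{Z}/N\mathbb{Z})^n$ is fixed for each element. A line in direction $u$ is a set $\{a+tu : t\in\mathbb{Z}/N\mathbb{Z}\}$ with $a\in(\mathbb{Z}/N\mathbb{Z})^n$. A subset $S\subseteq(\mathbb{Z}/N\mathbb{Z})^n$ is $(m,\epsilon)$-Kakeya if for at least an $\epsilon$ fraction of the directions $u\in\mathbb{P}(\mathbb{Z}/N\mathbb{Z})^{n-1}$ there exists a line $L_u$ in direction $u$ with $|L_u\cap S|\ge m$.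 $\log$ denotes the natural logarithm and $\log_p$ the logarithm to base $p$; an empty product is $1$. *)

theory Defs
  imports Complex_Main "HOL-Number_Theory.Number_Theory"
begin

text \<open>
  Vectors are extensional functions on \<open>{..<n}\<close>, so that equality of functions is equality of
  vectors. Residues are represented by \<open>0, \<dots>, N - 1\<close>.
\<close>

abbreviation Zmod :: "nat \<Rightarrow> int ring" where
  "Zmod N \<equiv> residue_ring (int N)"

definition vecs :: "nat \<Rightarrow> nat \<Rightarrow> (nat \<Rightarrow> int) set" where
  "vecs N n = {..<n} \<rightarrow>\<^sub>E carrier (Zmod N)"

definition scale_vec :: "nat \<Rightarrow> nat \<Rightarrow> int \<Rightarrow> (nat \<Rightarrow> int) \<Rightarrow> (nat \<Rightarrow> int)" where
  "scale_vec N n c u = (\<lambda>i\<in>{..<n}. c \<otimes>\<^bsub>Zmod N\<^esub> u i)"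

definition add_vec :: "nat \<Rightarrow> nat \<Rightarrow> (nat \<Rightarrow> int) \<Rightarrow> (nat \<Rightarrow> int) \<Rightarrow> (nat \<Rightarrow> int)" where
  "add_vec N n u v = (\<lambda>i\<in>{..<n}. u i \<oplus>\<^bsub>Zmod N\<^esub> v i)"

text \<open>The prime powers \<open>q ^ multiplicity q N\<close> are the \<open>p\<^sub>i ^ k\<^sub>i\<close> exactly dividing \<open>N\<close>.\<close>

definition direction_vecs :: "nat \<Rightarrow> nat \<Rightarrow> (nat \<Rightarrow> int) set" where
  "direction_vecs N n =
     {u \<in> vecs N n. \<forall>q \<in> prime_factors N. \<exists>i<n.
        u i mod int (q ^ multiplicity q N) \<in> Units (Zmod (q ^ multiplicity q N))}"

definition unit_multiple_rel :: "nat \<Rightarrow> nat \<Rightarrow> ((nat \<Rightarrow> int) \<times> (nat \<Rightarrow> int)) set" where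
  "unit_multiple_rel N n =
     {(u, v). u \<in> direction_vecs N n \<and> v \<in> direction_vecs N n \<and>
        (\<exists>c \<in> Units (Zmod N). v = scale_vec N n c u)}"

text \<open>\<open>proj_space N n\<close> is the projective space of dimension \<open>n - 1\<close>.\<close>

definition proj_space :: "nat \<Rightarrow> nat \<Rightarrow> (nat \<Rightarrow> int) set set" where
  "proj_space N n = direction_vecs N n // unit_multiple_rel N n"

definition line :: "nat \<Rightarrow> nat \<Rightarrow> (nat \<Rightarrow> int) \<Rightarrow> (nat \<Rightarrow> int) \<Rightarrow> (nat \<Rightarrow> int) set" where
  "line N n a u = {add_vec N n a (scale_vec N n t u) | t. t \<in> carrier (Zmod N)}"

definition lines_in_direction :: "nat \<Rightarrow> nat \<Rightarrow> (nat \<Rightarrow> int) \<Rightarrow> (nat \<Rightarrow> int) set set" where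
  "lines_in_direction N n u = {line N n a u | a. a \<in> vecs N n}"

text \<open>The function \<open>rep\<close> is the fixed choice of a representative vector for each direction.\<close>

definition kakeya ::
  "nat \<Rightarrow> nat \<Rightarrow> ((nat \<Rightarrow> int) set \<Rightarrow> (nat \<Rightarrow> int)) \<Rightarrow> nat \<Rightarrow> real \<Rightarrow> (nat \<Rightarrow> int) set \<Rightarrow> bool" where
  "kakeya N n rep m \<epsilon> S \<longleftrightarrow>
     S \<subseteq> vecs N n \<and>
     real (card {D \<in> proj_space N n.
                   \<exists>L \<in> lines_in_direction N n (rep D). card (L \<inter> S) \<ge> m})
       \<ge> \<epsilon> * real (card (proj_space N n))"

end

theory Submission
  imports Defs
    "HOL-Combinatorics.Permutations"
    "HOL-Computational_Algebra.Computational_Algebra"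
    "HOL-Computational_Algebra.Field_as_Ring"
begin

text \<open>
  For \<open>N = p ^ k\<close>, let \<open>\<zeta>\<close> be a primitive \<open>N\<close>-th root of unity and embed \<open>S\<close> in \<open>\<complex>\<^sup>n\<close> as the points
  \<open>\<zeta> ^ x\<close>. Restricting a monomial \<open>X ^ v\<close> to the line \<open>a + t u\<close> gives \<open>\<zeta> ^ (a v) Y ^ (u v)\<close>; its
  derivatives of order below \<open>n\<close> at the points of \<open>S\<close> on the line determine it modulo
  \<open>\<Prod>\<^sub>t (Y - \<zeta> ^ t) ^ n\<close>. Modulo the prime above \<open>p\<close>, where \<open>\<zeta>\<close> becomes \<open>1\<close>, one is left with the
  coefficients \<open>(u v choose j)\<close> of \<open>(1 + w) ^ (u v)\<close> in degrees \<open>j < n m\<close>, which depend on the direction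
  only. Hence the rank over the field with \<open>p\<close> elements of the functions \<open>v \<mapsto> (u v choose j)\<close> is at
  most \<open>card S\<close> times the number of monomials of degree below \<open>n\<close>. A \<open>w\<close>-analogue of Newton
  interpolation exhibits enough independent functions, one for each monomial; since linear
  bijections act transitively on the directions, averaging over them gives a bound for arbitrary
  line counts \<open>m\<close> depending on \<open>u\<close>.

  For coprime moduli, slice \<open>S\<close> over the first factor and weigh each point by the richest line of
  its fibre. Applying the first bound to the level sets of this weight, and the second bound to the
  fibres, multiplies the constants up to a harmonic sum, which is at most \<open>1 + ln M\<close>.
\<close>

section \<open>Determinants over a finite index set\<close>

text \<open>The rank comparison takes place on determinants in Z[X]: one whose value at
  \<open>X = 1\<close> is prime to \<open>p\<close> cannot vanish at all primitive
  \<open>p ^ k\<close>-th roots of unity. Derivatives of order below \<open>n\<close>, not just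
  values, are used because of the constant. There are \<open>D (D + 1) ... (D + n - 1) / n!\<close>
  monomials of degree below \<open>D\<close>; with multiplicity \<open>n\<close> the factor
  \<open>n!\<close> occurs on both sides of the rank bound and cancels, and
  \<open>n + i \<le> 2 n\<close> leaves \<open>2 ^ n\<close>, whereas multiplicity 1 would lose
  \<open>n!\<close>. The price is that coefficients up to degree \<open>n m \<le> n p ^ k\<close>
  are used. The differences of Newton nodes have total order at most \<open>l g\<close> in
  \<open>w\<close> when \<open>g < p ^ l\<close>, and \<open>l = k + \<lceil>log p n\<rceil>\<close>
  covers that range. A nonsingular minor only involves some special directions, about which a Kakeya
  hypothesis for a fraction of all directions says nothing; averaging over linear bijections removes
  this dependence. Line counts varying with the direction are forced by the product step, since a
  level set of the weight meets lines of different directions in different numbers of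
  points.\<close>

definition leib :: "'i set \<Rightarrow> ('i \<Rightarrow> 'i \<Rightarrow> 'a) \<Rightarrow> 'a::comm_ring_1" where
  "leib V M = (\<Sum>\<pi> | \<pi> permutes V. of_int (sign \<pi>) * (\<Prod>v\<in>V. M v (\<pi> v)))"

lemma leib_cong:
  assumes "\<And>v w. v \<in> V \<Longrightarrow> w \<in> V \<Longrightarrow> M v w = M' v w"
  shows "leib V M = leib V M'"
  unfolding leib_def
proof (intro sum.cong refl, clarify)
  fix \<pi> assume "\<pi> permutes V"
  then show "of_int (sign \<pi>) * (\<Prod>v\<in>V. M v (\<pi> v)) = of_int (sign \<pi>) * (\<Prod>v\<in>V. M' v (\<pi> v))"
    using assms permutes_in_image by (metis (no_types, lifting) prod.cong)
qed

text \<open>Multilinearity in the rows. A common \<open>K\<close> leads to the vanishing criterion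
  by pigeonhole, and separate sets \<open>K v\<close> to the expansion of Newton rows.\<close>

lemma leib_expand:
  assumes "finite V" and K: "\<And>v. v \<in> V \<Longrightarrow> finite (K v)"
    and M: "\<And>v w. v \<in> V \<Longrightarrow> w \<in> V \<Longrightarrow> M v w = (\<Sum>k\<in>K v. c v k * R k w)"
  shows "leib V M = (\<Sum>\<sigma>\<in>Pi\<^sub>E V K. (\<Prod>v\<in>V. c v (\<sigma> v)) * leib V (\<lambda>v. R (\<sigma> v)))"
proof -
  have "(\<Prod>v\<in>V. M v (\<pi> v)) = (\<Sum>\<sigma>\<in>Pi\<^sub>E V K. (\<Prod>v\<in>V. c v (\<sigma> v)) * (\<Prod>v\<in>V. R (\<sigma> v) (\<pi> v)))"
    if "\<pi> permutes V" for \<pi>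
  proof -
    have "(\<Prod>v\<in>V. M v (\<pi> v)) = (\<Prod>v\<in>V. \<Sum>k\<in>K v. c v k * R k (\<pi> v))"
      using that by (intro prod.cong refl) (simp add: M permutes_in_image)
    also have "\<dots> = (\<Sum>\<sigma>\<in>Pi\<^sub>E V K. \<Prod>v\<in>V. c v (\<sigma> v) * R (\<sigma> v) (\<pi> v))"
      using assms by (intro prod_sum_PiE) auto
    finally show ?thesis by (simp add: prod.distrib)
  qed
  then have "leib V M = (\<Sum>\<pi> | \<pi> permutes V. of_int (sign \<pi>) *
      (\<Sum>\<sigma>\<in>Pi\<^sub>E V K. (\<Prod>v\<in>V. c v (\<sigma> v)) * (\<Prod>v\<in>V. R (\<sigma> v) (\<pi> v))))"
    unfolding leib_def by (intro sum.cong) auto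
  also have "\<dots> = (\<Sum>\<sigma>\<in>Pi\<^sub>E V K. \<Sum>\<pi> | \<pi> permutes V.
      (\<Prod>v\<in>V. c v (\<sigma> v)) * (of_int (sign \<pi>) * (\<Prod>v\<in>V. R (\<sigma> v) (\<pi> v))))"
    by (subst sum.swap) (simp add: sum_distrib_left mult_ac)
  finally show ?thesis by (simp add: leib_def sum_distrib_left)
qed

text \<open>Composing with the transposition of \<open>a\<close> and \<open>b\<close> permutes the
  terms and flips their signs, so the determinant is its own negative; characteristic 0 makes it
  0.\<close>

lemma leib_equal_rows:
  fixes M :: "'i \<Rightarrow> 'i \<Rightarrow> 'a::{idom,ring_char_0}"
  assumes "finite V" "a \<in> V" "b \<in> V" "a \<noteq> b" "M a = M b"
  shows "leib V M = 0"
proof -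
  let ?\<tau> = "Transposition.transpose a b"
  have \<tau>: "?\<tau> permutes V" using assms by (simp add: permutes_swap_id)
  have "leib V M = (\<Sum>\<pi> | \<pi> permutes V. of_int (sign (\<pi> \<circ> ?\<tau>)) * (\<Prod>v\<in>V. M v ((\<pi> \<circ> ?\<tau>) v)))"
    unfolding leib_def by (subst sum_permutations_compose_right[OF \<tau>, symmetric]) simp
  also have "\<dots> = (\<Sum>\<pi> | \<pi> permutes V. - (of_int (sign \<pi>) * (\<Prod>v\<in>V. M v (\<pi> v))))"
  proof (intro sum.cong refl, clarify)
    fix \<pi> assume \<pi>: "\<pi> permutes V"
    have "sign (\<pi> \<circ> ?\<tau>) = - sign \<pi>"
      using \<pi> \<tau> assms permutation_permutes by (subst sign_compose) (auto simp: sign_swap_id)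
    moreover have "(\<Prod>v\<in>V. M v ((\<pi> \<circ> ?\<tau>) v)) = (\<Prod>v\<in>V. M (?\<tau> v) ((\<pi> \<circ> ?\<tau>) v))"
      using assms(5) by (intro prod.cong refl) (auto simp: transpose_def)
    moreover have "\<dots> = (\<Prod>v\<in>V. M v (\<pi> v))"
      using prod.permute[OF \<tau>, of "\<lambda>v. M v (\<pi> v)"] by (simp add: o_def)
    ultimately show "of_int (sign (\<pi> \<circ> ?\<tau>)) * (\<Prod>v\<in>V. M v ((\<pi> \<circ> ?\<tau>) v))
        = - (of_int (sign \<pi>) * (\<Prod>v\<in>V. M v (\<pi> v)))" by simp
  qed
  finally show ?thesis by (simp add: leib_def sum_negf)
qed

text \<open>Every choice of one generator per row repeats a generator, so each term of the
  multilinear expansion has two equal rows.\<close>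

lemma leib_eq_0_if_few_generators:
  fixes M :: "'i \<Rightarrow> 'i \<Rightarrow> 'a::{idom,ring_char_0}"
  assumes "finite V" "finite K" "card K < card V"
    and M: "\<And>v. v \<in> V \<Longrightarrow> \<exists>c. \<forall>w\<in>V. M v w = (\<Sum>k\<in>K. c k * R k w)"
  shows "leib V M = 0"
proof -
  obtain c where c: "\<And>v w. v \<in> V \<Longrightarrow> w \<in> V \<Longrightarrow> M v w = (\<Sum>k\<in>K. c v k * R k w)"
    using bchoice[of V "\<lambda>v c. \<forall>w\<in>V. M v w = (\<Sum>k\<in>K. c k * R k w)"] M by blast
  have "leib V M = (\<Sum>\<sigma>\<in>V \<rightarrow>\<^sub>E K. (\<Prod>v\<in>V. c v (\<sigma> v)) * leib V (\<lambda>v. R (\<sigma> v)))"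
    using assms c by (intro leib_expand) auto
  also have "\<dots> = 0"
  proof (intro sum.neutral ballI)
    fix \<sigma> assume "\<sigma> \<in> V \<rightarrow>\<^sub>E K"
    then have "\<not> inj_on \<sigma> V"
      using assms card_inj_on_le[of \<sigma> V K] by (auto simp: PiE_def Pi_def)
    then obtain a b where "a \<in> V" "b \<in> V" "a \<noteq> b" "\<sigma> a = \<sigma> b" by (auto simp: inj_on_def)
    then have "leib V (\<lambda>v. R (\<sigma> v)) = 0"
      using assms by (intro leib_equal_rows[of V a b]) auto
    then show "(\<Prod>v\<in>V. c v (\<sigma> v)) * leib V (\<lambda>v. R (\<sigma> v)) = 0" by simp
  qed
  finally show ?thesis .
qed

text \<open>A permutation with nonzero term never lowers \<open>deg\<close> and raises it wherever
  it moves an index, while the total of \<open>deg\<close> is invariant; only the identity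
  survives.\<close>

lemma leib_triangular:
  fixes deg :: "'i \<Rightarrow> nat"
  assumes "finite V"
    and tri: "\<And>v w. v \<in> V \<Longrightarrow> w \<in> V \<Longrightarrow> M v w \<noteq> 0 \<Longrightarrow> w = v \<or> deg v < deg w"
  shows "leib V M = (\<Prod>v\<in>V. M v v)"
proof -
  have "(\<Prod>v\<in>V. M v (\<pi> v)) = 0" if \<pi>: "\<pi> permutes V" "\<pi> \<noteq> id" for \<pi>
  proof (rule ccontr)
    assume "(\<Prod>v\<in>V. M v (\<pi> v)) \<noteq> 0"
    then have nz: "M v (\<pi> v) \<noteq> 0" if "v \<in> V" for v using assms(1) that
      by (metis prod_zero)
    have in_V: "\<pi> v \<in> V" if "v \<in> V" for v using \<pi> that by (simp add: permutes_in_image)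
    obtain a where a: "a \<in> V" "\<pi> a \<noteq> a" using \<pi> by (metis eq_id_iff permutes_def)
    have "(\<Sum>v\<in>V. deg v) < (\<Sum>v\<in>V. deg (\<pi> v))"
    proof (rule sum_strict_mono_ex1[OF assms(1)])
      show "\<forall>v\<in>V. deg v \<le> deg (\<pi> v)" using tri nz in_V by (metis less_imp_le order_refl)
      show "\<exists>v\<in>V. deg v < deg (\<pi> v)" using tri nz in_V a by blast
    qed
    also have "\<dots> = (\<Sum>v\<in>V. deg v)" using sum.permute[OF \<pi>(1), of deg] by (simp add: o_def)
    finally show False by simp
  qed
  then have "leib V M = (\<Sum>\<pi> | \<pi> permutes V. if \<pi> = id then \<Prod>v\<in>V. M v v else 0)"
    unfolding leib_def by (intro sum.cong) auto
  also have "\<dots> = (\<Prod>v\<in>V. M v v)"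
    using assms(1) by (simp add: sum.delta' finite_permutations permutes_id)
  finally show ?thesis .
qed

lemma leib_cong_mod:
  fixes M M' :: "'i \<Rightarrow> 'i \<Rightarrow> int"
  assumes "\<And>v w. v \<in> V \<Longrightarrow> w \<in> V \<Longrightarrow> [M v w = M' v w] (mod m)"
  shows "[leib V M = leib V M'] (mod m)"
  unfolding leib_def
  by (intro cong_sum cong_mult cong_refl cong_prod) (auto simp: assms permutes_in_image)

section \<open>Integer polynomials at roots of unity\<close>

text \<open>Covers evaluation at 1, evaluation at a root of unity, and their coefficientwise
  versions; all of them have to commute with determinants or with products of linear
  factors.\<close>

locale ring_map =
  fixes h :: "'a::comm_ring_1 \<Rightarrow> 'b::comm_ring_1"
  assumes hom_add: "h (x + y) = h x + h y" and hom_mult: "h (x * y) = h x * h y"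
    and hom_0: "h 0 = 0" and hom_1: "h 1 = 1"
begin

lemma hom_sum: "h (\<Sum>x\<in>A. f x) = (\<Sum>x\<in>A. h (f x))"
  by (induction A rule: infinite_finite_induct) (auto simp: hom_0 hom_add)

lemma hom_prod: "h (\<Prod>x\<in>A. f x) = (\<Prod>x\<in>A. h (f x))"
  by (induction A rule: infinite_finite_induct) (auto simp: hom_1 hom_mult)

lemma hom_power: "h (x ^ n) = h x ^ n"
  by (induction n) (auto simp: hom_1 hom_mult)

lemma hom_uminus: "h (- x) = - h x"
proof -
  have "h x + h (- x) = 0" using hom_add[of x "- x"] by (simp add: hom_0)
  then show ?thesis by (simp add: add_eq_0_iff)
qed

lemma hom_diff: "h (x - y) = h x - h y"
  using hom_add[of x "- y"] by (simp add: hom_uminus)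

lemma hom_leib: "h (leib V M) = leib V (\<lambda>v w. h (M v w))"
proof -
  have "h (of_int (sign \<pi>)) = of_int (sign \<pi>)" for \<pi> :: "'c \<Rightarrow> 'c"
    by (auto simp: sign_def hom_uminus hom_1)
  then show ?thesis by (simp add: leib_def hom_sum hom_prod hom_mult)
qed

lemma ring_map_map_poly: "ring_map (map_poly h)"
  by unfold_locales (auto intro!: poly_eqI
      simp: coeff_map_poly hom_0 hom_1 hom_add hom_mult coeff_mult hom_sum coeff_pCons split: nat.splits)

end

lemma ring_map_poly: "ring_map (\<lambda>P. poly P x)"
  by unfold_locales auto

lemma ring_map_of_int: "ring_map of_int"
  by unfold_locales auto

lemma ring_map_comp: "ring_map f \<Longrightarrow> ring_map g \<Longrightarrow> ring_map (\<lambda>x. f (g x))"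
  by (simp add: ring_map_def)

definition int_poly_eval :: "complex \<Rightarrow> int poly \<Rightarrow> complex" where
  "int_poly_eval z P = poly (map_poly of_int P) z"

lemma ring_map_int_poly_eval: "ring_map (int_poly_eval z)"
  unfolding int_poly_eval_def
  by (rule ring_map_comp[OF ring_map_poly ring_map.ring_map_map_poly[OF ring_map_of_int]])

lemma int_poly_eval_monom: "int_poly_eval z (monom 1 n) = z ^ n"
  by (simp add: int_poly_eval_def map_poly_monom poly_monom)

text \<open>Long division by a monic polynomial, for coefficients in Z and in Z[X]. Bounding the
  remainder through its coefficients lets \<open>d = 0\<close> mean remainder 0.\<close>

lemma monic_division:
  fixes H :: "'a::comm_ring_1 poly"
  assumes "coeff H d = 1" "degree H \<le> d"
  shows "\<exists>Q R. f = Q * H + R \<and> (\<forall>j\<ge>d. coeff R j = 0)"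
proof (induction f)
  case 0
  show ?case by (intro exI[of _ 0]) simp
next
  case (pCons a f)
  then obtain Q R where f: "f = Q * H + R" and R: "\<forall>j\<ge>d. coeff R j = 0" by auto
  define R2 where "R2 = pCons a R"
  define c where "c = coeff R2 d"
  have "pCons a f = pCons 0 f + [:a:]" by simp
  also have "\<dots> = (pCons 0 Q + [:c:]) * H + (R2 - smult c H)"
    by (simp add: f R2_def algebra_simps)
  finally have eq: "pCons a f = (pCons 0 Q + [:c:]) * H + (R2 - smult c H)" .
  have "coeff (R2 - smult c H) j = 0" if "j \<ge> d" for j
  proof (cases "j = d")
    case True
    then show ?thesis using assms by (simp add: c_def)
  next
    case False
    then have "j > d" using that by simp
    then have "coeff R2 j = 0" "coeff H j = 0"
      using R assms by (auto simp: R2_def coeff_pCons coeff_eq_0 split: nat.splits)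
    then show ?thesis by simp
  qed
  with eq show ?case by blast
qed

text \<open>If \<open>z ^ d = 1\<close>, then Bezout gives \<open>z ^ gcd d (p ^ k) = 1\<close>;
  this gcd is a proper divisor of \<open>p ^ k\<close>, hence divides
  \<open>p ^ (k - 1)\<close>.\<close>

lemma prime_power_root_of_unity_inj:
  fixes z :: "'a::field"
  assumes p: "prime p" "k \<ge> 1" and z: "z ^ (p ^ k) = 1" "z ^ (p ^ (k - 1)) \<noteq> 1"
  shows "inj_on (\<lambda>t. z ^ t) {..<p ^ k}"
proof (rule linorder_inj_onI')
  fix s t assume st: "s \<in> {..<p ^ k}" "t \<in> {..<p ^ k}" "s < t"
  show "z ^ s \<noteq> z ^ t"
  proof
    assume "z ^ s = z ^ t"
    define d where "d = t - s"
    have z0: "z \<noteq> 0" using z p by (auto simp: power_0_left)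
    have "z ^ t = z ^ s * z ^ d" using st by (simp add: d_def flip: power_add)
    then have zd: "z ^ d = 1" using \<open>z ^ s = z ^ t\<close> z0 by simp
    have d: "0 < d" "d < p ^ k" using st by (auto simp: d_def)
    obtain x y where "d * x = p ^ k * y + gcd d (p ^ k)" using bezout_nat[of d "p ^ k"] d by auto
    then have "z ^ (d * x) = z ^ (p ^ k * y) * z ^ gcd d (p ^ k)" by (simp flip: power_add)
    then have zg: "z ^ gcd d (p ^ k) = 1" by (simp add: power_mult zd z)
    obtain i where i: "i \<le> k" "gcd d (p ^ k) = p ^ i"
      using divides_primepow_nat[OF p(1), of "gcd d (p ^ k)" k] by auto
    have "i \<noteq> k" using d i by (metis gcd_dvd1 nat_dvd_not_less)
    then have "p ^ (k - 1) = p ^ i * p ^ (k - 1 - i)" using i by (simp flip: power_add)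
    then have "z ^ (p ^ (k - 1)) = 1" using zg i by (simp add: power_mult)
    then show False using z by simp
  qed
qed

text \<open>If \<open>P\<close> vanishes at the primitive \<open>p ^ k\<close>-th roots of unity, it is a multiple of the
  cyclotomic polynomial, whose value at \<open>1\<close> is \<open>p\<close>.\<close>

lemma dvd_poly_1_if_vanishes_at_primitive_roots:
  fixes P :: "int poly"
  assumes p: "prime p" "k \<ge> 1"
    and P: "\<And>z. z ^ (p ^ k) = 1 \<Longrightarrow> z ^ (p ^ (k - 1)) \<noteq> 1 \<Longrightarrow> int_poly_eval z P = 0"
  shows "int p dvd poly P 1"
proof -
  define q where "q = p ^ (k - 1)"
  have q: "p ^ k = p * q" "q > 0" "p > 1" using p prime_gt_1_nat by (cases k; auto simp: q_def prime_gt_0_nat)+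
  define \<Phi> :: "int poly" where "\<Phi> = (\<Sum>i<p. monom 1 (i * q))"
  define d where "d = (p - 1) * q"
  have coeff_\<Phi>: "coeff \<Phi> j = (\<Sum>i<p. if i * q = j then 1 else 0)" for j
    by (simp add: \<Phi>_def coeff_sum)
  have "coeff \<Phi> d = (\<Sum>i<p. if i = p - 1 then 1 else 0)"
    unfolding coeff_\<Phi> d_def using q by (intro sum.cong) auto
  then have 1: "coeff \<Phi> d = 1" using q by simp
  have "coeff \<Phi> j = 0" if "j > d" for j
    unfolding coeff_\<Phi>
  proof (intro sum.neutral ballI)
    fix i assume "i \<in> {..<p}"
    then have "i * q \<le> d" unfolding d_def by (intro mult_right_mono) auto
    then show "(if i * q = j then 1 else 0) = (0::int)" using that by auto
  qed
  then have 2: "degree \<Phi> \<le> d" by (simp add: degree_le)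
  obtain Q R where PQR: "P = Q * \<Phi> + R" and R: "\<forall>j\<ge>d. coeff R j = 0"
    using monic_division[OF 1 2, of P] by blast
  \<comment> \<open>There are \<open>d\<close> of these roots, more than a nonzero remainder of
    degree below \<open>d\<close> can have.\<close>
  define \<Omega> where "\<Omega> = {z::complex. z ^ (p ^ k) = 1} - {z. z ^ q = 1}"
  have "{z::complex. z ^ q = 1} \<subseteq> {z. z ^ (p ^ k) = 1}" by (auto simp: q mult.commute[of p] power_mult)
  then have "card \<Omega> = p * q - q"
    unfolding \<Omega>_def using card_roots_unity_eq[of q] card_roots_unity_eq[of "p ^ k"] q
    by (subst card_Diff_subset) (auto simp: finite_roots_unity)
  then have card: "card \<Omega> = d" by (simp add: d_def diff_mult_distrib)
  have "int_poly_eval z R = 0" if "z \<in> \<Omega>" for z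
  proof -
    interpret ring_map "int_poly_eval z" by (rule ring_map_int_poly_eval)
    have "int_poly_eval z \<Phi> = (\<Sum>i<p. (z ^ q) ^ i)"
      by (simp add: \<Phi>_def hom_sum int_poly_eval_monom power_mult mult.commute flip: power_mult)
    moreover have "(1 - z ^ q) * (\<Sum>i<p. (z ^ q) ^ i) = 1 - (z ^ q) ^ p"
      by (rule one_diff_power_eq[symmetric])
    ultimately have "int_poly_eval z \<Phi> = 0"
      using that q by (auto simp: \<Omega>_def mult.commute simp flip: power_mult)
    moreover have "int_poly_eval z P = 0" using that P by (auto simp: \<Omega>_def q_def)
    ultimately show ?thesis by (simp add: PQR hom_add hom_mult)
  qed
  then have roots: "\<Omega> \<subseteq> {z. poly (map_poly of_int R) z = 0}" by (auto simp: int_poly_eval_def)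
  have "map_poly of_int R = (0::complex poly)"
  proof (rule ccontr)
    assume nz: "map_poly of_int R \<noteq> (0::complex poly)"
    have "d \<le> degree (map_poly of_int R :: complex poly)"
      using card card_mono[OF poly_roots_finite[OF nz] roots] card_poly_roots_bound[OF nz] by simp
    moreover have "coeff (map_poly of_int R) (degree (map_poly of_int R :: complex poly)) \<noteq> (0::complex)"
      using nz by simp
    ultimately show False using R by (simp add: coeff_map_poly)
  qed
  then have "R = 0" by (metis coeff_0 coeff_map_poly of_int_0 of_int_eq_0_iff poly_eqI)
  then have "poly P 1 = poly Q 1 * int p" by (simp add: PQR \<Phi>_def poly_sum poly_monom)
  then show ?thesis by simp
qed

section \<open>Taylor expansion and Hermite interpolation\<close>

lemma pcompose_power: "pcompose (f ^ e) g = pcompose f g ^ e"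
  by (induction e) (simp_all add: pcompose_mult pcompose_1)

text \<open>\<open>coeff (pcompose f [:c, 1:]) i\<close> is the \<open>i\<close>-th Hasse derivative
  of \<open>f\<close> at \<open>c\<close>, the \<open>i\<close>-th derivative divided by
  \<open>i!\<close>. After translation to the origin the expansion is a splitting of the coefficient
  sequence.\<close>

lemma taylor_poly:
  fixes f :: "'a::idom poly"
  shows "\<exists>g. f = (\<Sum>i<n. smult (coeff (pcompose f [:c, 1:]) i) ([:- c, 1:] ^ i)) + [:- c, 1:] ^ n * g"
proof -
  define F where "F = pcompose f [:c, 1:]"
  have "F = (\<Sum>i<n. smult (coeff F i) ([:0, 1:] ^ i)) + [:0, 1:] ^ n * poly_shift n F"
  proof (rule poly_eqI)
    fix j
    have "coeff (\<Sum>i<n. smult (coeff F i) ([:0, 1:] ^ i)) j = (if j < n then coeff F j else 0)"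
      by (simp add: coeff_sum flip: monom_altdef)
    moreover have "coeff ([:0, 1:] ^ n * poly_shift n F) j = (if j < n then 0 else coeff F j)"
      using coeff_monom_mult[of 1 n "poly_shift n F" j]
      by (auto simp: coeff_poly_shift monom_altdef)
    ultimately show "coeff F j = coeff ((\<Sum>i<n. smult (coeff F i) ([:0, 1:] ^ i)) + [:0, 1:] ^ n * poly_shift n F) j"
      by simp
  qed
  then have "pcompose F [:- c, 1:] = pcompose ((\<Sum>i<n. smult (coeff F i) ([:0, 1:] ^ i)) + [:0, 1:] ^ n * poly_shift n F) [:- c, 1:]"
    by simp
  also have "\<dots> = (\<Sum>i<n. smult (coeff F i) ([:- c, 1:] ^ i)) + [:- c, 1:] ^ n * pcompose (poly_shift n F) [:- c, 1:]"
  proof -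
    have "pcompose ([:0, 1:] ^ i) [:- c, 1:] = [:- c, 1:] ^ i" for i
      by (induction i) (simp_all add: pcompose_mult pcompose_pCons pcompose_1)
    then show ?thesis by (simp add: pcompose_add pcompose_sum pcompose_smult pcompose_mult)
  qed
  also have "pcompose F [:- c, 1:] = f"
    by (simp add: F_def pcompose_pCons flip: pcompose_assoc)
  finally show ?thesis unfolding F_def by blast
qed

text \<open>Dual form of Hermite interpolation: a functional on the quotient by the product of the
  \<open>(X - c) ^ n\<close> sees only derivatives of order below \<open>n\<close> at the nodes.
  With \<open>A P + B H = 1\<close>, the part \<open>B H f\<close> depends only on the Taylor
  polynomial at the new node, and \<open>A P f\<close> falls under the induction hypothesis.\<close>

lemma hermite_functional:
  fixes L :: "'a::field_gcd poly \<Rightarrow> 'a"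
  assumes "finite C"
    and "\<And>f g. L (f + g) = L f + L g" and "\<And>a f. L (smult a f) = a * L f"
    and "\<And>f. L ((\<Prod>c\<in>C. [:- c, 1:] ^ n) * f) = 0"
  shows "\<exists>\<kappa>. \<forall>f. L f = (\<Sum>c\<in>C. \<Sum>i<n. \<kappa> c i * coeff (pcompose f [:c, 1:]) i)"
  using assms
proof (induction C arbitrary: L rule: finite_induct)
  case empty
  then show ?case by simp
next
  case (insert c C)
  define P where "P = [:- c, 1:] ^ n"
  define H where "H = (\<Prod>c\<in>C. [:- c, 1:] ^ n)"
  have PH: "L (P * H * f) = 0" for f using insert by (simp add: P_def H_def)
  have "coprime P H"
    unfolding P_def H_def
  proof (intro prod_coprime_right coprime_power_left_iff[THEN iffD2] coprime_power_right_iff[THEN iffD2] disjI1)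
    fix d assume "d \<in> C"
    then have "c \<noteq> d" using insert by auto
    have "[:- d, 1:] - [:- c, 1:] dvd 1"
      using \<open>c \<noteq> d\<close> by (intro dvdI[of _ _ "[:1 / (c - d):]"]) (simp add: one_pCons)
    then show "coprime [:- c, 1:] [:- d, 1:]"
      by (intro coprimeI) (rule dvd_trans[OF dvd_diff])
  qed
  then obtain A B where AB: "A * P + B * H = 1"
    using bezout_coefficients_fst_snd[of P H] by (metis coprime_iff_gcd_eq_1)
  have split: "L f = L (A * P * f) + L (B * H * f)" for f
  proof -
    have "f = A * P * f + B * H * f" using AB by (metis distrib_right mult_1)
    then show ?thesis using insert.prems(1) by metis
  qed
  have "\<exists>\<kappa>. \<forall>f. L (A * P * f) = (\<Sum>c\<in>C. \<Sum>i<n. \<kappa> c i * coeff (pcompose f [:c, 1:]) i)"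
  proof (rule insert.IH)
    show "L (A * P * ((\<Prod>c\<in>C. [:- c, 1:] ^ n) * f)) = 0" for f
      using PH[of "A * f"] by (simp add: H_def mult_ac)
  qed (simp_all add: distrib_left insert.prems)
  then obtain \<kappa> where \<kappa>: "\<And>f. L (A * P * f) = (\<Sum>c\<in>C. \<Sum>i<n. \<kappa> c i * coeff (pcompose f [:c, 1:]) i)" by blast
  have L0: "L 0 = 0" using insert.prems(2)[of 0 0] by simp
  have Lsum: "L (\<Sum>i<m. g i) = (\<Sum>i<m. L (g i))" for g and m :: nat
    by (induction m) (auto simp: L0 insert.prems(1))
  have 2: "L (B * H * f) = (\<Sum>i<n. L (B * H * [:- c, 1:] ^ i) * coeff (pcompose f [:c, 1:]) i)" for f
  proof -
    obtain g where g: "f = (\<Sum>i<n. smult (coeff (pcompose f [:c, 1:]) i) ([:- c, 1:] ^ i)) + P * g"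
      using taylor_poly[where f = f and n = n and c = c] by (auto simp: P_def)
    have "B * H * f = (\<Sum>i<n. smult (coeff (pcompose f [:c, 1:]) i) (B * H * [:- c, 1:] ^ i)) + P * H * (B * g)"
      by (subst g) (simp add: distrib_left sum_distrib_left mult_ac)
    then have "L (B * H * f) = L (\<Sum>i<n. smult (coeff (pcompose f [:c, 1:]) i) (B * H * [:- c, 1:] ^ i)) + L (P * H * (B * g))"
      using insert.prems(1) by metis
    moreover have "L (P * H * (B * g)) = 0" by (rule PH)
    ultimately show ?thesis by (simp add: Lsum insert.prems(2) mult.commute)
  qed
  define \<kappa>' where "\<kappa>' = \<kappa>(c := \<lambda>i. L (B * H * [:- c, 1:] ^ i))"
  have "L f = (\<Sum>c\<in>insert c C. \<Sum>i<n. \<kappa>' c i * coeff (pcompose f [:c, 1:]) i)" for f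
  proof -
    have "(\<Sum>d\<in>C. \<Sum>i<n. \<kappa>' d i * coeff (pcompose f [:d, 1:]) i) = L (A * P * f)"
      unfolding \<kappa> using insert.hyps by (intro sum.cong) (auto simp: \<kappa>'_def)
    then show ?thesis using insert.hyps split[of f] 2[of f] by (simp add: \<kappa>'_def)
  qed
  then show ?case by blast
qed

text \<open>\<open>b e j\<close> is the coefficient of \<open>w ^ j\<close> in the remainder of \<open>(1 + w) ^ e\<close> modulo
  \<open>\<Prod>t\<in>T. (w + 1 - X ^ t) ^ n\<close>, a polynomial in \<open>X\<close>. At \<open>X = 1\<close> the modulus is a power of \<open>w\<close>;
  at \<open>X = z\<close> the remainder is read off from Hermite data at the points \<open>z ^ t\<close>.\<close>

lemma remainder_coefficients:
  fixes T :: "nat set"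
  assumes "finite T"
  obtains b :: "nat \<Rightarrow> nat \<Rightarrow> int poly"
  where "\<And>e j. j < n * card T \<Longrightarrow> poly (b e j) 1 = int (e choose j)"
    and "\<And>z j. z \<noteq> 0 \<Longrightarrow> inj_on (\<lambda>t. z ^ t) T \<Longrightarrow> j < n * card T \<Longrightarrow>
      \<exists>\<kappa>. \<forall>e. int_poly_eval z (b e j) = (\<Sum>t\<in>T. \<Sum>i<n. \<kappa> t i * of_nat (e choose i) * (z ^ t) ^ e)"
proof -
  define d where "d = n * card T"
  define H :: "int poly poly" where "H = (\<Prod>t\<in>T. [:1 - monom 1 t, 1:] ^ n)"
  have deg: "degree H = d"
    by (simp add: H_def d_def degree_prod_eq_sum_degree degree_linear_power mult.commute)
  have "lead_coeff H = 1" by (simp add: H_def lead_coeff_prod lead_coeff_power)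
  then have lead: "coeff H d = 1" using deg by simp
  have "\<exists>R. (\<exists>Q. [:1, 1:] ^ e = Q * H + R) \<and> (\<forall>j\<ge>d. coeff R j = 0)" for e
    using monic_division[of H d "[:1, 1:] ^ e"] lead deg by auto
  then obtain R where R: "\<And>e. \<exists>Q. [:1, 1:] ^ e = Q * H + R e" "\<And>e j. j \<ge> d \<Longrightarrow> coeff (R e) j = 0"
    by metis
  show ?thesis
  proof (rule that[of "\<lambda>e. coeff (R e)"])
    fix e j assume j: "j < n * card T"
    interpret g: ring_map "\<lambda>P::int poly. poly P 1" by (rule ring_map_poly)
    interpret G: ring_map "map_poly (\<lambda>P::int poly. poly P 1)" by (rule g.ring_map_map_poly)
    obtain Q where Q: "[:1, 1:] ^ e = Q * H + R e" using R by blast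
    have GH: "map_poly (\<lambda>P. poly P 1) H = monom 1 d"
      by (simp add: H_def G.hom_prod G.hom_power map_poly_pCons poly_monom monom_altdef d_def power_mult)
    have "map_poly (\<lambda>P::int poly. poly P 1) ([:1, 1:] ^ e) = [:1, 1:] ^ e"
      by (simp add: G.hom_power map_poly_pCons)
    then have "[:1, 1:] ^ e = map_poly (\<lambda>P. poly P 1) Q * monom 1 d + map_poly (\<lambda>P. poly P 1) (R e)"
      by (simp only: Q G.hom_add G.hom_mult GH)
    then have "coeff ([:1, 1:] ^ e) j = poly (coeff (R e) j) 1"
      using j by (simp add: d_def coeff_map_poly coeff_monom_mult mult.commute[of _ "monom 1 _"])
    then show "poly (coeff (R e) j) 1 = int (e choose j)" by (cases "j \<le> e") (auto simp: coeff_linear_poly_power coeff_eq_0 degree_linear_power)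
  next
    fix z :: complex and j assume z: "z \<noteq> 0" "inj_on (\<lambda>t. z ^ t) T" and j: "j < n * card T"
    interpret g: ring_map "int_poly_eval z" by (rule ring_map_int_poly_eval)
    interpret G: ring_map "map_poly (int_poly_eval z)" by (rule g.ring_map_map_poly)
    define Hz where "Hz = map_poly (int_poly_eval z) H"
    define C where "C = (\<lambda>t. z ^ t - 1) ` T"
    have inj: "inj_on (\<lambda>t. z ^ t - 1) T" using z by (auto simp: inj_on_def)
    have Hz: "Hz = (\<Prod>c\<in>C. [:- c, 1:] ^ n)"
      using inj by (simp add: Hz_def H_def C_def prod.reindex G.hom_prod G.hom_power map_poly_pCons
          g.hom_0 g.hom_diff g.hom_1 int_poly_eval_monom)
    have degz: "degree Hz = d"
      using card_image[OF inj]
      by (simp add: Hz d_def degree_prod_eq_sum_degree degree_linear_power C_def mult.commute)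
    define L where "L f = coeff (f mod Hz) j" for f
    have "\<exists>\<kappa>. \<forall>f. L f = (\<Sum>c\<in>C. \<Sum>i<n. \<kappa> c i * coeff (pcompose f [:c, 1:]) i)"
      using assms by (intro hermite_functional) (auto simp: L_def C_def poly_mod_add_left mod_smult_left simp flip: Hz[unfolded C_def])
    then obtain \<kappa> where \<kappa>: "\<And>f. L f = (\<Sum>c\<in>C. \<Sum>i<n. \<kappa> c i * coeff (pcompose f [:c, 1:]) i)" by blast
    \<comment> \<open>At the node \<open>w = z ^ t - 1\<close> the Hasse derivative of
      \<open>(1 + w) ^ e\<close> is \<open>(e choose i) (z ^ t) ^ (e - i)\<close>. Moving
      \<open>(z ^ t) ^ i\<close> into the weight leaves weights independent of
      \<open>e\<close>.\<close>
    have "int_poly_eval z (coeff (R e) j) = (\<Sum>t\<in>T. \<Sum>i<n. (\<kappa> (z ^ t - 1) i / (z ^ t) ^ i) * of_nat (e choose i) * (z ^ t) ^ e)" for e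
    proof -
      obtain Q where Q: "[:1, 1:] ^ e = Q * H + R e" using R by blast
      define Rz where "Rz = map_poly (int_poly_eval z) (R e)"
      have "map_poly (int_poly_eval z) ([:1, 1:] ^ e) = [:1, 1:] ^ e"
        by (simp add: G.hom_power map_poly_pCons g.hom_1 g.hom_0)
      then have eq: "[:1, 1:] ^ e = map_poly (int_poly_eval z) Q * Hz + Rz"
        by (simp only: Q G.hom_add G.hom_mult Hz_def Rz_def)
      have "0 < d" using j unfolding d_def by linarith
      then have "degree Rz < d"
        by (intro degree_lessI) (auto simp: Rz_def R coeff_map_poly g.hom_0)
      then have "([:1, 1:] ^ e) mod Hz = Rz" using degz by (simp add: eq mod_poly_less)
      then have "int_poly_eval z (coeff (R e) j) = L ([:1, 1:] ^ e)"
        by (simp add: L_def Rz_def coeff_map_poly g.hom_0)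
      also have "\<dots> = (\<Sum>t\<in>T. \<Sum>i<n. \<kappa> (z ^ t - 1) i * coeff ([:z ^ t, 1:] ^ e) i)"
        unfolding \<kappa> C_def using inj
        by (subst sum.reindex) (simp_all add: pcompose_power pcompose_pCons)
      also have "\<dots> = (\<Sum>t\<in>T. \<Sum>i<n. (\<kappa> (z ^ t - 1) i / (z ^ t) ^ i) * of_nat (e choose i) * (z ^ t) ^ e)"
      proof (intro sum.cong refl)
        fix t i
        show "\<kappa> (z ^ t - 1) i * coeff ([:z ^ t, 1:] ^ e) i = \<kappa> (z ^ t - 1) i / (z ^ t) ^ i * of_nat (e choose i) * (z ^ t) ^ e"
        proof (cases "i \<le> e")
          case True
          then have "(z ^ t) ^ e = (z ^ t) ^ i * (z ^ t) ^ (e - i)" by (simp flip: power_add)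
          then show ?thesis using True z by (simp add: coeff_linear_poly_power)
        qed (simp add: coeff_eq_0 degree_linear_power)
      qed
      finally show ?thesis .
    qed
    then show "\<exists>\<kappa>. \<forall>e. int_poly_eval z (coeff (R e) j) = (\<Sum>t\<in>T. \<Sum>i<n. \<kappa> t i * of_nat (e choose i) * (z ^ t) ^ e)"
      by (intro exI[of _ "\<lambda>t i. \<kappa> (z ^ t - 1) i / (z ^ t) ^ i"]) blast
  qed
qed

section \<open>The rank bound\<close>

text \<open>The row condition of \<open>leib_eq_0_if_few_generators\<close>; functions are compared
  only on \<open>V\<close>, the columns of the matrix.\<close>

definition spanned :: "'k set \<Rightarrow> ('k \<Rightarrow> 'v \<Rightarrow> complex) \<Rightarrow> 'v set \<Rightarrow> ('v \<Rightarrow> complex) \<Rightarrow> bool" where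
  "spanned K R V F \<longleftrightarrow> (\<exists>c. \<forall>w\<in>V. F w = (\<Sum>k\<in>K. c k * R k w))"

lemma spanned_generator: "finite K \<Longrightarrow> k \<in> K \<Longrightarrow> spanned K R V (R k)"
  unfolding spanned_def
  by (rule exI[of _ "\<lambda>l. if l = k then 1 else 0"]) (simp add: if_distrib[of "\<lambda>c. c * _"] sum.delta cong: if_cong)

lemma spanned_scale:
  assumes "spanned K R V F"
  shows "spanned K R V (\<lambda>w. a * F w)"
proof -
  from assms obtain c where "\<forall>w\<in>V. F w = (\<Sum>k\<in>K. c k * R k w)" by (auto simp: spanned_def)
  then show ?thesis
    unfolding spanned_def by (intro exI[of _ "\<lambda>k. a * c k"]) (simp add: sum_distrib_left mult.assoc)
qed

lemma spanned_sum:
  assumes "\<And>x. x \<in> A \<Longrightarrow> spanned K R V (F x)"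
  shows "spanned K R V (\<lambda>w. \<Sum>x\<in>A. F x w)"
proof -
  from assms obtain c where c: "\<And>x w. x \<in> A \<Longrightarrow> w \<in> V \<Longrightarrow> F x w = (\<Sum>k\<in>K. c x k * R k w)"
    unfolding spanned_def by metis
  have "(\<Sum>x\<in>A. F x w) = (\<Sum>k\<in>K. (\<Sum>x\<in>A. c x k) * R k w)" if "w \<in> V" for w
    using c that by (simp add: sum_distrib_right) (rule sum.swap)
  then show ?thesis unfolding spanned_def by (intro exI[of _ "\<lambda>k. \<Sum>x\<in>A. c x k"]) blast
qed

lemma spanned_add:
  assumes "spanned K R V F" "spanned K R V G"
  shows "spanned K R V (\<lambda>w. F w + G w)"
proof -
  from assms obtain c d where "\<forall>w\<in>V. F w = (\<Sum>k\<in>K. c k * R k w)" "\<forall>w\<in>V. G w = (\<Sum>k\<in>K. d k * R k w)"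
    by (auto simp: spanned_def)
  then show ?thesis
    unfolding spanned_def by (intro exI[of _ "\<lambda>k. c k + d k"]) (simp add: distrib_right sum.distrib)
qed

lemma spanned_cong:
  "(\<And>w. w \<in> V \<Longrightarrow> F w = G w) \<Longrightarrow> spanned K R V F \<Longrightarrow> spanned K R V G"
  by (simp add: spanned_def)

lemma spanned_mult:
  assumes "spanned K R W F" "V \<subseteq> W" and "\<And>k. k \<in> K \<Longrightarrow> spanned K' R' V (\<lambda>w. g w * R k w)"
  shows "spanned K' R' V (\<lambda>w. g w * F w)"
proof -
  from assms(1) obtain c where c: "\<forall>w\<in>W. F w = (\<Sum>k\<in>K. c k * R k w)" by (auto simp: spanned_def)
  have "spanned K' R' V (\<lambda>w. \<Sum>k\<in>K. c k * (g w * R k w))"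
    by (intro spanned_sum spanned_scale assms)
  then show ?thesis
    using c assms(2) by (elim spanned_cong[rotated]) (auto simp: sum_distrib_left mult_ac)
qed

text \<open>Exponents of the monomials of degree below \<open>d\<close>. The same sets index
  derivatives of order below \<open>n\<close>, Newton polynomials and matrix columns.\<close>

definition simplex :: "nat \<Rightarrow> nat \<Rightarrow> (nat \<Rightarrow> nat) set" where
  "simplex n d = {\<alpha> \<in> {..<n} \<rightarrow>\<^sub>E UNIV. (\<Sum>i<n. \<alpha> i) < d}"

definition dot :: "nat \<Rightarrow> (nat \<Rightarrow> nat) \<Rightarrow> (nat \<Rightarrow> nat) \<Rightarrow> nat" where
  "dot n u v = (\<Sum>i<n. u i * v i)"

definition vmonom :: "nat \<Rightarrow> (nat \<Rightarrow> nat) \<Rightarrow> (nat \<Rightarrow> nat) \<Rightarrow> complex" where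
  "vmonom n \<alpha> v = (\<Prod>i<n. of_nat (v i) ^ \<alpha> i)"

lemma finite_simplex [simp]: "finite (simplex n d)"
proof (rule finite_subset)
  show "simplex n d \<subseteq> {..<n} \<rightarrow>\<^sub>E {..<d}"
  proof
    fix \<alpha> assume "\<alpha> \<in> simplex n d"
    then have \<alpha>: "\<alpha> \<in> {..<n} \<rightarrow>\<^sub>E UNIV" "(\<Sum>i<n. \<alpha> i) < d" by (auto simp: simplex_def)
    have "\<alpha> i < d" if "i < n" for i
      using member_le_sum[of i "{..<n}" \<alpha>] that \<alpha>(2) by simp
    then show "\<alpha> \<in> {..<n} \<rightarrow>\<^sub>E {..<d}" using \<alpha>(1) by (auto simp: PiE_def Pi_def)
  qed
qed (auto intro: finite_PiE)

lemma simplex_mono: "d \<le> d' \<Longrightarrow> simplex n d \<subseteq> simplex n d'"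
  unfolding simplex_def using less_le_trans by blast

lemma spanned_mult_coordinate:
  assumes "spanned (simplex n d) (vmonom n) UNIV F" "l < n"
  shows "spanned (simplex n (Suc d)) (vmonom n) UNIV (\<lambda>v. of_nat (v l) * F v)"
proof (rule spanned_mult[OF assms(1) subset_UNIV])
  fix \<alpha> assume \<alpha>: "\<alpha> \<in> simplex n d"
  define \<beta> where "\<beta> = \<alpha>(l := Suc (\<alpha> l))"
  have l: "finite {..<n}" "l \<in> {..<n}" using assms(2) by auto
  have "(\<Sum>i\<in>{..<n} - {l}. \<beta> i) = (\<Sum>i\<in>{..<n} - {l}. \<alpha> i)"
    by (intro sum.cong) (auto simp: \<beta>_def)
  then have "(\<Sum>i<n. \<beta> i) = Suc (\<Sum>i<n. \<alpha> i)"
    using sum.remove[OF l, of \<beta>] sum.remove[OF l, of \<alpha>] by (simp add: \<beta>_def)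
  then have "\<beta> \<in> simplex n (Suc d)"
    using \<alpha> assms(2) by (auto simp: simplex_def \<beta>_def PiE_def Pi_def extensional_def)
  then have "spanned (simplex n (Suc d)) (vmonom n) UNIV (vmonom n \<beta>)"
    by (rule spanned_generator[OF finite_simplex])
  then show "spanned (simplex n (Suc d)) (vmonom n) UNIV (\<lambda>v. of_nat (v l) * vmonom n \<alpha> v)"
  proof (rule spanned_cong[rotated])
    fix v
    have "(\<Prod>i\<in>{..<n} - {l}. of_nat (v i) ^ \<beta> i :: complex) = (\<Prod>i\<in>{..<n} - {l}. of_nat (v i) ^ \<alpha> i)"
      by (intro prod.cong) (auto simp: \<beta>_def)
    then show "vmonom n \<beta> v = of_nat (v l) * vmonom n \<alpha> v"
      using prod.remove[OF l, of "\<lambda>i. of_nat (v i) ^ \<beta> i :: complex"]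
        prod.remove[OF l, of "\<lambda>i. of_nat (v i) ^ \<alpha> i :: complex"]
      by (simp add: \<beta>_def vmonom_def)
  qed
qed

lemma spanned_mono_index:
  assumes "spanned K R V F" "K \<subseteq> K'" "finite K'"
  shows "spanned K' R V F"
proof -
  have "spanned K' R V (\<lambda>w. 1 * F w)"
    using assms by (intro spanned_mult[OF assms(1)]) (auto intro: spanned_generator)
  then show ?thesis by simp
qed

text \<open>\<open>e choose i\<close> is a polynomial of degree \<open>i\<close> in
  \<open>e\<close>, and \<open>e = dot n u v\<close> is linear in \<open>v\<close>. The induction
  uses \<open>(i + 1) (e choose (i + 1)) = (e - i) (e choose i)\<close>.\<close>

lemma spanned_dot_choose:
  "spanned (simplex n (Suc i)) (vmonom n) UNIV (\<lambda>v. of_nat (dot n u v choose i))"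
proof (induction i)
  case 0
  have "(\<lambda>j\<in>{..<n}. 0) \<in> simplex n (Suc 0)" by (auto simp: simplex_def)
  from spanned_generator[OF _ this, of "vmonom n" UNIV] show ?case
    by (rule spanned_cong[rotated]) (auto simp: vmonom_def intro!: prod.neutral)
next
  case (Suc i)
  let ?F = "\<lambda>v. of_nat (dot n u v choose i) :: complex"
  have "spanned (simplex n (Suc (Suc i))) (vmonom n) UNIV
      (\<lambda>v. (1 / of_nat (Suc i)) * ((\<Sum>l<n. of_nat (u l) * (of_nat (v l) * ?F v)) + (- of_nat i) * ?F v))"
  proof (rule spanned_scale, rule spanned_add)
    show "spanned (simplex n (Suc (Suc i))) (vmonom n) UNIV (\<lambda>v. \<Sum>l<n. of_nat (u l) * (of_nat (v l) * ?F v))"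
    proof (rule spanned_sum, rule spanned_scale)
      fix l assume "l \<in> {..<n}"
      then show "spanned (simplex n (Suc (Suc i))) (vmonom n) UNIV (\<lambda>v. of_nat (v l) * ?F v)"
        using spanned_mult_coordinate[OF Suc] by simp
    qed
    show "spanned (simplex n (Suc (Suc i))) (vmonom n) UNIV (\<lambda>v. (- of_nat i) * ?F v)"
      by (rule spanned_scale, rule spanned_mono_index[OF Suc simplex_mono]) auto
  qed
  moreover have "(1 / of_nat (Suc i)) * ((\<Sum>l<n. of_nat (u l) * (of_nat (v l) * ?F v)) + (- of_nat i) * ?F v)
      = of_nat (dot n u v choose Suc i)" for v
  proof -
    define e where "e = dot n u v"
    have 1: "(\<Sum>l<n. of_nat (u l) * (of_nat (v l) * ?F v)) = of_nat e * ?F v"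
      by (simp add: e_def dot_def sum_distrib_right mult.assoc)
    have 2: "of_nat (Suc i) * of_nat (e choose Suc i) = (of_nat e - of_nat i) * (of_nat (e choose i) :: complex)"
    proof (cases "i \<le> e")
      case True
      have "Suc i * (e choose Suc i) = (e - i) * (e choose i)"
        using binomial_absorb_comp[of e i] Suc_times_binomial[of i "e - 1"]
        by (cases e) (simp_all del: binomial_Suc_Suc)
      then show ?thesis using True by (metis of_nat_diff of_nat_mult)
    next
      case False
      then show ?thesis by (simp add: binomial_eq_0)
    qed
    have 3: "(1 / c) * (x * y + (- w) * y) = g" if "c * g = (x - w) * y" "c \<noteq> 0"
      for c g x y w :: complex
      using that by (simp add: divide_eq_eq algebra_simps)
    show ?thesis
      unfolding 1 using 3[OF 2 of_nat_neq_0] by (simp only: e_def)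
  qed
  ultimately show ?case by (simp only:)
qed

lemma power_dot_mod:
  fixes z :: "'a::comm_monoid_mult"
  assumes "z ^ q = 1"
  shows "z ^ dot n (\<lambda>i. f i mod q) v = z ^ dot n f v"
proof -
  have "z ^ (m mod q) = z ^ m" for m
  proof -
    have "z ^ m = z ^ (q * (m div q) + m mod q)" by simp
    then show ?thesis using assms by (simp only: power_add power_mult) simp
  qed
  then have "z ^ ((f i mod q) * v i) = z ^ (f i * v i)" for i by (simp add: power_mult)
  then show ?thesis by (simp add: dot_def power_sum)
qed

definition lin :: "nat \<Rightarrow> nat \<Rightarrow> (nat \<Rightarrow> nat) \<Rightarrow> nat \<Rightarrow> (nat \<Rightarrow> nat) \<Rightarrow> (nat \<Rightarrow> nat)" where
  "lin N n a t u = (\<lambda>i\<in>{..<n}. (a i + t * u i) mod N)"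

lemma power_dot_lin:
  assumes "z ^ q = (1::'a::comm_monoid_mult)"
  shows "z ^ dot n (lin q n a t u) v = z ^ dot n a v * (z ^ t) ^ dot n u v"
proof -
  have "dot n (lin q n a t u) v = dot n (\<lambda>i. (a i + t * u i) mod q) v" by (simp add: dot_def lin_def)
  then have "z ^ dot n (lin q n a t u) v = z ^ dot n (\<lambda>i. a i + t * u i) v"
    by (simp add: power_dot_mod[OF assms])
  also have "dot n (\<lambda>i. a i + t * u i) v = dot n a v + t * dot n u v"
    by (simp add: dot_def algebra_simps sum.distrib sum_distrib_left)
  finally show ?thesis by (simp add: power_add power_mult)
qed

text \<open>Replace the rows in \<open>I\<close> by their lifts. If \<open>I\<close> were too large, the determinant would vanish at
  every primitive root of unity, as the lifted rows are spanned by few functions there.\<close>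

lemma rank_bound:
  fixes p k n :: nat and S :: "(nat \<Rightarrow> nat) set" and u :: "'g \<Rightarrow> nat \<Rightarrow> nat" and V :: "'g set"
  assumes p: "prime p" "k \<ge> 1" and fin: "finite V" "finite S" "I \<subseteq> V"
    and nonsing: "\<not> int p dvd leib V (\<lambda>g v. int (dot n (u g) (f v) choose j g))"
    and rich: "\<And>g. g \<in> I \<Longrightarrow> \<exists>a. j g < n * card {t. t < p ^ k \<and> lin (p ^ k) n a t (u g) \<in> S}"
  shows "card I \<le> card S * card (simplex n n)"
proof (rule ccontr)
  assume big: "\<not> card I \<le> card S * card (simplex n n)"
  define q where "q = p ^ k"
  obtain a where a: "\<And>g. g \<in> I \<Longrightarrow> j g < n * card {t. t < q \<and> lin q n (a g) t (u g) \<in> S}"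
    using rich unfolding q_def by metis
  define T where "T g = {t. t < q \<and> lin q n (a g) t (u g) \<in> S}" for g
  have T: "finite (T g)" "T g \<subseteq> {..<q}" "\<And>t. t \<in> T g \<Longrightarrow> lin q n (a g) t (u g) \<in> S" for g
    by (auto simp: T_def)
  define good where "good g b \<longleftrightarrow> (\<forall>e j. j < n * card (T g) \<longrightarrow> poly (b e j) 1 = int (e choose j)) \<and>
     (\<forall>z j. z \<noteq> 0 \<longrightarrow> inj_on (\<lambda>t. z ^ t) (T g) \<longrightarrow> j < n * card (T g) \<longrightarrow>
      (\<exists>\<kappa>. \<forall>e. int_poly_eval z (b e j) = (\<Sum>t\<in>T g. \<Sum>i<n. \<kappa> t i * of_nat (e choose i) * (z ^ t) ^ e)))" for g b
  have "\<exists>b. good g b" for g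
  proof (rule remainder_coefficients[OF T(1)[of g], of n])
    fix b :: "nat \<Rightarrow> nat \<Rightarrow> int poly"
    assume "\<And>e j. j < n * card (T g) \<Longrightarrow> poly (b e j) 1 = int (e choose j)"
      and "\<And>z j. z \<noteq> 0 \<Longrightarrow> inj_on (\<lambda>t. z ^ t) (T g) \<Longrightarrow> j < n * card (T g) \<Longrightarrow>
        \<exists>\<kappa>. \<forall>e. int_poly_eval z (b e j) = (\<Sum>t\<in>T g. \<Sum>i<n. \<kappa> t i * of_nat (e choose i) * (z ^ t) ^ e)"
    then show "\<exists>b. good g b" unfolding good_def by (intro exI[of _ b]) simp
  qed
  then obtain b where "\<And>g. good g (b g)" by metis
  then have b1: "\<And>g e. g \<in> I \<Longrightarrow> poly (b g e (j g)) 1 = int (e choose j g)"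
    and bz: "\<And>g z. g \<in> I \<Longrightarrow> z \<noteq> 0 \<Longrightarrow> inj_on (\<lambda>t. z ^ t) (T g) \<Longrightarrow>
      \<exists>\<kappa>. \<forall>e. int_poly_eval z (b g e (j g)) = (\<Sum>t\<in>T g. \<Sum>i<n. \<kappa> t i * of_nat (e choose i) * (z ^ t) ^ e)"
    using a unfolding good_def T_def by blast+
  \<comment> \<open>The power of the variable accounts for the base point \<open>a g\<close> of the
    rich line; at 1 it disappears together with the dependence on the line.\<close>
  define M where "M g v = (if g \<in> I then monom 1 (dot n (a g) (f v)) * b g (dot n (u g) (f v)) (j g)
     else [:int (dot n (u g) (f v) choose j g):])" for g v
  interpret e1: ring_map "\<lambda>P::int poly. poly P 1" by (rule ring_map_poly)
  have "poly (leib V M) 1 = leib V (\<lambda>g v. poly (M g v) 1)" by (rule e1.hom_leib)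
  also have "\<dots> = leib V (\<lambda>g v. int (dot n (u g) (f v) choose j g))"
    by (rule leib_cong) (simp add: M_def poly_monom b1)
  finally have at1: "poly (leib V M) 1 = leib V (\<lambda>g v. int (dot n (u g) (f v) choose j g))" .
  have "int_poly_eval z (leib V M) = 0" if z: "z ^ (p ^ k) = 1" "z ^ (p ^ (k - 1)) \<noteq> 1" for z
  proof -
    interpret ez: ring_map "int_poly_eval z" by (rule ring_map_int_poly_eval)
    \<comment> \<open>Each point of \<open>S\<close> with each monomial of degree below
      \<open>n\<close>, and each row outside \<open>I\<close> as its own generator. There are fewer
      than \<open>card V\<close> of them exactly because \<open>I\<close> is assumed too
      large.\<close>
    define K where "K = (S \<times> simplex n n) <+> (V - I)"
    define R where "R l v = (case l of Inl (x, \<alpha>) \<Rightarrow> z ^ dot n x (f v) * vmonom n \<alpha> (f v)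
        | Inr g \<Rightarrow> of_nat (dot n (u g) (f v) choose j g))" for l v
    have finK: "finite K" using fin by (auto simp: K_def)
    have z0: "z \<noteq> 0" using z p by (auto simp: power_0_left)
    have "card K = card S * card (simplex n n) + (card V - card I)"
      using fin by (simp add: K_def card_Plus card_cartesian_product card_Diff_subset finite_subset)
    then have cardK: "card K < card V"
      using big card_mono[OF fin(1,3)] by linarith
    have spanned: "spanned K R V (\<lambda>v. int_poly_eval z (M g v))" if g: "g \<in> V" for g
    proof (cases "g \<in> I")
      case True
      have "inj_on (\<lambda>t. z ^ t) (T g)"
        using prime_power_root_of_unity_inj[OF p z] T(2) unfolding q_def by (rule inj_on_subset)
      with bz[OF True z0] obtain \<kappa> where \<kappa>: "\<And>e. int_poly_eval z (b g e (j g)) =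
          (\<Sum>t\<in>T g. \<Sum>i<n. \<kappa> t i * of_nat (e choose i) * (z ^ t) ^ e)" by blast
      have "spanned K R V (\<lambda>v. z ^ dot n x (f v) * of_nat (dot n (u g) (f v) choose i))"
        if x: "x \<in> S" and i: "i < n" for x i
      proof -
        have 1: "spanned (simplex n (Suc i)) (\<lambda>\<alpha> v. vmonom n \<alpha> (f v)) V (\<lambda>v. of_nat (dot n (u g) (f v) choose i))"
          using spanned_dot_choose[of n i "u g"] unfolding spanned_def by fastforce
        show ?thesis
        proof (rule spanned_mult[OF 1 order_refl])
          fix \<alpha> assume "\<alpha> \<in> simplex n (Suc i)"
          then have "Inl (x, \<alpha>) \<in> K" using simplex_mono[of "Suc i" n n] i x by (auto simp: K_def)
          from spanned_generator[OF finK this, of R V]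
          show "spanned K R V (\<lambda>v. z ^ dot n x (f v) * vmonom n \<alpha> (f v))"
            by (rule spanned_cong[rotated]) (simp add: R_def)
        qed
      qed
      \<comment> \<open>For \<open>t\<close> in \<open>T g\<close> the product
        \<open>z ^ (a v) (z ^ t) ^ (u v)\<close> equals \<open>z ^ (x v)\<close> with
        \<open>x\<close> the point of \<open>S\<close> at parameter \<open>t\<close>. This turns the
        Hermite data along the line into generators that depend on \<open>S\<close> only.\<close>
      then have "spanned K R V (\<lambda>v. \<Sum>t\<in>T g. \<Sum>i<n. \<kappa> t i *
          (z ^ dot n (lin q n (a g) t (u g)) (f v) * of_nat (dot n (u g) (f v) choose i)))"
        using T(3) by (intro spanned_sum spanned_scale[where a = "\<kappa> _ _"]) auto
      then show ?thesis
      proof (rule spanned_cong[rotated])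
        fix v
        have zq: "z ^ q = 1" using z by (simp add: q_def)
        show "(\<Sum>t\<in>T g. \<Sum>i<n. \<kappa> t i *
          (z ^ dot n (lin q n (a g) t (u g)) (f v) * of_nat (dot n (u g) (f v) choose i))) = int_poly_eval z (M g v)"
          using True by (simp add: M_def ez.hom_mult int_poly_eval_monom \<kappa> power_dot_lin[OF zq]
              sum_distrib_left mult_ac)
      qed
    next
      case False
      then have "Inr g \<in> K" using g by (auto simp: K_def)
      from spanned_generator[OF finK this, of R V] show ?thesis
        by (rule spanned_cong[rotated]) (use False in \<open>simp add: R_def M_def int_poly_eval_def map_poly_pCons\<close>)
    qed
    have "int_poly_eval z (leib V M) = leib V (\<lambda>g v. int_poly_eval z (M g v))" by (rule ez.hom_leib)
    also have "\<dots> = 0"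
      using leib_eq_0_if_few_generators[OF fin(1) finK cardK, of "\<lambda>g v. int_poly_eval z (M g v)" R] spanned
      unfolding spanned_def by blast
    finally show ?thesis .
  qed
  from dvd_poly_1_if_vanishes_at_primitive_roots[OF p this] show False
    using nonsing at1 by simp
qed

section \<open>Independent binomial rows\<close>

text \<open>The reduction of \<open>f\<close> modulo \<open>p\<close> has \<open>w\<close>-adic
  order exactly \<open>c\<close>.\<close>

definition lowp :: "nat \<Rightarrow> int poly \<Rightarrow> nat \<Rightarrow> bool" where
  "lowp p f c \<longleftrightarrow> (\<forall>j<c. int p dvd coeff f j) \<and> \<not> int p dvd coeff f c"

lemma lowp_mult:
  assumes "prime p" "lowp p f c" "lowp p g d"
  shows "lowp p (f * g) (c + d)"
proof -
  have tm: "int p dvd coeff f i * coeff g (j - i)" if "i \<le> j" "j \<le> c + d" "j = c + d \<longrightarrow> i \<noteq> c" for i j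
  proof (cases "i < c")
    case True
    then show ?thesis using assms(2) by (simp add: lowp_def)
  next
    case False
    then have "j - i < d" using that by linarith
    then show ?thesis using assms(3) by (simp add: lowp_def)
  qed
  have "coeff (f * g) (c + d) = coeff f c * coeff g d + (\<Sum>i\<in>{..c + d} - {c}. coeff f i * coeff g (c + d - i))"
    by (simp add: coeff_mult sum.remove[of "{..c + d}" c])
  moreover have "int p dvd (\<Sum>i\<in>{..c + d} - {c}. coeff f i * coeff g (c + d - i))"
    by (rule dvd_sum) (auto intro!: tm)
  moreover have "\<not> int p dvd coeff f c * coeff g d"
    using assms by (simp add: lowp_def prime_dvd_mult_iff)
  ultimately have "\<not> int p dvd coeff (f * g) (c + d)" by (simp add: dvd_add_left_iff)
  moreover have "int p dvd coeff (f * g) j" if "j < c + d" for j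
    unfolding coeff_mult using that by (intro dvd_sum tm) auto
  ultimately show ?thesis by (simp add: lowp_def)
qed

lemma lowp_prod:
  assumes "prime p" "finite A" "\<And>x. x \<in> A \<Longrightarrow> lowp p (f x) (c x)"
  shows "lowp p (\<Prod>x\<in>A. f x) (\<Sum>x\<in>A. c x)"
  using assms(2,3)
proof (induction A rule: finite_induct)
  case empty
  then show ?case using assms(1) by (auto simp: lowp_def dest: not_prime_unit)
next
  case (insert x A)
  then show ?case using lowp_mult[OF assms(1)] by simp
qed

text \<open>By \<open>l (e choose l) = e ((e - 1) choose (l - 1))\<close>, if \<open>p\<close> did
  not divide \<open>e choose l\<close>, then \<open>p ^ a\<close> would divide
  \<open>l\<close>.\<close>

lemma prime_dvd_choose_prime_power_dvd:
  fixes p :: nat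
  assumes "prime p" "p ^ a dvd e" "0 < l" "l < p ^ a"
  shows "p dvd e choose l"
proof (rule ccontr)
  assume "\<not> p dvd e choose l"
  then have cop: "coprime (p ^ a) (e choose l)"
    using assms(1) by (simp add: prime_imp_coprime)
  obtain l' where l': "l = Suc l'" using assms(3) by (cases l) auto
  have "p ^ a dvd l * (e choose l)"
  proof (cases e)
    case (Suc e')
    have "l * (e choose l) = e * (e' choose l')" unfolding l' Suc by (rule Suc_times_binomial)
    then show ?thesis using assms(2) by simp
  qed (simp add: l')
  then have "p ^ a dvd l" using cop by (simp add: coprime_dvd_mult_left_iff)
  then show False using assms(3,4) by (auto dest: dvd_imp_le)
qed

lemma dvd_power_diff_power:
  fixes f g :: "'a::comm_ring_1"
  assumes "c dvd f - g"
  shows "c dvd f ^ e - g ^ e"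
proof (induction e)
  case (Suc e)
  have "f ^ Suc e - g ^ Suc e = f * (f ^ e - g ^ e) + (f - g) * g ^ e" by (simp add: algebra_simps)
  then show ?case using Suc assms by (metis dvd_add dvd_mult dvd_mult2)
qed simp

lemma coeff_one_plus_w_power: "coeff ([:1, 1:] ^ e :: 'a::comm_ring_1 poly) j = of_nat (e choose j)"
proof (induction e arbitrary: j)
  case (Suc e)
  then show ?case by (cases j) (auto simp: coeff_pCons)
qed (simp add: coeff_1 binomial_eq_0)

text \<open>The freshman's dream \<open>(1 + w) ^ (p ^ a e) \<equiv> (1 + w ^ (p ^ a)) ^ e\<close>, read off on coefficients.\<close>

lemma choose_prime_power_mult_cong:
  assumes "prime p"
  shows "[int (p ^ a * e choose j) = (if p ^ a dvd j then int (e choose (j div p ^ a)) else 0)] (mod int p)"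
proof -
  let ?q = "p ^ a"
  have q: "?q > 0" using assms by (simp add: prime_gt_0_nat)
  have "[:int p:] dvd [:1, 1:] ^ ?q - (monom 1 ?q + 1)"
    unfolding const_poly_dvd_iff
  proof
    fix l
    consider "l = 0" | "0 < l" "l < ?q" | "l = ?q" | "l > ?q" using q by linarith
    then show "int p dvd coeff ([:1, 1:] ^ ?q - (monom 1 ?q + 1)) l"
    proof cases
      case 2
      then have "p dvd ?q choose l" using assms by (intro prime_dvd_choose_prime_power_dvd[of p a]) auto
      then show ?thesis using 2 by (simp add: coeff_one_plus_w_power coeff_monom coeff_1)
    qed (use q in \<open>auto simp: coeff_one_plus_w_power coeff_monom coeff_1 binomial_eq_0\<close>)
  qed
  then have "[:int p:] dvd ([:1, 1:] ^ ?q) ^ e - (monom 1 ?q + 1) ^ e" by (rule dvd_power_diff_power)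
  then have "int p dvd coeff (([:1, 1:] ^ ?q) ^ e - (monom 1 ?q + 1) ^ e) j"
    unfolding const_poly_dvd_iff by blast
  moreover have "coeff (([:1, 1:] ^ ?q) ^ e) j = int (?q * e choose j)"
    by (simp add: coeff_one_plus_w_power flip: power_mult)
  moreover have "coeff ((monom 1 ?q + 1) ^ e) j = (if ?q dvd j then int (e choose (j div ?q)) else 0)"
  proof -
    have "coeff ((monom 1 ?q + 1) ^ e) j = (\<Sum>i\<le>e. if ?q * i = j then int (e choose i) else 0)"
      unfolding binomial_ring coeff_sum
      by (intro sum.cong) (auto simp: monom_power of_nat_poly mult.commute[of i for i] coeff_monom)
    also have "\<dots> = (\<Sum>i\<le>e. if i = j div ?q \<and> ?q dvd j then int (e choose i) else 0)"
      using q by (intro sum.cong) auto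
    also have "\<dots> = (if ?q dvd j then int (e choose (j div ?q)) else 0)"
      by (auto simp: binomial_eq_0)
    finally show ?thesis .
  qed
  ultimately show ?thesis by (simp add: cong_iff_dvd_diff)
qed

text \<open>With \<open>j = p ^ a b\<close> and \<open>p\<close> not dividing \<open>b\<close>,
  modulo \<open>p\<close> the polynomial is \<open>(1 + w ^ (p ^ a)) ^ b - 1\<close>, which starts
  with \<open>b w ^ (p ^ a)\<close>.\<close>

lemma lowp_power_diff_1:
  assumes "prime p" "j > 0"
  shows "lowp p ([:1, 1:] ^ j - 1) (p ^ multiplicity p j)"
proof -
  define a where "a = multiplicity p j"
  have dvd: "p ^ a dvd j" by (simp add: a_def multiplicity_dvd)
  then obtain b where b: "j = p ^ a * b" by blast
  have "p ^ a > 0" using assms(1) by (simp add: prime_gt_0_nat)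
  have "\<not> p ^ Suc a dvd j"
  proof
    assume "p ^ Suc a dvd j"
    then have "Suc a \<le> multiplicity p j"
      using assms by (intro multiplicity_geI) (auto dest: not_prime_unit)
    then show False by (simp add: a_def)
  qed
  then have "\<not> p dvd b" by (auto simp: b)
  have "int p dvd coeff ([:1, 1:] ^ j - 1 :: int poly) l" if "l < p ^ a" for l
  proof (cases "l = 0")
    case False
    then have "p dvd j choose l" using that assms dvd by (intro prime_dvd_choose_prime_power_dvd) auto
    then show ?thesis using False by (simp add: coeff_one_plus_w_power coeff_1)
  qed (simp add: coeff_one_plus_w_power)
  moreover have "\<not> int p dvd coeff ([:1, 1:] ^ j - 1 :: int poly) (p ^ a)"
  proof -
    have "[int (j choose p ^ a) = int b] (mod int p)"
      using choose_prime_power_mult_cong[OF assms(1), of a b "p ^ a"] \<open>p ^ a > 0\<close> by (simp add: b)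
    then have "\<not> int p dvd int (j choose p ^ a)"
      using \<open>\<not> p dvd b\<close> by (metis cong_dvd_iff int_dvd_int_iff)
    then show ?thesis using prime_gt_0_nat[OF assms(1)] by (simp add: coeff_one_plus_w_power coeff_1)
  qed
  ultimately show ?thesis by (simp add: lowp_def a_def)
qed

text \<open>The order in \<open>w\<close>, modulo \<open>p\<close>, of the product of
  \<open>(1 + w) ^ j - 1\<close> for \<open>j = 1..g\<close>, a \<open>q\<close>-factorial at
  \<open>q = 1 + w\<close> up to a power of \<open>q - 1\<close>.\<close>

definition cost1 :: "nat \<Rightarrow> nat \<Rightarrow> nat" where
  "cost1 p g = (\<Sum>j=1..g. p ^ multiplicity p j)"

definition cost :: "nat \<Rightarrow> nat \<Rightarrow> (nat \<Rightarrow> nat) \<Rightarrow> nat" where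
  "cost p n \<gamma> = (\<Sum>i<n. cost1 p (\<gamma> i))"

text \<open>With \<open>Z i = (1 + w) ^ v i\<close>, the product \<open>newton n \<gamma> v\<close> is the Newton basis polynomial in \<open>Z\<close> with
  nodes \<open>(1 + w) ^ j\<close>: a combination of the rows of directions \<open>u \<le> \<gamma>\<close>, and triangular in \<open>v\<close>.\<close>

definition newton :: "nat \<Rightarrow> (nat \<Rightarrow> nat) \<Rightarrow> (nat \<Rightarrow> nat) \<Rightarrow> int poly" where
  "newton n \<gamma> v = (\<Prod>i<n. \<Prod>j<\<gamma> i. [:1, 1:] ^ v i - [:1, 1:] ^ j)"

lemma newton_eq_0: "i < n \<Longrightarrow> v i < \<gamma> i \<Longrightarrow> newton n \<gamma> v = 0"
  unfolding newton_def by (intro prod_zero bexI[of _ i] bexI[of _ "v i"]) auto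

lemma lowp_newton_diag:
  assumes "prime p"
  shows "lowp p (newton n \<gamma> \<gamma>) (cost p n \<gamma>)"
  unfolding newton_def cost_def
proof (rule lowp_prod[OF assms])
  fix i
  have "lowp p (\<Prod>j<g. [:1, 1:] ^ g - [:1, 1:] ^ j) (\<Sum>j<g. p ^ multiplicity p (g - j))" for g
  proof (rule lowp_prod[OF assms])
    fix j assume "j \<in> {..<g}"
    then have "[:1, 1:] ^ g - [:1, 1:] ^ j = [:1, 1:] ^ j * ([:1, 1:] ^ (g - j) - 1 :: int poly)"
      by (simp add: algebra_simps flip: power_add)
    moreover have "lowp p ([:1, 1:] ^ j) 0"
      using assms by (auto simp: lowp_def coeff_one_plus_w_power dest: not_prime_unit)
    ultimately show "lowp p ([:1, 1:] ^ g - [:1, 1:] ^ j) (p ^ multiplicity p (g - j))"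
      using lowp_mult[OF assms, of "[:1, 1:] ^ j" 0] lowp_power_diff_1[OF assms, of "g - j"] \<open>j \<in> {..<g}\<close>
      by fastforce
  qed simp
  moreover have "(\<Sum>j<g. p ^ multiplicity p (g - j)) = cost1 p g" for g
    unfolding cost1_def
    by (rule sum.reindex_bij_witness[of _ "\<lambda>j. g - j" "\<lambda>j. g - j"]) auto
  ultimately show "lowp p (\<Prod>j<\<gamma> i. [:1, 1:] ^ \<gamma> i - [:1, 1:] ^ j) (cost1 p (\<gamma> i))" by metis
qed simp

text \<open>The weights \<open>A u\<close> do not depend on \<open>v\<close>, so every coefficient
  of \<open>newton n \<gamma>\<close> in \<open>w\<close> is an integer combination of the rows
  \<open>v \<mapsto> (dot n u v choose j)\<close>.\<close>

lemma newton_expand: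
  "\<exists>A. \<forall>v. newton n \<gamma> v = (\<Sum>u\<in>(\<Pi>\<^sub>E i\<in>{..<n}. {..\<gamma> i}). A u * [:1, 1:] ^ dot n u v)"
proof -
  define P :: "nat \<Rightarrow> int poly poly" where "P g = (\<Prod>j<g. [:- ([:1, 1:] ^ j), 1:])" for g
  have deg: "degree (P g) = g" for g
    by (simp add: P_def degree_prod_eq_sum_degree)
  define A where "A u = (\<Prod>i<n. coeff (P (\<gamma> i)) (u i))" for u
  have "newton n \<gamma> v = (\<Sum>u\<in>(\<Pi>\<^sub>E i\<in>{..<n}. {..\<gamma> i}). A u * [:1, 1:] ^ dot n u v)" for v
  proof -
    have "newton n \<gamma> v = (\<Prod>i<n. poly (P (\<gamma> i)) ([:1, 1:] ^ v i))"
      by (simp add: newton_def P_def poly_prod)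
    also have "\<dots> = (\<Prod>i<n. \<Sum>l\<in>{..\<gamma> i}. coeff (P (\<gamma> i)) l * ([:1, 1:] ^ v i) ^ l)"
      by (simp add: poly_altdef deg)
    also have "\<dots> = (\<Sum>u\<in>(\<Pi>\<^sub>E i\<in>{..<n}. {..\<gamma> i}). \<Prod>i<n. coeff (P (\<gamma> i)) (u i) * ([:1, 1:] ^ v i) ^ u i)"
      by (intro prod_sum_PiE) auto
    also have "\<dots> = (\<Sum>u\<in>(\<Pi>\<^sub>E i\<in>{..<n}. {..\<gamma> i}). A u * [:1, 1:] ^ dot n u v)"
      by (intro sum.cong refl)
         (simp add: A_def prod.distrib dot_def power_sum mult.commute flip: power_mult)
    finally show ?thesis .
  qed
  then show ?thesis by blast
qed

text \<open>Rows of vectors divisible by \<open>p\<close> reduce, modulo \<open>p\<close>, to rows of directions of no larger degree.\<close>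

lemma choose_dot_cong_direction:
  assumes "prime p" "n \<ge> 1"
  shows "(\<forall>v. int p dvd int (dot n u v choose j)) \<or>
    (\<exists>u' j'. (\<exists>i<n. \<not> p dvd u' i) \<and> j' \<le> j \<and> (\<forall>v. [int (dot n u v choose j) = int (dot n u' v choose j')] (mod int p)))"
proof (induction "\<Sum>i<n. u i" arbitrary: u j rule: less_induct)
  case less
  show ?case
  proof (cases "\<exists>i<n. \<not> p dvd u i")
    case True
    then show ?thesis by (intro disjI2 exI[of _ u] exI[of _ j]) simp
  next
    case False
    show ?thesis
    proof (cases "\<forall>i<n. u i = 0")
      case True
      then have dot: "dot n u v = 0" for v by (simp add: dot_def)
      show ?thesis
      proof (cases j)
        case 0
        have "\<not> p dvd 1" using assms(1) by (auto dest: not_prime_unit)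
        \<comment> \<open>For the zero vector and \<open>j = 0\<close> the row is constantly 1, and
          the all-ones direction in degree 0 gives the same row.\<close>
        then show ?thesis using assms(2) 0 by (intro disjI2 exI[of _ "\<lambda>_. 1"] exI[of _ 0]) (simp add: dot, intro exI[of _ 0], simp)
      next
        case (Suc j')
        then have "int p dvd int (dot n u v choose j)" for v by (simp add: dot)
        then show ?thesis by blast
      qed
    next
      case nz: False
      define u1 where "u1 i = u i div p" for i
      have u: "u i = p * u1 i" if "i < n" for i using False that by (simp add: u1_def)
      have dot: "dot n u v = p ^ 1 * dot n u1 v" for v
        by (simp add: dot_def u sum_distrib_left mult.assoc)
      have "(\<Sum>i<n. u1 i) < (\<Sum>i<n. u i)"
      proof (rule sum_strict_mono_ex1)
        show "\<forall>i\<in>{..<n}. u1 i \<le> u i" by (simp add: u1_def div_le_dividend)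
        show "\<exists>i\<in>{..<n}. u1 i < u i" 
          using nz prime_gt_1_nat[OF assms(1)] by (auto simp: u1_def intro!: bexI)
      qed simp
      note IH = less[OF this, of "j div p"]
      have cong: "[int (dot n u v choose j) = (if p dvd j then int (dot n u1 v choose (j div p)) else 0)] (mod int p)" for v
        unfolding dot using choose_prime_power_mult_cong[OF assms(1), of 1 "dot n u1 v" j]
        by (simp only: power_one_right)
      show ?thesis
      proof (cases "p dvd j")
        case False
        then show ?thesis using cong by (simp add: cong_0_iff)
      next
        case True
        then have c: "[int (dot n u v choose j) = int (dot n u1 v choose (j div p))] (mod int p)" for v using cong by simp
        from IH show ?thesis
        proof
          assume "\<forall>v. int p dvd int (dot n u1 v choose (j div p))"
          then show ?thesis using c cong_dvd_iff by blast
        next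
          assume "\<exists>u' j'. (\<exists>i<n. \<not> p dvd u' i) \<and> j' \<le> j div p \<and>
            (\<forall>v. [int (dot n u1 v choose (j div p)) = int (dot n u' v choose j')] (mod int p))"
          then obtain u' j' where u': "\<exists>i<n. \<not> p dvd u' i" and j': "j' \<le> j div p"
            and c': "\<And>v. [int (dot n u1 v choose (j div p)) = int (dot n u' v choose j')] (mod int p)" by blast
          have "j' \<le> j" using j' div_le_dividend le_trans by blast
          moreover have "[int (dot n u v choose j) = int (dot n u' v choose j')] (mod int p)" for v
            using cong_trans[OF c c'] .
          ultimately show ?thesis using u' by (intro disjI2 exI[of _ u'] exI[of _ j']) simp
        qed
      qed
    qed
  qed
qed

text \<open>The coefficients of the Newton polynomials in degree \<open>cost p n \<gamma>\<close>
  form a matrix that is triangular by total degree, with diagonal prime to \<open>p\<close>. By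
  multilinearity some choice of one binomial row per \<gamma>, of degree at most the cost, keeps the
  determinant prime to \<open>p\<close>; these rows are then replaced by rows of directions.\<close>

lemma nonsingular_directions:
  assumes "prime p" "n \<ge> 1"
  shows "\<exists>u j. (\<forall>\<gamma>\<in>simplex n D. (\<exists>i<n. \<not> p dvd u \<gamma> i) \<and> j \<gamma> \<le> cost p n \<gamma>) \<and>
    \<not> int p dvd leib (simplex n D) (\<lambda>\<gamma> v. int (dot n (u \<gamma>) v choose j \<gamma>))"
proof -
  let ?V = "simplex n D"
  define M where "M \<gamma> v = coeff (newton n \<gamma> v) (cost p n \<gamma>)" for \<gamma> v
  have "leib ?V M = (\<Prod>\<gamma>\<in>?V. M \<gamma> \<gamma>)"
  proof (rule leib_triangular[where deg = "\<lambda>v. \<Sum>i<n. v i"])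
    fix \<gamma> v assume in_V: "\<gamma> \<in> ?V" "v \<in> ?V" and "M \<gamma> v \<noteq> 0"
    then have le: "\<gamma> i \<le> v i" if "i < n" for i
      using newton_eq_0[of i n v \<gamma>] that by (force simp: M_def)
    show "v = \<gamma> \<or> (\<Sum>i<n. \<gamma> i) < (\<Sum>i<n. v i)"
    proof (cases "\<exists>i<n. \<gamma> i < v i")
      case True
      then have "(\<Sum>i<n. \<gamma> i) < (\<Sum>i<n. v i)" using le by (intro sum_strict_mono_ex1) auto
      then show ?thesis by blast
    next
      case False
      then have "v i = \<gamma> i" if "i < n" for i using le that by (metis le_neq_implies_less)
      moreover have "v \<in> {..<n} \<rightarrow>\<^sub>E UNIV" "\<gamma> \<in> {..<n} \<rightarrow>\<^sub>E UNIV" using in_V by (auto simp: simplex_def)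
      ultimately have "v = \<gamma>" by (intro PiE_ext) auto
      then show ?thesis by blast
    qed
  qed simp
  moreover have "\<not> int p dvd M \<gamma> \<gamma>" for \<gamma>
    using lowp_newton_diag[OF assms(1)] by (simp add: M_def lowp_def)
  ultimately have nd: "\<not> int p dvd leib ?V M" using assms(1) by (simp add: prime_dvd_prod_iff)
  define K where "K \<gamma> = (\<Pi>\<^sub>E i\<in>{..<n}. {..\<gamma> i}) \<times> {..cost p n \<gamma>}" for \<gamma>
  define R where "R k v = int (dot n (fst k) v choose snd k)" for k v
  have "\<exists>c. \<forall>v. M \<gamma> v = (\<Sum>k\<in>K \<gamma>. c k * R k v)" for \<gamma>
  proof -
    obtain A where A: "\<And>v. newton n \<gamma> v = (\<Sum>u\<in>(\<Pi>\<^sub>E i\<in>{..<n}. {..\<gamma> i}). A u * [:1, 1:] ^ dot n u v)"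
      using newton_expand[of n \<gamma>] by blast
    have "M \<gamma> v = (\<Sum>k\<in>K \<gamma>. coeff (A (fst k)) (cost p n \<gamma> - snd k) * R k v)" for v
      by (simp add: M_def A coeff_sum coeff_mult[of "[:1, 1:] ^ _"] mult.commute[of "A _"] coeff_one_plus_w_power
          K_def R_def sum.cartesian_product' mult.commute[of "int _"])
    then show ?thesis by (intro exI[of _ "\<lambda>k. coeff (A (fst k)) (cost p n \<gamma> - snd k)"]) simp
  qed
  then obtain c where c: "\<And>\<gamma> v. M \<gamma> v = (\<Sum>k\<in>K \<gamma>. c \<gamma> k * R k v)" by metis
  have "leib ?V M = (\<Sum>\<sigma>\<in>Pi\<^sub>E ?V K. (\<Prod>\<gamma>\<in>?V. c \<gamma> (\<sigma> \<gamma>)) * leib ?V (\<lambda>\<gamma>. R (\<sigma> \<gamma>)))"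
    by (rule leib_expand) (auto simp: c K_def intro!: finite_PiE)
  then have "\<not> (\<forall>\<sigma>\<in>Pi\<^sub>E ?V K. int p dvd leib ?V (\<lambda>\<gamma>. R (\<sigma> \<gamma>)))"
    using nd by (auto intro!: dvd_sum)
  then obtain \<sigma> where \<sigma>: "\<sigma> \<in> Pi\<^sub>E ?V K" "\<not> int p dvd leib ?V (\<lambda>\<gamma>. R (\<sigma> \<gamma>))"
    by blast
  have "\<exists>u' j'. (\<exists>i<n. \<not> p dvd u' i) \<and> j' \<le> cost p n \<gamma> \<and> (\<forall>v. [R (\<sigma> \<gamma>) v = int (dot n u' v choose j')] (mod int p))"
    if "\<gamma> \<in> ?V" for \<gamma>
  proof -
    have le: "snd (\<sigma> \<gamma>) \<le> cost p n \<gamma>"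
      using PiE_mem[OF \<sigma>(1) that] by (simp add: K_def mem_Times_iff)
    \<comment> \<open>A row divisible by \<open>p\<close> would make the whole determinant
      divisible, so the other alternative of the reduction to directions must hold.\<close>
    have "\<not> (\<forall>v. int p dvd R (\<sigma> \<gamma>) v)"
    proof
      assume "\<forall>v. int p dvd R (\<sigma> \<gamma>) v"
      then have "int p dvd leib ?V (\<lambda>\<gamma>. R (\<sigma> \<gamma>))"
        unfolding leib_def using that by (intro dvd_sum dvd_mult dvd_trans[OF _ dvd_prodI[of ?V \<gamma>]]) auto
      then show False using \<sigma>(2) by blast
    qed
    then show ?thesis
      using choose_dot_cong_direction[OF assms, of "fst (\<sigma> \<gamma>)" "snd (\<sigma> \<gamma>)"] le
      unfolding R_def by (blast intro: le_trans)
  qed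
  then obtain u j where uj: "\<And>\<gamma>. \<gamma> \<in> ?V \<Longrightarrow> (\<exists>i<n. \<not> p dvd u \<gamma> i) \<and> j \<gamma> \<le> cost p n \<gamma> \<and>
      (\<forall>v. [R (\<sigma> \<gamma>) v = int (dot n (u \<gamma>) v choose j \<gamma>)] (mod int p))"
    by metis
  then have "[leib ?V (\<lambda>\<gamma>. R (\<sigma> \<gamma>)) = leib ?V (\<lambda>\<gamma> v. int (dot n (u \<gamma>) v choose j \<gamma>))] (mod int p)"
    by (intro leib_cong_mod) blast
  then have "\<not> int p dvd leib ?V (\<lambda>\<gamma> v. int (dot n (u \<gamma>) v choose j \<gamma>))"
    using \<sigma>(2) cong_dvd_iff by blast
  then show ?thesis using uj by blast
qed

text \<open>Bound \<open>p ^ multiplicity p j\<close> by the sum of all \<open>p ^ a\<close>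
  dividing \<open>j\<close> with \<open>a < l\<close>. After exchanging the sums, each of the
  \<open>l\<close> values of \<open>a\<close> contributes at most
  \<open>p ^ a (g div p ^ a) \<le> g\<close>.\<close>

lemma cost1_le:
  assumes "prime p" "g < p ^ l"
  shows "cost1 p g \<le> l * g"
proof -
  have "p ^ multiplicity p j \<le> (\<Sum>a<l. if p ^ a dvd j then p ^ a else 0)" if "j \<in> {1..g}" for j
  proof -
    have "p ^ multiplicity p j \<le> j" using that by (intro dvd_imp_le) (auto simp: multiplicity_dvd)
    then have "p ^ multiplicity p j < p ^ l" using that assms(2) by auto
    then have "multiplicity p j < l" using prime_gt_1_nat[OF assms(1)] by (simp add: power_strict_increasing_iff)
    then show ?thesis
      using member_le_sum[of "multiplicity p j" "{..<l}" "\<lambda>a. if p ^ a dvd j then p ^ a else 0"]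
      by (simp add: multiplicity_dvd)
  qed
  then have "cost1 p g \<le> (\<Sum>j=1..g. \<Sum>a<l. if p ^ a dvd j then p ^ a else 0)"
    unfolding cost1_def by (rule sum_mono)
  also have "\<dots> = (\<Sum>a<l. \<Sum>j=1..g. if p ^ a dvd j then p ^ a else 0)" by (rule sum.swap)
  also have "\<dots> \<le> (\<Sum>a<l. g)"
  proof (rule sum_mono)
    fix a
    have pos: "p ^ a > 0" using assms(1) by (simp add: prime_gt_0_nat)
    have "{j \<in> {1..g}. p ^ a dvd j} \<subseteq> (\<lambda>i. p ^ a * i) ` {1..g div p ^ a}"
    proof
      fix j assume "j \<in> {j \<in> {1..g}. p ^ a dvd j}"
      then show "j \<in> (\<lambda>i. p ^ a * i) ` {1..g div p ^ a}"
        using pos by (intro image_eqI[of _ _ "j div p ^ a"]) (auto simp: div_le_mono div_greater_zero_iff dvd_imp_le Suc_le_eq)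
    qed
    then have "card {j \<in> {1..g}. p ^ a dvd j} \<le> g div p ^ a"
      using surj_card_le[of "{1..g div p ^ a}"] by simp
    then have "card {j \<in> {1..g}. p ^ a dvd j} * p ^ a \<le> (g div p ^ a) * p ^ a" by (rule mult_right_mono) simp
    also have "\<dots> \<le> g" by (rule div_times_less_eq_dividend)
    finally show "(\<Sum>j=1..g. if p ^ a dvd j then p ^ a else 0) \<le> g"
      by (simp add: sum.If_cases Int_def)
  qed
  finally show ?thesis by simp
qed

section \<open>Directions and linear bijections\<close>

text \<open>Stars and bars: a last entry holding the slack turns the inequality on the sum into an
  equality for lists of length \<open>n + 1\<close>.\<close>

lemma card_simplex: "card (simplex n (Suc d)) = (n + d) choose n"
proof -
  let ?L = "{l::nat list. length l = Suc n \<and> sum_list l = d}"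
  let ?f = "\<lambda>\<alpha>. map \<alpha> [0..<n] @ [d - (\<Sum>i<n. \<alpha> i)]"
  let ?g = "\<lambda>l::nat list. \<lambda>i\<in>{..<n}. l ! i"
  have sum: "sum_list (map \<alpha> [0..<n]) = (\<Sum>i<n. \<alpha> i)" for \<alpha> :: "nat \<Rightarrow> nat"
    by (simp add: interv_sum_list_conv_sum_set_nat atLeast0LessThan)
  have split: "sum_list l = (\<Sum>i<n. l ! i) + l ! n" if "length l = Suc n" for l :: "nat list"
    using that by (simp add: sum_list_sum_nth atLeast0LessThan)
  have "bij_betw ?f (simplex n (Suc d)) ?L"
  proof (rule bij_betw_byWitness[where f' = ?g])
    show "\<forall>\<alpha>\<in>simplex n (Suc d). ?g (?f \<alpha>) = \<alpha>"
    proof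
      fix \<alpha> assume "\<alpha> \<in> simplex n (Suc d)"
      then have "\<alpha> \<in> extensional {..<n}" by (simp add: simplex_def PiE_def)
      then show "?g (?f \<alpha>) = \<alpha>"
        by (intro extensionalityI[of _ "{..<n}"]) (simp_all add: nth_append)
    qed
    show "\<forall>l\<in>?L. ?f (?g l) = l"
    proof
      fix l assume l: "l \<in> ?L"
      then have "d - (\<Sum>i<n. l ! i) = l ! n" using split[of l] by simp
      then show "?f (?g l) = l"
        using l by (intro nth_equalityI) (auto simp: nth_append less_Suc_eq)
    qed
    show "?f ` simplex n (Suc d) \<subseteq> ?L" by (simp add: sum simplex_def image_subset_iff)
    have "(\<Sum>i<n. l ! i) < Suc d" if "length l = Suc n" "sum_list l = d" for l
      using split[OF that(1)] that(2) by simp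
    then show "?g ` ?L \<subseteq> simplex n (Suc d)" by (simp add: simplex_def image_subset_iff)
  qed
  then have "card (simplex n (Suc d)) = card ?L" by (rule bij_betw_same_card)
  also have "\<dots> = (n + d) choose n"
    using card_length_sum_list[of "Suc n" d] binomial_symmetric[of n "n + d"] by (simp add: add.commute)
  finally show ?thesis .
qed

text \<open>Both cardinalities are rising factorials over \<open>n!\<close>. They are compared
  factor by factor through \<open>n + i \<le> 2 n\<close>, the source of the 2, and
  \<open>n m \<le> D l\<close>.\<close>

lemma card_simplex_ratio:
  fixes m l n D :: nat
  assumes "n \<ge> 1" "l > 0" "D > 0" "n * m \<le> D * l"
  shows "(real m / (2 * real l)) ^ n * real (card (simplex n n)) \<le> real (card (simplex n D))"
proof -
  define x where "x = real m / (2 * real l)"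
  have card: "real (card (simplex n d)) = (\<Prod>i<n. real d + real i) / fact n" if "d > 0" for d
  proof -
    obtain e where e: "d = Suc e" using \<open>d > 0\<close> by (cases d) auto
    have "real (card (simplex n d)) = (real (n + e) gchoose n)"
      by (simp only: e card_simplex binomial_gbinomial)
    also have "\<dots> = pochhammer (real d) n / fact n"
      by (simp add: gbinomial_pochhammer' e add.commute)
    finally show ?thesis by (simp add: pochhammer_prod atLeast0LessThan)
  qed
  have "x ^ n * (\<Prod>i<n. real n + real i) = (\<Prod>i<n. x * (real n + real i))" by (simp add: prod.distrib)
  also have "\<dots> \<le> (\<Prod>i<n. real D + real i)"
  proof (rule prod_mono, rule conjI)
    fix i assume "i \<in> {..<n}"
    have "x \<ge> 0" by (simp add: x_def)
    then show "0 \<le> x * (real n + real i)" by simp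
    have "x * (real n + real i) \<le> x * (2 * real n)"
      using \<open>x \<ge> 0\<close> \<open>i \<in> {..<n}\<close> by (intro mult_left_mono) auto
    also have "\<dots> = real (n * m) / real l" by (simp add: x_def)
    also have "\<dots> \<le> real (D * l) / real l" using assms(4) by (intro divide_right_mono) (simp_all only: of_nat_le_iff of_nat_0_le_iff)
    also have "\<dots> = real D" using assms(2) by simp
    finally show "x * (real n + real i) \<le> real D + real i" by simp
  qed
  finally show ?thesis
    using assms by (simp add: card x_def divide_right_mono)
qed

section \<open>Directions and line counts with natural representatives\<close>

definition nvecs :: "nat \<Rightarrow> nat \<Rightarrow> (nat \<Rightarrow> nat) set" where
  "nvecs N n = {..<n} \<rightarrow>\<^sub>E {..<N}"

definition ndir :: "nat \<Rightarrow> nat \<Rightarrow> (nat \<Rightarrow> nat) set" where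
  "ndir N n = {u \<in> nvecs N n. \<forall>r. prime r \<longrightarrow> r dvd N \<longrightarrow> (\<exists>i<n. \<not> r dvd u i)}"

text \<open>Counting parameters instead of points makes line counts compatible with the Chinese
  remainder theorem.\<close>

definition kcount :: "nat \<Rightarrow> nat \<Rightarrow> (nat \<Rightarrow> nat) set \<Rightarrow> (nat \<Rightarrow> nat) \<Rightarrow> (nat \<Rightarrow> nat) \<Rightarrow> nat" where
  "kcount N n S a u = card {t. t < N \<and> lin N n a t u \<in> S}"

text \<open>The line counts may depend on the direction; \<open>\<epsilon>\<close> has become an average over directions.\<close>

definition kakeya_const :: "nat \<Rightarrow> nat \<Rightarrow> real \<Rightarrow> bool" where
  "kakeya_const N n C \<longleftrightarrow> (\<forall>S a. S \<subseteq> nvecs N n \<longrightarrow>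
     C * (\<Sum>u\<in>ndir N n. real (kcount N n S (a u) u) ^ n) \<le> real (card S) * real (card (ndir N n)))"

lemma finite_nvecs [simp]: "finite (nvecs N n)"
  by (simp add: nvecs_def finite_PiE)

lemma ndir_subset: "ndir N n \<subseteq> nvecs N n"
  by (auto simp: ndir_def)

lemma finite_ndir [simp]: "finite (ndir N n)"
  by (rule finite_subset[OF ndir_subset]) simp

lemma nvecs_eqI:
  assumes "x \<in> nvecs N n" "y \<in> nvecs N n" "\<And>i. i < n \<Longrightarrow> x i = y i"
  shows "x = y"
  by (rule PiE_ext[OF assms(1,2)[unfolded nvecs_def]]) (simp add: assms(3))

lemma nvecs_less: "x \<in> nvecs N n \<Longrightarrow> i < n \<Longrightarrow> x i < N"
  unfolding nvecs_def by (drule PiE_mem[of _ _ _ i]) simp_all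

lemma restrict_in_nvecs: "(\<And>i. i < n \<Longrightarrow> f i < N) \<Longrightarrow> (\<lambda>i\<in>{..<n}. f i) \<in> nvecs N n"
  unfolding nvecs_def by (rule restrict_PiE_iff[THEN iffD2]) simp

lemma lin_in_nvecs: "N > 0 \<Longrightarrow> lin N n a t u \<in> nvecs N n"
  unfolding lin_def by (rule restrict_in_nvecs) simp

lemma kcount_le: "kcount N n S a u \<le> N"
  using card_mono[of "{..<N}" "{t. t < N \<and> lin N n a t u \<in> S}"] by (auto simp: kcount_def)

text \<open>The general linear group over Z/q: respecting \<open>a + t u\<close> for all
  \<open>a\<close>, \<open>u\<close>, \<open>t\<close> is linearity. Extensionality makes the group
  a finite set over which averages can be taken.\<close>

definition linear_bijections :: "nat \<Rightarrow> nat \<Rightarrow> ((nat \<Rightarrow> nat) \<Rightarrow> (nat \<Rightarrow> nat)) set" where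
  "linear_bijections q n = {g \<in> nvecs q n \<rightarrow>\<^sub>E nvecs q n. bij_betw g (nvecs q n) (nvecs q n) \<and>
     (\<forall>a\<in>nvecs q n. \<forall>u\<in>nvecs q n. \<forall>t. g (lin q n a t u) = lin q n (g a) t (g u))}"

lemma finite_linear_bijections [simp]: "finite (linear_bijections q n)"
  by (rule finite_subset[of _ "nvecs q n \<rightarrow>\<^sub>E nvecs q n"]) (simp_all add: linear_bijections_def finite_PiE)

lemma linear_bijectionsD:
  assumes "g \<in> linear_bijections q n"
  shows "bij_betw g (nvecs q n) (nvecs q n)" "\<And>x. x \<in> nvecs q n \<Longrightarrow> g x \<in> nvecs q n"
    "\<And>a u t. a \<in> nvecs q n \<Longrightarrow> u \<in> nvecs q n \<Longrightarrow> g (lin q n a t u) = lin q n (g a) t (g u)"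
proof -
  show bij: "bij_betw g (nvecs q n) (nvecs q n)" using assms by (simp add: linear_bijections_def)
  show "g x \<in> nvecs q n" if "x \<in> nvecs q n" for x using bij_betw_apply[OF bij that] .
  show "g (lin q n a t u) = lin q n (g a) t (g u)" if "a \<in> nvecs q n" "u \<in> nvecs q n" for a u t
    using assms that by (simp add: linear_bijections_def)
qed

lemma linear_bijectionsI:
  assumes "bij_betw f (nvecs q n) (nvecs q n)" "q > 0"
    and "\<And>a u t. a \<in> nvecs q n \<Longrightarrow> u \<in> nvecs q n \<Longrightarrow> f (lin q n a t u) = lin q n (f a) t (f u)"
  shows "restrict f (nvecs q n) \<in> linear_bijections q n"
proof -
  have "restrict f (nvecs q n) \<in> nvecs q n \<rightarrow>\<^sub>E nvecs q n"
    using bij_betwE[OF assms(1)] by (simp add: restrict_PiE_iff)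
  moreover have "bij_betw (restrict f (nvecs q n)) (nvecs q n) (nvecs q n)"
    using assms(1) by (simp cong: bij_betw_cong)
  ultimately show ?thesis using assms(2,3) by (simp add: linear_bijections_def lin_in_nvecs)
qed

definition reach :: "nat \<Rightarrow> nat \<Rightarrow> (nat \<Rightarrow> nat) \<Rightarrow> (nat \<Rightarrow> nat) \<Rightarrow> bool" where
  "reach q n u v \<longleftrightarrow> u \<in> nvecs q n \<and> v \<in> nvecs q n \<and> (\<exists>g\<in>linear_bijections q n. g u = v)"

lemma linear_bijections_comp:
  assumes "g \<in> linear_bijections q n" "h \<in> linear_bijections q n" "q > 0"
  shows "restrict (h \<circ> g) (nvecs q n) \<in> linear_bijections q n"
  by (rule linear_bijectionsI[OF bij_betw_trans[OF linear_bijectionsD(1)[OF assms(1)] linear_bijectionsD(1)[OF assms(2)]] assms(3)])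
     (simp add: linear_bijectionsD(2,3)[OF assms(1)] linear_bijectionsD(3)[OF assms(2)])

lemma reach_trans:
  assumes "q > 0" "reach q n u v" "reach q n v w"
  shows "reach q n u w"
proof -
  from assms obtain g h where gh: "g \<in> linear_bijections q n" "h \<in> linear_bijections q n" "g u = v" "h v = w"
    and in_X: "u \<in> nvecs q n" "w \<in> nvecs q n" unfolding reach_def by blast
  have "restrict (h \<circ> g) (nvecs q n) u = w" using gh in_X by simp
  then show ?thesis
    unfolding reach_def using in_X linear_bijections_comp[OF gh(1,2) assms(1)] by blast
qed

lemma reach_sym:
  assumes "q > 0" "reach q n u v"
  shows "reach q n v u"
proof -
  let ?X = "nvecs q n"
  from assms obtain g where uv: "u \<in> ?X" "v \<in> ?X" and g: "g \<in> linear_bijections q n" "g u = v"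
    unfolding reach_def by blast
  note G = linear_bijectionsD[OF g(1)]
  have inv: "bij_betw (inv_into ?X g) ?X ?X" using bij_betw_inv_into[OF G(1)] .
  have in_X: "inv_into ?X g x \<in> ?X" and gi: "g (inv_into ?X g x) = x" if "x \<in> ?X" for x
    using that inv bij_betw_inv_into_right[OF G(1)] by (auto dest: bij_betwE)
  have ig: "inv_into ?X g (g x) = x" if "x \<in> ?X" for x
    using that bij_betw_inv_into_left[OF G(1)] by simp
  have "inv_into ?X g (lin q n a t w) = lin q n (inv_into ?X g a) t (inv_into ?X g w)"
    if "a \<in> ?X" "w \<in> ?X" for a w t
  proof -
    have "lin q n (inv_into ?X g a) t (inv_into ?X g w) \<in> ?X" using assms(1) by (rule lin_in_nvecs)
    from ig[OF this] show ?thesis using G(3)[OF in_X[OF that(1)] in_X[OF that(2)]] gi that by simp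
  qed
  then have "restrict (inv_into ?X g) ?X \<in> linear_bijections q n"
    using inv assms(1) by (intro linear_bijectionsI)
  moreover have "restrict (inv_into ?X g) ?X v = u" using uv g ig by auto
  ultimately show ?thesis unfolding reach_def using uv by blast
qed

text \<open>The map is the identity matrix with column \<open>i\<close> replaced by
  \<open>w\<close>, invertible because \<open>w i\<close> is a unit. Reducing the entries of the
  unit vector modulo \<open>q\<close> includes the case \<open>q = 1\<close>.\<close>

lemma reach_unit_vector:
  assumes "q > 0" "i < n" "w \<in> nvecs q n" "coprime (w i) q"
  shows "reach q n (\<lambda>j\<in>{..<n}. (if j = i then 1 else 0) mod q) w"
proof -
  let ?X = "nvecs q n"
  define h where "h x = (\<lambda>j\<in>{..<n}. (if j = i then x i * w i else x j + x i * w j) mod q)" for x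
  have h_X: "h x \<in> ?X" for x unfolding h_def using assms(1) by (intro restrict_in_nvecs) simp
  have "inj_on h ?X"
  proof (rule inj_onI)
    fix x y assume xy: "x \<in> ?X" "y \<in> ?X" "h x = h y"
    have eq: "h x j = h y j" for j using xy(3) by simp
    have "[x i * w i = y i * w i] (mod q)" using eq[of i] assms(2) by (simp add: h_def cong_def)
    then have "[x i = y i] (mod q)" using assms(4) by (simp add: cong_mult_rcancel_nat)
    then have i: "x i = y i" using xy assms(2) by (simp add: cong_def nvecs_less)
    show "x = y"
    proof (rule nvecs_eqI[OF xy(1,2)])
      fix j assume "j < n"
      show "x j = y j"
      proof (cases "j = i")
        case False
        then have "[x j + x i * w j = y j + x i * w j] (mod q)"
          using eq[of j] \<open>j < n\<close> i by (simp add: h_def cong_def)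
        then have "[x j = y j] (mod q)" by (simp add: cong_add_rcancel_nat)
        then show ?thesis using xy \<open>j < n\<close> by (simp add: cong_def nvecs_less)
      qed (simp add: i)
    qed
  qed
  then have "bij_betw h ?X ?X"
    using endo_inj_surj[of ?X h] h_X by (simp add: bij_betw_def image_subset_iff)
  moreover have "h (lin q n a t u) = lin q n (h a) t (h u)" for a u t
  proof (rule nvecs_eqI[OF h_X lin_in_nvecs[OF assms(1)]])
    have m: "(x mod q + y * (z mod q)) mod q = (x + y * z) mod q" for x y z
    proof -
      have "(x mod q + y * (z mod q)) mod q = (x + (y * (z mod q)) mod q) mod q"
        by (simp only: mod_add_left_eq mod_add_right_eq)
      then show ?thesis by (simp only: mod_mult_right_eq mod_add_right_eq)
    qed
    fix j assume "j < n"
    have m': "(x mod q + (z mod q) * y) mod q = (x + z * y) mod q" for x y z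
      using m[of x y z] by (simp only: mult.commute)
    have "h (lin q n a t u) j =
        (if j = i then (a i + t * u i) * w i else (a j + t * u j) + (a i + t * u i) * w j) mod q"
      using assms(2) \<open>j < n\<close> by (simp add: h_def lin_def mod_mult_left_eq m')
    moreover have "lin q n (h a) t (h u) j =
        (if j = i then a i * w i + t * (u i * w i) else (a j + a i * w j) + t * (u j + u i * w j)) mod q"
      using assms(2) \<open>j < n\<close> by (simp add: h_def lin_def m)
    moreover have "(a i + t * u i) * w i = a i * w i + t * (u i * w i)"
      "(a j + t * u j) + (a i + t * u i) * w j = (a j + a i * w j) + t * (u j + u i * w j)"
      by (simp_all add: algebra_simps)
    ultimately show "h (lin q n a t u) j = lin q n (h a) t (h u) j" by (simp only:)
  qed
  ultimately have h: "restrict h ?X \<in> linear_bijections q n"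
    using assms(1) by (intro linear_bijectionsI)
  let ?e = "\<lambda>j\<in>{..<n}. (if j = i then 1 else 0) mod q"
  have e: "?e \<in> ?X" using assms(1) by (intro restrict_in_nvecs) simp
  have "h ?e = w"
  proof (rule nvecs_eqI[OF h_X assms(3)])
    fix j assume "j < n"
    then show "h ?e j = w j" using nvecs_less[OF assms(3) \<open>j < n\<close>] assms(2)
      by (auto simp: h_def mod_simps)
  qed
  then have "restrict h ?X ?e = w" using e by simp
  then show ?thesis unfolding reach_def using e h assms(3) by blast
qed

text \<open>Such matrices connect vectors having a unit at the same position; the vector
  \<open>?w\<close> with ones at both \<open>i\<close> and \<open>k\<close> bridges the two
  positions.\<close>

lemma reach_directions:
  assumes "q > 0" and u: "u \<in> nvecs q n" "i < n" "coprime (u i) q"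
    and v: "v \<in> nvecs q n" "k < n" "coprime (v k) q"
  shows "reach q n u v"
proof -
  let ?e = "\<lambda>i. \<lambda>j\<in>{..<n}. (if j = i then 1 else 0) mod q"
  let ?w = "\<lambda>j\<in>{..<n}. (if j = i \<or> j = k then 1 else 0) mod q"
  have w: "?w \<in> nvecs q n" using assms(1) by (intro restrict_in_nvecs) simp
  have w1: "?w i = 1 mod q" "?w k = 1 mod q" using u(2) v(2) by simp_all
  have cop: "coprime (1 mod q) q" by (cases "q = 1") simp_all
  have 1: "reach q n u (?e i)"
    by (rule reach_sym[OF assms(1) reach_unit_vector[OF assms(1) u(2,1,3)]])
  have 2: "reach q n (?e i) ?w"
    by (rule reach_unit_vector[OF assms(1) u(2) w]) (simp only: w1 cop)
  have 3: "reach q n ?w (?e k)"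
    by (rule reach_sym[OF assms(1) reach_unit_vector[OF assms(1) v(2) w]]) (simp only: w1 cop)
  have 4: "reach q n (?e k) v"
    by (rule reach_unit_vector[OF assms(1) v(2,1,3)])
  show ?thesis
    by (rule reach_trans[OF assms(1) reach_trans[OF assms(1) reach_trans[OF assms(1) 1 2] 3] 4])
qed

text \<open>Composition with a bijection taking \<open>v\<close> to \<open>w\<close> injects one
  fibre of \<open>g \<mapsto> g u\<close> into another, so all fibres over \<open>D\<close> have
  equal size: a random bijection sends \<open>u\<close> to a uniformly distributed element of
  \<open>D\<close>.\<close>

lemma card_linear_bijections_mapping:
  assumes "q > 0" and trans: "\<And>u v. u \<in> D \<Longrightarrow> v \<in> D \<Longrightarrow> reach q n u v"
    and D: "finite D" "D \<subseteq> nvecs q n" "\<And>g u. g \<in> linear_bijections q n \<Longrightarrow> u \<in> D \<Longrightarrow> g u \<in> D"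
    and uv: "u \<in> D" "v \<in> D"
  shows "card {g \<in> linear_bijections q n. g u = v} * card D = card (linear_bijections q n)"
proof -
  let ?G = "linear_bijections q n" and ?X = "nvecs q n"
  have le: "card {g \<in> ?G. g u = v} \<le> card {g \<in> ?G. g u = w}" if vw: "v \<in> D" "w \<in> D" for v w
  proof -
    obtain h where h: "h \<in> ?G" "h v = w" using trans[OF vw] by (auto simp: reach_def)
    note H = linear_bijectionsD[OF h(1)]
    show ?thesis
    proof (rule card_inj_on_le[of "\<lambda>g. restrict (h \<circ> g) ?X"])
      show "inj_on (\<lambda>g. restrict (h \<circ> g) ?X) {g \<in> ?G. g u = v}"
      proof (rule inj_onI)
        fix g g' assume g: "g \<in> {g \<in> ?G. g u = v}" "g' \<in> {g \<in> ?G. g u = v}"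
          and eq: "restrict (h \<circ> g) ?X = restrict (h \<circ> g') ?X"
        have ext: "g \<in> ?X \<rightarrow>\<^sub>E ?X" "g' \<in> ?X \<rightarrow>\<^sub>E ?X" using g by (simp_all add: linear_bijections_def)
        have "g x = g' x" if "x \<in> ?X" for x
        proof -
          have "h (g x) = h (g' x)" using fun_cong[OF eq, of x] that by simp
          moreover have "g x \<in> ?X" "g' x \<in> ?X" using g that linear_bijectionsD(2) by auto
          ultimately show ?thesis using bij_betw_imp_inj_on[OF H(1)] by (auto dest: inj_onD)
        qed
        then show "g = g'" by (rule PiE_ext[OF ext])
      qed
      show "(\<lambda>g. restrict (h \<circ> g) ?X) ` {g \<in> ?G. g u = v} \<subseteq> {g \<in> ?G. g u = w}"
        using linear_bijections_comp[OF _ h(1) assms(1)] h(2) uv(1) D(2) by auto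
    qed simp
  qed
  have "card ?G = card (\<Union>w\<in>D. {g \<in> ?G. g u = w})"
    using D(3) uv(1) by (intro arg_cong[of _ _ card]) auto
  also have "\<dots> = (\<Sum>w\<in>D. card {g \<in> ?G. g u = w})"
    using D(1) by (intro card_UN_disjoint) auto
  also have "\<dots> = (\<Sum>w\<in>D. card {g \<in> ?G. g u = v})"
    using le uv(2) by (intro sum.cong) (auto intro: antisym)
  finally show ?thesis by (simp add: mult.commute)
qed

lemma ndir_prime_power:
  assumes "prime p" "k \<ge> 1"
  shows "ndir (p ^ k) n = {u \<in> nvecs (p ^ k) n. \<exists>i<n. \<not> p dvd u i}"
proof -
  have "r = p" if "prime r" "r dvd p ^ k" for r
    using that assms by (metis prime_dvd_power primes_dvd_imp_eq)
  moreover have "p dvd p ^ k" using assms by simp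
  ultimately show ?thesis unfolding ndir_def using assms(1) by blast
qed

lemma coprime_prime_power: "prime (p::nat) \<Longrightarrow> \<not> p dvd x \<Longrightarrow> coprime x (p ^ k)"
  by (metis coprime_commute coprime_power_right_iff prime_imp_coprime)

text \<open>Multiplication by \<open>p\<close> is
  \<open>x \<mapsto> lin (p ^ k) n x (p - 1) x\<close> and so commutes with \<open>g\<close>. If
  \<open>g u = p x\<close> and \<open>x = g y\<close>, then \<open>u = p y\<close> would not be a
  direction.\<close>

lemma linear_bijections_ndir:
  assumes "prime p" "k \<ge> 1" "g \<in> linear_bijections (p ^ k) n" "u \<in> ndir (p ^ k) n"
  shows "g u \<in> ndir (p ^ k) n"
proof -
  let ?q = "p ^ k" and ?X = "nvecs (p ^ k) n"
  note G = linear_bijectionsD[OF assms(3)]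
  have u: "u \<in> ?X" "\<exists>i<n. \<not> p dvd u i" using assms(4) by (auto simp: ndir_prime_power[OF assms(1,2)])
  have p: "p > 1" using assms(1) by (rule prime_gt_1_nat)
  have False if dvd: "\<forall>i<n. p dvd g u i"
  proof -
    define x where "x = (\<lambda>i\<in>{..<n}. g u i div p)"
    have lt: "g u i < ?q" if "i < n" for i using nvecs_less[OF G(2)[OF u(1)] that] .
    have x: "x \<in> ?X" unfolding x_def
      using lt by (intro restrict_in_nvecs) (meson div_le_dividend le_less_trans)
    have "x + (p - 1) * x = p * x" for x using p by (cases p) auto
    then have "lin ?q n x (p - 1) x = g u"
      using p lt dvd by (intro nvecs_eqI[OF lin_in_nvecs G(2)[OF u(1)]]) (auto simp: lin_def x_def)
    moreover obtain y where y: "y \<in> ?X" "g y = x" using x G(1) by (metis bij_betw_iff_bijections)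
    ultimately have "g (lin ?q n y (p - 1) y) = g u" using G(3)[OF y(1) y(1)] by simp
    then have "lin ?q n y (p - 1) y = u"
      using G(1) u(1) lin_in_nvecs[of ?q n y "p - 1" y] p by (auto simp: bij_betw_def dest: inj_onD)
    moreover have "p dvd lin ?q n y (p - 1) y i" if "i < n" for i
    proof -
      have "y i + (p - 1) * y i = p * y i" using p by (cases p) auto
      then show ?thesis using that assms(2) by (simp add: lin_def dvd_mod)
    qed
    ultimately show False using u(2) by auto
  qed
  then show ?thesis using G(2)[OF u(1)] by (auto simp: ndir_prime_power[OF assms(1,2)])
qed

section \<open>Prime power moduli\<close>

lemma lin_cong:
  assumes "\<And>i. i < n \<Longrightarrow> [a i = b i] (mod N)" "\<And>i. i < n \<Longrightarrow> [u i = v i] (mod N)"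
  shows "lin N n a t u = lin N n b t v"
  unfolding lin_def
proof (rule restrict_ext)
  fix i assume "i \<in> {..<n}"
  then have "[a i + t * u i = b i + t * v i] (mod N)"
    using assms by (intro cong_add cong_mult cong_refl) simp_all
  then show "(a i + t * u i) mod N = (b i + t * v i) mod N" by (simp add: cong_def)
qed

lemma cost_le:
  assumes "prime p" "\<gamma> \<in> simplex n (Suc d)" "d < p ^ l"
  shows "cost p n \<gamma> \<le> l * d"
proof -
  have sum: "(\<Sum>i<n. \<gamma> i) \<le> d" using assms(2) by (simp add: simplex_def)
  have "cost1 p (\<gamma> i) \<le> l * \<gamma> i" if "i \<in> {..<n}" for i
  proof (rule cost1_le[OF assms(1)])
    have "\<gamma> i \<le> (\<Sum>i<n. \<gamma> i)" using that by (intro member_le_sum) simp_all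
    then show "\<gamma> i < p ^ l" using sum assms(3) by linarith
  qed
  then have "cost p n \<gamma> \<le> (\<Sum>i<n. l * \<gamma> i)" unfolding cost_def by (rule sum_mono)
  also have "\<dots> \<le> l * d" using sum by (simp flip: sum_distrib_left)
  finally show ?thesis .
qed

text \<open>Degree at most \<open>d\<close> costs at most \<open>l d\<close>, and
  \<open>d = (n m - 1) div l\<close> is the largest degree for which this stays below
  \<open>n m\<close>. The choice \<open>l = k + c\<close> gives \<open>n p ^ k \<le> p ^ l\<close>,
  hence \<open>d < p ^ l\<close>, as the linear cost bound requires.\<close>

lemma card_low_cost:
  fixes p k c n m :: nat
  assumes "prime p" "n \<ge> 1" "k \<ge> 1" "n \<le> p ^ c" "m \<le> p ^ k"
  shows "(real m / (2 * real (k + c))) ^ n * real (card (simplex n n))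
    \<le> real (card {\<gamma> \<in> simplex n (Suc (n * p ^ k)). cost p n \<gamma> < n * m})"
proof (cases "m = 0")
  case True
  then show ?thesis using assms(2) by (simp add: power_0_left)
next
  case False
  define l where "l = k + c"
  define d where "d = (n * m - 1) div l"
  have l: "l > 0" using assms(3) by (simp add: l_def)
  have nm: "n * m > 0" using False assms(2) by simp
  have "l * d \<le> n * m - 1" unfolding d_def by (rule times_div_less_eq_dividend)
  then have dl: "l * d < n * m" using nm by linarith
  have "n * m - 1 < Suc d * l" unfolding d_def using l by (simp add: dividend_less_div_times)
  then have cover: "n * m \<le> Suc d * l" by linarith
  have "d \<le> n * m - 1" unfolding d_def by (rule div_le_dividend)
  then have d_le: "d < n * m" using nm by linarith
  have "n * m \<le> n * p ^ k" using assms(5) by simp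
  moreover have "n * p ^ k \<le> p ^ l" using assms(4) by (simp add: l_def power_add mult.commute)
  ultimately have d: "d < n * p ^ k" "d < p ^ l" using d_le by linarith+
  have "(real m / (2 * real l)) ^ n * real (card (simplex n n)) \<le> real (card (simplex n (Suc d)))"
    using assms(2) l cover by (intro card_simplex_ratio) simp_all
  also have "simplex n (Suc d) \<subseteq> {\<gamma> \<in> simplex n (Suc (n * p ^ k)). cost p n \<gamma> < n * m}"
  proof
    fix \<gamma> assume \<gamma>: "\<gamma> \<in> simplex n (Suc d)"
    have "\<gamma> \<in> simplex n (Suc (n * p ^ k))" using \<gamma> simplex_mono[of "Suc d" "Suc (n * p ^ k)" n] d(1) by (meson Suc_le_mono less_imp_le subsetD)
    moreover have "cost p n \<gamma> < n * m" using cost_le[OF assms(1) \<gamma> d(2)] dl by linarith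
    ultimately show "\<gamma> \<in> {\<gamma> \<in> simplex n (Suc (n * p ^ k)). cost p n \<gamma> < n * m}" by simp
  qed
  then have "real (card (simplex n (Suc d))) \<le> real (card {\<gamma> \<in> simplex n (Suc (n * p ^ k)). cost p n \<gamma> < n * m})"
    by (simp add: card_mono)
  finally show ?thesis by (simp add: l_def)
qed

lemma card_filter_eq_sum: "finite A \<Longrightarrow> card {x \<in> A. P x} = (\<Sum>x\<in>A. if P x then 1 else 0)"
  by (simp add: sum.If_cases Int_def)

lemma sum_card_swap:
  "finite A \<Longrightarrow> finite B \<Longrightarrow> (\<Sum>x\<in>A. card {y \<in> B. P x y}) = (\<Sum>y\<in>B. card {x \<in> A. P x y})"
  by (simp only: card_filter_eq_sum sum.swap[of _ B A])

text \<open>Pulling \<open>S\<close> back along a linear bijection \<open>g\<close> moves the rich line in direction \<open>g u\<close>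
  to direction \<open>u\<close>, so the rank bound holds with the line counts permuted by \<open>g\<close>.\<close>

lemma rank_bound_linear_bijection:
  assumes p: "prime p" "k \<ge> 1" and S: "S \<subseteq> nvecs (p ^ k) n" and V: "finite V"
    and nonsing: "\<not> int p dvd leib V (\<lambda>\<gamma> v. int (dot n (u \<gamma>) v choose j \<gamma>))"
    and g: "g \<in> linear_bijections (p ^ k) n"
  defines "w \<equiv> \<lambda>\<gamma>. g (\<lambda>i\<in>{..<n}. u \<gamma> i mod p ^ k)"
  shows "card {\<gamma> \<in> V. j \<gamma> < n * kcount (p ^ k) n S (a (w \<gamma>)) (w \<gamma>)} \<le> card S * card (simplex n n)"
proof -
  let ?q = "p ^ k" and ?X = "nvecs (p ^ k) n"
  define T where "T = {x \<in> ?X. g x \<in> S}"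
  have q: "?q > 0" using p by (simp add: prime_gt_0_nat)
  note G = linear_bijectionsD[OF g]
  have "finite T" "finite S" using finite_subset[OF S] by (simp_all add: T_def)
  have "card T \<le> card S"
    using G(1) \<open>finite S\<close> by (intro card_inj_on_le[of g]) (auto simp: T_def bij_betw_def inj_on_def)
  have "card {\<gamma> \<in> V. j \<gamma> < n * kcount ?q n S (a (w \<gamma>)) (w \<gamma>)} \<le> card T * card (simplex n n)"
  proof (rule rank_bound[OF p V \<open>finite T\<close> _ nonsing])
    fix \<gamma> assume \<gamma>: "\<gamma> \<in> {\<gamma> \<in> V. j \<gamma> < n * kcount ?q n S (a (w \<gamma>)) (w \<gamma>)}"
    define u' where "u' = (\<lambda>i\<in>{..<n}. u \<gamma> i mod ?q)"
    define b where "b = (\<lambda>i\<in>{..<n}. a (w \<gamma>) i mod ?q)"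
    have u': "u' \<in> ?X" and b: "b \<in> ?X" unfolding u'_def b_def using q by (simp_all add: restrict_in_nvecs)
    have "b \<in> g ` ?X" using G(1) b by (simp add: bij_betw_def)
    then obtain a' where a': "a' \<in> ?X" "g a' = b" by blast
    have "lin ?q n a' t (u \<gamma>) \<in> T \<longleftrightarrow> lin ?q n (a (w \<gamma>)) t (w \<gamma>) \<in> S" for t
    proof -
      have "lin ?q n a' t (u \<gamma>) = lin ?q n a' t u'" by (rule lin_cong) (simp_all add: u'_def cong_def)
      then have "g (lin ?q n a' t (u \<gamma>)) = lin ?q n b t (w \<gamma>)" using G(3)[OF a'(1) u'] a'(2) by (simp add: w_def u'_def)
      also have "\<dots> = lin ?q n (a (w \<gamma>)) t (w \<gamma>)" by (rule lin_cong) (simp_all add: b_def cong_def)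
      finally show ?thesis using lin_in_nvecs[OF q] by (simp add: T_def)
    qed
    then show "\<exists>a. j \<gamma> < n * card {t. t < ?q \<and> lin ?q n a t (u \<gamma>) \<in> T}"
      using \<gamma> by (intro exI[of _ a']) (simp add: kcount_def)
  qed blast
  also have "\<dots> \<le> card S * card (simplex n n)" using \<open>card T \<le> card S\<close> by (rule mult_right_mono) simp
  finally show ?thesis .
qed

text \<open>Count pairs of \<gamma> and a linear bijection \<open>g\<close> for which the direction
  \<open>g (u' \<gamma>)\<close> is rich enough for the row \<gamma>. For fixed \<open>g\<close>
  this is the rank bound; for fixed \<gamma> the vector \<open>g (u' \<gamma>)\<close> is uniform
  over all directions. The number \<open>A\<close> of monomials of degree below \<open>n\<close>
  cancels at the end.\<close>

theorem kakeya_const_prime_power: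
  fixes p k c n :: nat
  assumes p: "prime p" "k \<ge> 1" and n: "n \<ge> 1" "n \<le> p ^ c"
  shows "kakeya_const (p ^ k) n ((1 / (2 * real (k + c))) ^ n)"
  unfolding kakeya_const_def
proof (intro allI impI)
  fix S a assume S: "S \<subseteq> nvecs (p ^ k) n"
  let ?q = "p ^ k" and ?X = "nvecs (p ^ k) n" and ?G = "linear_bijections (p ^ k) n" and ?D = "ndir (p ^ k) n"
  \<comment> \<open>Large enough for the exponents supplied by \<open>card_low_cost\<close> at every
    \<open>m \<le> p ^ k\<close>, so that one nonsingular matrix serves all line counts at
    once.\<close>
  define V where "V = simplex n (Suc (n * ?q))"
  have q: "?q > 0" using p by (simp add: prime_gt_0_nat)
  obtain u j where u: "\<And>\<gamma>. \<gamma> \<in> V \<Longrightarrow> \<exists>i<n. \<not> p dvd u \<gamma> i" and j: "\<And>\<gamma>. \<gamma> \<in> V \<Longrightarrow> j \<gamma> \<le> cost p n \<gamma>"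
    and nonsing: "\<not> int p dvd leib V (\<lambda>\<gamma> v. int (dot n (u \<gamma>) v choose j \<gamma>))"
    using nonsingular_directions[OF p(1) n(1), of "Suc (n * ?q)"] unfolding V_def by blast
  define u' where "u' \<gamma> = (\<lambda>i\<in>{..<n}. u \<gamma> i mod ?q)" for \<gamma>
  define m where "m w = kcount ?q n S (a w) w" for w
  define A where "A = card (simplex n n)"
  have V: "finite V" by (simp add: V_def)
  have u': "u' \<gamma> \<in> ?D" if \<gamma>: "\<gamma> \<in> V" for \<gamma>
  proof -
    obtain i where "i < n" "\<not> p dvd u \<gamma> i" using u[OF \<gamma>] by blast
    then have "\<not> p dvd u' \<gamma> i" using p(2) by (simp add: u'_def dvd_mod_iff)
    moreover have "u' \<gamma> \<in> ?X" unfolding u'_def using q by (simp add: restrict_in_nvecs)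
    ultimately show ?thesis using \<open>i < n\<close> by (auto simp: ndir_prime_power[OF p])
  qed
  have reach: "reach ?q n v w" if "v \<in> ?D" "w \<in> ?D" for v w
  proof -
    have "v \<in> ?X" "w \<in> ?X" "\<exists>i<n. \<not> p dvd v i" "\<exists>i<n. \<not> p dvd w i"
      using that by (simp_all add: ndir_prime_power[OF p])
    then show ?thesis using coprime_prime_power[OF p(1)] reach_directions[OF q] by blast
  qed
  have mapping: "card {g \<in> ?G. g v = w} * card ?D = card ?G" if "v \<in> ?D" "w \<in> ?D" for v w
    using card_linear_bijections_mapping[where D = ?D and q = ?q and n = n] q reach ndir_subset
      linear_bijections_ndir[OF p] that by simp
  have "restrict id ?X \<in> ?G" using q by (intro linear_bijectionsI) simp_all
  then have G_pos: "card ?G > 0" by (auto simp: card_gt_0_iff)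
  have fibres: "card {g \<in> ?G. j \<gamma> < n * m (g (u' \<gamma>))} * card ?D = card {w \<in> ?D. j \<gamma> < n * m w} * card ?G"
    if \<gamma>: "\<gamma> \<in> V" for \<gamma>
  proof -
    let ?W = "{w \<in> ?D. j \<gamma> < n * m w}"
    have "{g \<in> ?G. j \<gamma> < n * m (g (u' \<gamma>))} = (\<Union>w\<in>?W. {g \<in> ?G. g (u' \<gamma>) = w})"
      using linear_bijections_ndir[OF p _ u'[OF \<gamma>]] by blast
    then have "card {g \<in> ?G. j \<gamma> < n * m (g (u' \<gamma>))} = (\<Sum>w\<in>?W. card {g \<in> ?G. g (u' \<gamma>) = w})"
      by (simp only:, intro card_UN_disjoint) auto
    then have "card {g \<in> ?G. j \<gamma> < n * m (g (u' \<gamma>))} * card ?D = (\<Sum>w\<in>?W. card {g \<in> ?G. g (u' \<gamma>) = w} * card ?D)"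
      by (simp add: sum_distrib_right)
    also have "\<dots> = (\<Sum>w\<in>?W. card ?G)" using mapping[OF u'[OF \<gamma>]] by (intro sum.cong) simp_all
    finally show ?thesis by simp
  qed
  have "(\<Sum>w\<in>?D. card {\<gamma> \<in> V. cost p n \<gamma> < n * m w}) * card ?G
      = (\<Sum>\<gamma>\<in>V. card {w \<in> ?D. cost p n \<gamma> < n * m w} * card ?G)"
    by (simp only: sum_card_swap[OF finite_ndir V] sum_distrib_right)
  also have "\<dots> \<le> (\<Sum>\<gamma>\<in>V. card {w \<in> ?D. j \<gamma> < n * m w} * card ?G)"
  proof (intro sum_mono mult_right_mono card_mono)
    fix \<gamma> assume "\<gamma> \<in> V"
    then show "{w \<in> ?D. cost p n \<gamma> < n * m w} \<subseteq> {w \<in> ?D. j \<gamma> < n * m w}" using j by fastforce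
  qed simp_all
  also have "\<dots> = (\<Sum>\<gamma>\<in>V. card {g \<in> ?G. j \<gamma> < n * m (g (u' \<gamma>))} * card ?D)"
    using fibres by (intro sum.cong) simp_all
  also have "\<dots> = (\<Sum>g\<in>?G. card {\<gamma> \<in> V. j \<gamma> < n * m (g (u' \<gamma>))}) * card ?D"
    by (simp only: sum_card_swap[OF finite_linear_bijections V] sum_distrib_right)
  also have "\<dots> \<le> (\<Sum>g\<in>?G. card S * A) * card ?D"
  proof (intro mult_right_mono sum_mono)
    fix g assume "g \<in> ?G"
    from rank_bound_linear_bijection[OF p S V nonsing this, of a]
    show "card {\<gamma> \<in> V. j \<gamma> < n * m (g (u' \<gamma>))} \<le> card S * A" by (simp add: m_def u'_def A_def)
  qed simp
  also have "\<dots> = (card S * A * card ?D) * card ?G" by simp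
  finally have count: "(\<Sum>w\<in>?D. card {\<gamma> \<in> V. cost p n \<gamma> < n * m w}) \<le> card S * A * card ?D"
    using G_pos by simp
  have "(1 / (2 * real (k + c))) ^ n * (\<Sum>w\<in>?D. real (m w) ^ n) * real A
      = (\<Sum>w\<in>?D. (real (m w) / (2 * real (k + c))) ^ n * real A)"
    by (simp add: sum_distrib_left sum_distrib_right sum_divide_distrib power_divide mult_ac)
  also have "\<dots> \<le> (\<Sum>w\<in>?D. real (card {\<gamma> \<in> V. cost p n \<gamma> < n * m w}))"
    unfolding A_def V_def
    by (intro sum_mono card_low_cost p n) (simp add: m_def kcount_le)
  also have "\<dots> \<le> real (card S * A * card ?D)" using count by (simp only: of_nat_le_iff flip: of_nat_sum)
  finally have "(1 / (2 * real (k + c))) ^ n * (\<Sum>w\<in>?D. real (m w) ^ n) * real A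
      \<le> real (card S) * real (card ?D) * real A" by (simp add: mult_ac)
  moreover have "A > 0"
    using n(1) card_simplex[of n "n - 1"] by (simp add: A_def)
  ultimately show "(1 / (2 * real (k + c))) ^ n * (\<Sum>w\<in>?D. real (kcount ?q n S (a w) w) ^ n)
      \<le> real (card S) * real (card ?D)"
    by (simp add: m_def)
qed

section \<open>Coprime products of moduli\<close>

text \<open>In decreasing order the \<open>i\<close>-th value is at most \<open>X / i\<close>. The
  induction removes the smallest value, which is at most \<open>X / card T\<close> because all of
  \<open>T\<close> lies at or above it.\<close>

lemma sum_le_harmonic:
  fixes \<phi> :: "'t \<Rightarrow> nat" and X :: real
  assumes "finite T" and "\<And>b. b \<ge> 1 \<Longrightarrow> real b * real (card {t \<in> T. b \<le> \<phi> t}) \<le> X" and "X \<ge> 0"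
  shows "(\<Sum>t\<in>T. real (\<phi> t)) \<le> X * (\<Sum>i=1..card T. 1 / real i)"
  using assms(1,2)
proof (induction "card T" arbitrary: T)
  case 0
  then show ?case by simp
next
  case (Suc c)
  then have "T \<noteq> {}" by auto
  define x where "x = Min (\<phi> ` T)"
  have "x \<in> \<phi> ` T" using Suc.prems(1) \<open>T \<noteq> {}\<close> by (simp add: x_def)
  then obtain t where t: "t \<in> T" "\<phi> t = x" by blast
  have min: "x \<le> \<phi> s" if "s \<in> T" for s using that Suc.prems(1) by (simp add: x_def)
  have "real x * real (Suc c) \<le> X"
  proof (cases "x = 0")
    case False
    have "{s \<in> T. x \<le> \<phi> s} = T" using min by blast
    then show ?thesis using Suc.prems(2)[of x] False Suc.hyps(2) by simp
  qed (simp add: assms(3))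
  then have x_le: "real x \<le> X * (1 / real (Suc c))" by (simp add: field_simps)
  have c: "card (T - {t}) = c" using t Suc.hyps(2) Suc.prems(1) by simp
  have "(\<Sum>s\<in>T - {t}. real (\<phi> s)) \<le> X * (\<Sum>i=1..card (T - {t}). 1 / real i)"
  proof (rule Suc.hyps(1))
    fix b :: nat assume "b \<ge> 1"
    have "card {s \<in> T - {t}. b \<le> \<phi> s} \<le> card {s \<in> T. b \<le> \<phi> s}"
      using Suc.prems(1) by (intro card_mono) auto
    then have "real b * real (card {s \<in> T - {t}. b \<le> \<phi> s}) \<le> real b * real (card {s \<in> T. b \<le> \<phi> s})"
      by (intro mult_left_mono) simp_all
    then show "real b * real (card {s \<in> T - {t}. b \<le> \<phi> s}) \<le> X"
      using Suc.prems(2)[OF \<open>b \<ge> 1\<close>] by linarith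
  qed (simp_all add: c Suc.prems)
  then have "(\<Sum>s\<in>T. real (\<phi> s)) \<le> X * (1 / real (Suc c)) + X * (\<Sum>i=1..c. 1 / real i)"
    using x_le t c sum.remove[OF Suc.prems(1) t(1), of "\<lambda>s. real (\<phi> s)"] by simp
  also have "\<dots> = X * (\<Sum>i=1..card T. 1 / real i)"
    unfolding Suc.hyps(2)[symmetric] by (simp add: distrib_left)
  finally show ?case .
qed

lemma harmonic_le_ln:
  assumes "q \<ge> 1"
  shows "(\<Sum>i=1..q. 1 / real i) \<le> 1 + ln (real q)"
  using assms
proof (induction q rule: dec_induct)
  case (step q)
  have "ln (real q / real (Suc q)) \<le> real q / real (Suc q) - 1"
    using step.hyps by (intro ln_le_minus_one) simp
  also have "real q / real (Suc q) - 1 = - (1 / real (Suc q))" by (simp add: field_simps)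
  finally have "1 / real (Suc q) \<le> ln (real (Suc q)) - ln (real q)" using step.hyps by (simp add: ln_div)
  then show ?case using step.IH by simp
qed simp

text \<open>Weights of the discrete layer-cake formula: summed over the levels reached by a value,
  they telescope to its \<open>n\<close>-th power.\<close>

definition layer :: "nat \<Rightarrow> nat \<Rightarrow> real" where
  "layer n b = real b ^ n - real (b - 1) ^ n"

lemma layer_nonneg: "layer n b \<ge> 0"
  by (simp add: layer_def power_mono)

lemma power_eq_sum_layers:
  assumes "n \<ge> 1"
  shows "real x ^ n = (\<Sum>b=1..x. layer n b)"
proof (induction x)
  case 0
  then show ?case using assms by (simp add: power_0_left)
qed (simp add: layer_def)

text \<open>The level counts \<open>k b\<close> decrease in \<open>b\<close> and the layers up to
  \<open>b\<close> sum to \<open>b ^ n\<close>, so \<open>(b k b) ^ n \<le> Y\<close>. This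
  weak-type bound becomes a bound for the sum through the harmonic series.\<close>

lemma power_sum_le_layers:
  fixes \<phi> :: "'t \<Rightarrow> nat"
  assumes n: "n \<ge> 1" and T: "finite T" "card T \<ge> 1" and B: "\<And>t. t \<in> T \<Longrightarrow> \<phi> t \<le> B"
  shows "(\<Sum>t\<in>T. real (\<phi> t)) ^ n
    \<le> (1 + ln (real (card T))) ^ n * (\<Sum>b=1..B. layer n b * real (card {t \<in> T. b \<le> \<phi> t}) ^ n)"
proof -
  define k where "k b = card {t \<in> T. b \<le> \<phi> t}" for b
  define Y where "Y = (\<Sum>b=1..B. layer n b * real (k b) ^ n)"
  have Y0: "Y \<ge> 0" unfolding Y_def by (intro sum_nonneg mult_nonneg_nonneg layer_nonneg) simp
  have root: "root n Y \<ge> 0" "root n Y ^ n = Y" using n Y0 by (simp_all add: real_root_ge_zero)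
  have "real b * real (k b) \<le> root n Y" if "b \<ge> 1" for b
  proof (cases "b \<le> B")
    case True
    have "(real b * real (k b)) ^ n = (\<Sum>c=1..b. layer n c * real (k b) ^ n)"
      by (simp add: power_mult_distrib power_eq_sum_layers[OF n] sum_distrib_right)
    also have "\<dots> \<le> (\<Sum>c=1..b. layer n c * real (k c) ^ n)"
    proof (intro sum_mono mult_left_mono power_mono layer_nonneg)
      fix c assume "c \<in> {1..b}"
      then have "k b \<le> k c" unfolding k_def using T(1) by (intro card_mono) auto
      then show "real (k b) \<le> real (k c)" by simp
    qed simp
    also have "\<dots> \<le> Y" unfolding Y_def using True
      by (intro sum_mono2 mult_nonneg_nonneg layer_nonneg) auto
    finally have "root n ((real b * real (k b)) ^ n) \<le> root n Y" using n by simp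
    then show ?thesis using n by (simp add: real_root_power_cancel)
  next
    case False
    then have "{t \<in> T. b \<le> \<phi> t} = {}" using B by fastforce
    then have "k b = 0" unfolding k_def by (simp only: card.empty)
    then show ?thesis using root(1) by simp
  qed
  then have "(\<Sum>t\<in>T. real (\<phi> t)) \<le> root n Y * (\<Sum>i=1..card T. 1 / real i)"
    using T(1) root(1) by (intro sum_le_harmonic) (simp_all add: k_def)
  also have "\<dots> \<le> root n Y * (1 + ln (real (card T)))"
    using root(1) by (intro mult_left_mono harmonic_le_ln T)
  finally have "(\<Sum>t\<in>T. real (\<phi> t)) ^ n \<le> (root n Y * (1 + ln (real (card T)))) ^ n"
    by (rule power_mono) (simp add: sum_nonneg)
  also have "\<dots> = (1 + ln (real (card T))) ^ n * Y"
    by (simp add: power_mult_distrib root(2))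
  finally show ?thesis by (simp add: Y_def k_def)
qed

section \<open>The Chinese remainder theorem for vectors, directions and lines\<close>

definition vmod :: "nat \<Rightarrow> nat \<Rightarrow> (nat \<Rightarrow> nat) \<Rightarrow> (nat \<Rightarrow> nat)" where
  "vmod M n x = (\<lambda>i\<in>{..<n}. x i mod M)"

lemma vmod_in_nvecs: "M > 0 \<Longrightarrow> vmod M n x \<in> nvecs M n"
  unfolding vmod_def by (simp add: restrict_in_nvecs)

lemma vmod_lin:
  assumes "M dvd N"
  shows "vmod M n (lin N n a t u) = lin M n a (t mod M) (vmod M n u)"
  unfolding vmod_def lin_def
proof (rule restrict_ext)
  fix i assume i: "i \<in> {..<n}"
  have "[a i + t * u i = a i + (t mod M) * (u i mod M)] (mod M)"
    by (intro cong_add cong_mult cong_refl) (simp_all add: cong_def)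
  then show "(\<lambda>i\<in>{..<n}. (a i + t * u i) mod N) i mod M
      = (a i + t mod M * (\<lambda>i\<in>{..<n}. u i mod M) i) mod M"
    using i assms by (simp add: mod_mod_cancel cong_def)
qed

lemma bij_betw_vmod:
  assumes "coprime M M'" "M > 0" "M' > 0"
  shows "bij_betw (\<lambda>x. (vmod M n x, vmod M' n x)) (nvecs (M * M') n) (nvecs M n \<times> nvecs M' n)"
proof -
  let ?f = "\<lambda>x. (vmod M n x, vmod M' n x)"
  have inj: "inj_on ?f (nvecs (M * M') n)"
  proof (rule inj_onI)
    fix x y assume xy: "x \<in> nvecs (M * M') n" "y \<in> nvecs (M * M') n" "?f x = ?f y"
    show "x = y"
    proof (rule nvecs_eqI[OF xy(1,2)])
      fix i assume i: "i < n"
      from xy(3) have "vmod M n x i = vmod M n y i" "vmod M' n x i = vmod M' n y i" by simp_all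
      then have "[x i = y i] (mod M)" "[x i = y i] (mod M')" using i by (simp_all add: vmod_def cong_def)
      then have "[x i = y i] (mod M * M')" using assms(1) by (simp add: coprime_cong_mult_nat)
      then show "x i = y i" using nvecs_less[OF xy(1) i] nvecs_less[OF xy(2) i] by (simp add: cong_def)
    qed
  qed
  have card: "card (nvecs K n) = K ^ n" for K by (simp add: nvecs_def card_PiE)
  have "?f ` nvecs (M * M') n = nvecs M n \<times> nvecs M' n"
  proof (rule card_subset_eq)
    show "?f ` nvecs (M * M') n \<subseteq> nvecs M n \<times> nvecs M' n"
      using assms by (simp add: image_subset_iff vmod_in_nvecs)
    show "card (?f ` nvecs (M * M') n) = card (nvecs M n \<times> nvecs M' n)"
      by (simp add: card_image[OF inj] card card_cartesian_product power_mult_distrib)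
  qed simp
  then show ?thesis using inj by (simp add: bij_betw_def)
qed

lemma ndir_mult:
  assumes "coprime M M'" "M > 0" "M' > 0" "x \<in> nvecs (M * M') n"
  shows "x \<in> ndir (M * M') n \<longleftrightarrow> vmod M n x \<in> ndir M n \<and> vmod M' n x \<in> ndir M' n"
proof -
  have vmod: "(\<exists>i<n. \<not> r dvd vmod K n x i) \<longleftrightarrow> (\<exists>i<n. \<not> r dvd x i)" if "r dvd K" for r K
    using that by (auto simp: vmod_def dvd_mod_iff)
  have "r dvd M * M' \<longleftrightarrow> r dvd M \<or> r dvd M'" if "prime r" for r
    using that by (rule prime_dvd_mult_iff)
  then show ?thesis
    unfolding ndir_def using assms vmod by (simp add: vmod_in_nvecs) blast
qed

lemma bij_betw_ndir:
  assumes "coprime M M'" "M > 0" "M' > 0"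
  shows "bij_betw (\<lambda>x. (vmod M n x, vmod M' n x)) (ndir (M * M') n) (ndir M n \<times> ndir M' n)"
proof -
  let ?f = "\<lambda>x. (vmod M n x, vmod M' n x)"
  note bij = bij_betw_vmod[OF assms, of n]
  have "?f ` ndir (M * M') n = ndir M n \<times> ndir M' n"
  proof
    show "?f ` ndir (M * M') n \<subseteq> ndir M n \<times> ndir M' n"
      using ndir_mult[OF assms] ndir_subset by blast
    show "ndir M n \<times> ndir M' n \<subseteq> ?f ` ndir (M * M') n"
    proof
      fix y assume y: "y \<in> ndir M n \<times> ndir M' n"
      then have "y \<in> nvecs M n \<times> nvecs M' n" using ndir_subset by blast
      then obtain x where x: "x \<in> nvecs (M * M') n" "y = ?f x" using bij by (auto simp: bij_betw_def)
      then have "x \<in> ndir (M * M') n" using ndir_mult[OF assms x(1)] y by simp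
      then show "y \<in> ?f ` ndir (M * M') n" using x(2) by blast
    qed
  qed
  moreover have "inj_on ?f (ndir (M * M') n)"
    using bij_betw_imp_inj_on[OF bij] ndir_subset by (rule inj_on_subset)
  ultimately show ?thesis by (simp add: bij_betw_def)
qed

text \<open>The base points range over an infinite type, but the counts are at most
  \<open>N\<close>, so the maximum is attained.\<close>

definition kmax :: "nat \<Rightarrow> nat \<Rightarrow> (nat \<Rightarrow> nat) set \<Rightarrow> (nat \<Rightarrow> nat) \<Rightarrow> nat" where
  "kmax N n S u = Max (range (\<lambda>a. kcount N n S a u))"

lemma finite_range_kcount: "finite (range (\<lambda>a. kcount N n S a u))"
  by (rule finite_subset[of _ "{..N}"]) (auto simp: kcount_le)

lemma kcount_le_kmax: "kcount N n S a u \<le> kmax N n S u"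
  unfolding kmax_def by (rule Max_ge[OF finite_range_kcount]) simp

lemma kmax_attained: "\<exists>a. kmax N n S u = kcount N n S a u"
  using Max_in[OF finite_range_kcount, of N n S u] by (auto simp: kmax_def)

lemma kmax_le: "kmax N n S u \<le> N"
  using kmax_attained[of N n S u] kcount_le by metis

definition fibre :: "nat \<Rightarrow> nat \<Rightarrow> nat \<Rightarrow> (nat \<Rightarrow> nat) set \<Rightarrow> (nat \<Rightarrow> nat) \<Rightarrow> (nat \<Rightarrow> nat) set" where
  "fibre M M' n S x = vmod M' n ` {z \<in> S. vmod M n z = x}"

lemma sum_card_fibre:
  assumes "coprime M M'" "M > 0" "M' > 0" "S \<subseteq> nvecs (M * M') n"
  shows "(\<Sum>x\<in>nvecs M n. card (fibre M M' n S x)) = card S"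
proof -
  have fin: "finite S" using assms(4) finite_nvecs by (rule finite_subset)
  have "card (fibre M M' n S x) = card {z \<in> S. vmod M n z = x}" for x
    unfolding fibre_def
  proof (rule card_image, rule inj_onI)
    fix y z assume "y \<in> {z \<in> S. vmod M n z = x}" "z \<in> {z \<in> S. vmod M n z = x}" "vmod M' n y = vmod M' n z"
    then show "y = z"
      using bij_betw_imp_inj_on[OF bij_betw_vmod[OF assms(1-3), of n]] assms(4) by (auto dest!: inj_onD)
  qed
  then have "(\<Sum>x\<in>nvecs M n. card (fibre M M' n S x)) = (\<Sum>x\<in>nvecs M n. card {z \<in> S. vmod M n z = x})"
    by simp
  also have "\<dots> = card (\<Union>x\<in>nvecs M n. {z \<in> S. vmod M n z = x})"
    using fin by (intro card_UN_disjoint[symmetric]) auto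
  also have "(\<Union>x\<in>nvecs M n. {z \<in> S. vmod M n z = x}) = S"
    using vmod_in_nvecs[OF assms(2)] by blast
  finally show ?thesis .
qed

text \<open>The residue \<open>t mod M\<close> moves along the projected line and
  \<open>t mod M'\<close> along a line in the fibre above it; each fibre line is then replaced by
  the richest one in the same direction.\<close>

lemma kcount_mult_le:
  assumes "coprime M M'" "M > 0" "M' > 0"
  shows "kcount (M * M') n S a u
    \<le> (\<Sum>t<M. kmax M' n (fibre M M' n S (lin M n a t (vmod M n u))) (vmod M' n u))"
proof -
  define Q where "Q t = {t'. t' < M' \<and> lin M' n a t' (vmod M' n u) \<in> fibre M M' n S (lin M n a t (vmod M n u))}" for t
  have fin: "finite (Q t)" for t by (simp add: Q_def)
  have "card {t. t < M * M' \<and> lin (M * M') n a t u \<in> S} \<le> card (SIGMA t:{..<M}. Q t)"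
  proof (rule card_inj_on_le[of "\<lambda>t. (t mod M, t mod M')"])
    show "inj_on (\<lambda>t. (t mod M, t mod M')) {t. t < M * M' \<and> lin (M * M') n a t u \<in> S}"
    proof (rule inj_onI)
      fix s t assume st: "s \<in> {t. t < M * M' \<and> lin (M * M') n a t u \<in> S}"
        "t \<in> {t. t < M * M' \<and> lin (M * M') n a t u \<in> S}" "(s mod M, s mod M') = (t mod M, t mod M')"
      then have "[s = t] (mod M)" "[s = t] (mod M')" by (simp_all add: cong_def)
      then have "[s = t] (mod M * M')" using assms(1) by (simp add: coprime_cong_mult_nat)
      then show "s = t" using st by (simp add: cong_def)
    qed
    show "(\<lambda>t. (t mod M, t mod M')) ` {t. t < M * M' \<and> lin (M * M') n a t u \<in> S} \<subseteq> (SIGMA t:{..<M}. Q t)"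
    proof
      fix x assume "x \<in> (\<lambda>t. (t mod M, t mod M')) ` {t. t < M * M' \<and> lin (M * M') n a t u \<in> S}"
      then obtain t where t: "x = (t mod M, t mod M')" "lin (M * M') n a t u \<in> S" by blast
      have "vmod M' n (lin (M * M') n a t u) \<in> fibre M M' n S (vmod M n (lin (M * M') n a t u))"
        unfolding fibre_def using t(2) by blast
      then have "t mod M' \<in> Q (t mod M)" using assms by (simp add: Q_def vmod_lin)
      then show "x \<in> (SIGMA t:{..<M}. Q t)" using t(1) assms by simp
    qed
    show "finite (SIGMA t:{..<M}. Q t)" using fin by (intro finite_SigmaI) simp_all
  qed
  also have "\<dots> = (\<Sum>t<M. card (Q t))" using fin by (simp add: card_SigmaI)
  also have "\<dots> \<le> (\<Sum>t<M. kmax M' n (fibre M M' n S (lin M n a t (vmod M n u))) (vmod M' n u))"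
    by (intro sum_mono) (simp only: Q_def kcount_le_kmax flip: kcount_def)
  finally show ?thesis by (simp add: kcount_def)
qed

text \<open>Slicing the first factor by the level sets of \<open>x \<mapsto> kmax (fibre x)\<close> turns the bound for
  sets over \<open>M\<close> into a bound for weights; the harmonic sum is the price.\<close>

theorem kakeya_const_mult:
  assumes cop: "coprime M M'" and pos: "M > 0" "M' > 0" and n: "n \<ge> 1"
    and C: "C \<ge> 0" "kakeya_const M n C" and C': "C' \<ge> 0" "kakeya_const M' n C'"
  shows "kakeya_const (M * M') n (C * C' / (1 + ln (real M)) ^ n)"
  unfolding kakeya_const_def
proof (intro allI impI)
  fix S and a :: "(nat \<Rightarrow> nat) \<Rightarrow> nat \<Rightarrow> nat" assume S: "S \<subseteq> nvecs (M * M') n"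
  let ?D = "ndir (M * M') n" and ?D1 = "ndir M n" and ?D2 = "ndir M' n" and ?X = "nvecs M n"
  define F where "F = fibre M M' n S"
  define \<phi> where "\<phi> v x = kmax M' n (F x) v" for v x
  define f where "f x = (vmod M n x, vmod M' n x)" for x
  \<comment> \<open>The base point depends on both components of the direction. For fixed
    \<open>v\<close>, the function \<open>\<lambda>u. b (u, v)\<close> is an admissible choice of
    lines over \<open>M\<close>.\<close>
  define b where "b y = a (inv_into ?D f y)" for y
  define G where "G y = (\<Sum>t<M. \<phi> (snd y) (lin M n (b y) t (fst y)))" for y
  define L where "L = (1 + ln (real M)) ^ n"
  have "ln (real M) \<ge> 0" using pos(1) by simp
  then have L: "L > 0" by (simp add: L_def)
  have bij: "bij_betw f ?D (?D1 \<times> ?D2)"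
    unfolding f_def[abs_def] by (rule bij_betw_ndir[OF cop pos])
  have F_sub: "F x \<subseteq> nvecs M' n" for x
    unfolding F_def fibre_def using vmod_in_nvecs[OF pos(2)] by blast
  have fibres: "C' * (\<Sum>v\<in>?D2. real (\<phi> v x) ^ n) \<le> real (card (F x)) * real (card ?D2)" for x
  proof -
    obtain \<alpha> where "\<And>v. kmax M' n (F x) v = kcount M' n (F x) (\<alpha> v) v"
      using kmax_attained by metis
    then show ?thesis using C'(2) F_sub[of x] unfolding kakeya_const_def \<phi>_def by simp
  qed
  \<comment> \<open>For fixed \<open>v\<close> the hypothesis over \<open>M\<close> is applied to
    every level set \<open>Y c\<close> of the weight \<open>\<phi> v\<close>; the layer weights
    recombine the sizes of the level sets into the sum of \<open>n\<close>-th powers.\<close>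
  have base: "C * (\<Sum>u\<in>?D1. real (G (u, v)) ^ n) \<le> L * ((\<Sum>x\<in>?X. real (\<phi> v x) ^ n) * real (card ?D1))" for v
  proof -
    define Y where "Y c = {x \<in> ?X. c \<le> \<phi> v x}" for c
    have level: "C * (\<Sum>u\<in>?D1. real (kcount M n (Y c) (b (u, v)) u) ^ n) \<le> real (card (Y c)) * real (card ?D1)" for c
    proof -
      have "Y c \<subseteq> ?X" by (auto simp: Y_def)
      with C(2) show ?thesis unfolding kakeya_const_def by (elim allE[of _ "Y c"] allE[of _ "\<lambda>u. b (u, v)"]) simp
    qed
    have G_le: "real (G (u, v)) ^ n \<le> L * (\<Sum>c=1..M'. layer n c * real (kcount M n (Y c) (b (u, v)) u) ^ n)" for u
    proof -
      have "kcount M n (Y c) (b (u, v)) u = card {t \<in> {..<M}. c \<le> \<phi> v (lin M n (b (u, v)) t u)}" for c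
        unfolding kcount_def Y_def using lin_in_nvecs[OF pos(1)] by (intro arg_cong[of _ _ card]) auto
      moreover have "(\<Sum>t<M. real (\<phi> v (lin M n (b (u, v)) t u))) ^ n
          \<le> (1 + ln (real (card {..<M}))) ^ n * (\<Sum>c=1..M'. layer n c * real (card {t \<in> {..<M}. c \<le> \<phi> v (lin M n (b (u, v)) t u)}) ^ n)"
        using n pos by (intro power_sum_le_layers) (simp_all add: \<phi>_def kmax_le)
      ultimately show ?thesis by (simp add: G_def L_def)
    qed
    have "C * (\<Sum>u\<in>?D1. real (G (u, v)) ^ n)
        \<le> C * (\<Sum>u\<in>?D1. L * (\<Sum>c=1..M'. layer n c * real (kcount M n (Y c) (b (u, v)) u) ^ n))"
      using C(1) G_le by (intro mult_left_mono sum_mono)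
    also have "\<dots> = L * (\<Sum>c=1..M'. layer n c * (C * (\<Sum>u\<in>?D1. real (kcount M n (Y c) (b (u, v)) u) ^ n)))"
      by (subst sum_distrib_left[symmetric], subst sum.swap) (simp add: sum_distrib_left mult_ac)
    also have "\<dots> \<le> L * (\<Sum>c=1..M'. layer n c * (real (card (Y c)) * real (card ?D1)))"
      using L level by (intro mult_left_mono sum_mono layer_nonneg) simp_all
    also have "(\<Sum>c=1..M'. layer n c * (real (card (Y c)) * real (card ?D1)))
        = (\<Sum>c=1..M'. layer n c * real (card (Y c))) * real (card ?D1)"
      by (simp add: sum_distrib_right mult.assoc)
    also have "(\<Sum>c=1..M'. layer n c * real (card (Y c))) = (\<Sum>x\<in>?X. real (\<phi> v x) ^ n)"
    proof -
      have "(\<Sum>c=1..M'. layer n c * real (card (Y c))) = (\<Sum>c=1..M'. \<Sum>x\<in>?X. if c \<le> \<phi> v x then layer n c else 0)"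
        unfolding Y_def by (intro sum.cong refl) (simp add: sum.If_cases Int_def mult.commute)
      also have "\<dots> = (\<Sum>x\<in>?X. \<Sum>c=1..M'. if c \<le> \<phi> v x then layer n c else 0)" by (rule sum.swap)
      also have "\<dots> = (\<Sum>x\<in>?X. real (\<phi> v x) ^ n)"
      proof (intro sum.cong refl)
        fix x
        have "{1..M'} \<inter> {c. c \<le> \<phi> v x} = {1..\<phi> v x}" using kmax_le[of M' n "F x" v] by (auto simp: \<phi>_def)
        then show "(\<Sum>c=1..M'. if c \<le> \<phi> v x then layer n c else 0) = real (\<phi> v x) ^ n"
          by (simp add: sum.If_cases power_eq_sum_layers[OF n])
      qed
      finally show ?thesis .
    qed
    finally show ?thesis .
  qed
  have "(\<Sum>u\<in>?D. real (kcount (M * M') n S (a u) u) ^ n) \<le> (\<Sum>u\<in>?D. real (G (f u)) ^ n)"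
  proof (intro sum_mono power_mono)
    fix u assume u: "u \<in> ?D"
    have "b (f u) = a u" using bij u by (simp add: b_def bij_betw_def)
    then have "kcount (M * M') n S (a u) u \<le> G (f u)"
      using kcount_mult_le[OF cop pos, of n S "a u" u] by (simp add: G_def \<phi>_def F_def f_def)
    then show "real (kcount (M * M') n S (a u) u) \<le> real (G (f u))" by (simp only: of_nat_le_iff)
  qed simp
  also have "\<dots> = (\<Sum>y\<in>?D1 \<times> ?D2. real (G y) ^ n)"
    by (rule sum.reindex_bij_betw[OF bij])
  also have "\<dots> = (\<Sum>v\<in>?D2. \<Sum>u\<in>?D1. real (G (u, v)) ^ n)"
    by (subst sum.swap) (simp add: sum.cartesian_product)
  finally have le: "(\<Sum>u\<in>?D. real (kcount (M * M') n S (a u) u) ^ n) \<le> (\<Sum>v\<in>?D2. \<Sum>u\<in>?D1. real (G (u, v)) ^ n)" .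
  have "C * C' * (\<Sum>u\<in>?D. real (kcount (M * M') n S (a u) u) ^ n)
      \<le> C * C' * (\<Sum>v\<in>?D2. \<Sum>u\<in>?D1. real (G (u, v)) ^ n)"
    using C(1) C'(1) le by (intro mult_left_mono) simp_all
  also have "\<dots> = C' * (\<Sum>v\<in>?D2. C * (\<Sum>u\<in>?D1. real (G (u, v)) ^ n))"
    by (simp add: sum_distrib_left mult_ac)
  also have "\<dots> \<le> C' * (\<Sum>v\<in>?D2. L * ((\<Sum>x\<in>?X. real (\<phi> v x) ^ n) * real (card ?D1)))"
    using C'(1) base by (intro mult_left_mono sum_mono)
  also have "\<dots> = L * real (card ?D1) * (\<Sum>x\<in>?X. C' * (\<Sum>v\<in>?D2. real (\<phi> v x) ^ n))"
    by (subst sum_distrib_left[symmetric, of C'], subst sum.swap) (simp add: sum_distrib_left sum_distrib_right mult_ac)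
  also have "\<dots> \<le> L * real (card ?D1) * (\<Sum>x\<in>?X. real (card (F x)) * real (card ?D2))"
    using L fibres by (intro mult_left_mono sum_mono) simp_all
  also have "\<dots> = L * real (card ?D1) * (real (\<Sum>x\<in>?X. card (F x)) * real (card ?D2))"
    by (simp add: sum_distrib_right)
  also have "(\<Sum>x\<in>?X. card (F x)) = card S"
    unfolding F_def by (rule sum_card_fibre[OF cop pos S])
  also have "L * real (card ?D1) * (real (card S) * real (card ?D2)) = real (card S) * real (card ?D) * L"
    using bij_betw_same_card[OF bij] by (simp add: card_cartesian_product)
  finally show "C * C' / (1 + ln (real M)) ^ n * (\<Sum>u\<in>?D. real (kcount (M * M') n S (a u) u) ^ n)
      \<le> real (card S) * real (card ?D)"
    using L by (simp add: L_def[symmetric] divide_simps)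
qed

section \<open>The projective space over the residue ring\<close>

text \<open>The induction starts with the smallest prime \<open>p r\<close> and adds larger ones on
  the left. Each added factor enters as \<open>M\<close> and costs
  \<open>1 + ln (p s ^ k s)\<close>, so only \<open>p r\<close> carries no logarithm.\<close>

lemma kakeya_const_prod:
  fixes n r :: nat and p k :: "nat \<Rightarrow> nat"
  assumes n: "n \<ge> 1" and r: "r \<ge> 1"
    and prime: "\<And>i. i \<in> {1..r} \<Longrightarrow> prime (p i)"
    and less: "\<And>i j. i \<in> {1..r} \<Longrightarrow> j \<in> {1..r} \<Longrightarrow> i < j \<Longrightarrow> p i > p j"
    and k: "\<And>i. i \<in> {1..r} \<Longrightarrow> k i \<ge> 1"
  shows "kakeya_const (\<Prod>i=1..r. p i ^ k i) n
    (((\<Prod>j=1..r-1. 1 / (real (k j) * ln (real (p j)) + 1)) *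
     (\<Prod>i=1..r. 1 / (2 * (real (k i) + real_of_int \<lceil>log (real (p i)) (real n)\<rceil>)))) ^ n)"
proof -
  define d where "d i = 1 / (2 * (real (k i) + real_of_int \<lceil>log (real (p i)) (real n)\<rceil>))" for i
  define e where "e j = 1 / (real (k j) * ln (real (p j)) + 1)" for j
  have pp: "kakeya_const (p i ^ k i) n (d i ^ n)" "d i \<ge> 0" if i: "i \<in> {1..r}" for i
  proof -
    \<comment> \<open>The least exponent with \<open>n \<le> p i ^ c\<close>, as the prime power
      bound asks for.\<close>
    define c where "c = nat \<lceil>log (real (p i)) (real n)\<rceil>"
    have p1: "real (p i) > 1" using prime_gt_1_nat[OF prime[OF i]] by simp
    have "log (real (p i)) (real n) \<ge> 0" using p1 n by simp
    then have "real_of_int \<lceil>log (real (p i)) (real n)\<rceil> \<ge> 0" by linarith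
    then have c: "real_of_int \<lceil>log (real (p i)) (real n)\<rceil> = real c" by (simp add: c_def)
    have "real n = real (p i) powr log (real (p i)) (real n)" using p1 n by simp
    also have "\<dots> \<le> real (p i) powr real c"
    proof (rule powr_mono)
      show "log (real (p i)) (real n) \<le> real c" unfolding c[symmetric] by (rule le_of_int_ceiling)
    qed (use p1 in simp)
    also have "\<dots> = real (p i ^ c)" using p1 by (simp add: powr_realpow)
    finally have "n \<le> p i ^ c" by (simp only: of_nat_le_iff)
    then show "kakeya_const (p i ^ k i) n (d i ^ n)"
      using kakeya_const_prime_power[OF prime[OF i] k[OF i] n, of c] by (simp add: d_def c)
    show "d i \<ge> 0" by (simp add: d_def c)
  qed
  have e0: "e j \<ge> 0" if "j \<in> {1..r}" for j
    using prime_gt_1_nat[OF prime[OF that]] by (simp add: e_def)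
  define r' where "r' = r - 1"
  have "1 \<le> r" by (rule r)
  then have "kakeya_const (\<Prod>i=1..r. p i ^ k i) n (((\<Prod>j=1..r'. e j) * (\<Prod>i=1..r. d i)) ^ n)"
  proof (induction rule: inc_induct)
    case base
    then show ?case using pp(1)[of r] r by (simp add: r'_def)
  next
    case (step s)
    then have s: "s \<in> {1..r}" and sub: "{Suc s..r} \<subseteq> {1..r}" "{Suc s..r'} \<subseteq> {1..r}" "s \<le> r'" by (auto simp: r'_def)
    have pos: "p s ^ k s > 0" "(\<Prod>i=Suc s..r. p i ^ k i) > 0"
      using prime s sub by (auto intro!: prod_pos simp: prime_gt_0_nat)
    have "coprime (p s ^ k s) (\<Prod>i=Suc s..r. p i ^ k i)"
    proof (rule prod_coprime_right)
      fix i assume "i \<in> {Suc s..r}"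
      then have "i \<in> {1..r}" "p s \<noteq> p i" using sub less[OF s, of i] by auto
      then have "coprime (p s) (p i)" using prime s by (intro primes_coprime) auto
      then show "coprime (p s ^ k s) (p i ^ k i)" by simp
    qed
    moreover have "((\<Prod>j=Suc s..r'. e j) * (\<Prod>i=Suc s..r. d i)) ^ n \<ge> 0"
      using sub e0 pp(2) by (intro zero_le_power mult_nonneg_nonneg prod_nonneg) blast+
    ultimately have "kakeya_const (p s ^ k s * (\<Prod>i=Suc s..r. p i ^ k i)) n
        (d s ^ n * ((\<Prod>j=Suc s..r'. e j) * (\<Prod>i=Suc s..r. d i)) ^ n / (1 + ln (real (p s ^ k s))) ^ n)"
      using pos n pp[OF s] step.IH by (intro kakeya_const_mult) simp_all
    moreover have "d s ^ n * ((\<Prod>j=Suc s..r'. e j) * (\<Prod>i=Suc s..r. d i)) ^ n / (1 + ln (real (p s ^ k s))) ^ n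
        = ((\<Prod>j=s..r'. e j) * (\<Prod>i=s..r. d i)) ^ n"
    proof -
      have "inverse (1 + ln (real (p s ^ k s))) = e s"
        using prime_gt_0_nat[OF prime[OF s]] by (simp add: e_def ln_realpow add.commute inverse_eq_divide)
      then have "inverse ((1 + ln (real (p s ^ k s))) ^ n) = e s ^ n" by (metis power_inverse)
      moreover have "(\<Prod>j=s..r'. e j) = e s * (\<Prod>j=Suc s..r'. e j)" "(\<Prod>i=s..r. d i) = d s * (\<Prod>i=Suc s..r. d i)"
        using step.hyps sub(3) by (simp_all add: prod.atLeast_Suc_atMost)
      ultimately show ?thesis
        by (simp only: divide_inverse power_mult_distrib mult_ac)
    qed
    moreover have "p s ^ k s * (\<Prod>i=Suc s..r. p i ^ k i) = (\<Prod>i=s..r. p i ^ k i)"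
      using step.hyps by (simp add: prod.atLeast_Suc_atMost)
    ultimately show ?case by simp
  qed
  then show ?thesis by (simp add: d_def e_def r'_def)
qed

section \<open>Translation between residue vectors and natural representatives\<close>

locale kakeya_modulus =
  fixes N n :: nat
  assumes N: "N > 1"
begin

lemma residues: "residues (int N)"
  using N by (simp add: residues_def)

lemmas carrier = residues.res_carrier_eq[OF residues]
lemmas add_eq = residues.res_add_eq[OF residues]
lemmas mult_eq = residues.res_mult_eq[OF residues]
lemmas units = residues.res_units_eq[OF residues]

definition to_nat :: "(nat \<Rightarrow> int) \<Rightarrow> (nat \<Rightarrow> nat)" where
  "to_nat x = (\<lambda>i\<in>{..<n}. nat (x i))"

lemma vecsD: "x \<in> vecs N n \<Longrightarrow> i < n \<Longrightarrow> 0 \<le> x i \<and> x i < int N"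
  unfolding vecs_def by (drule PiE_mem[of _ _ _ i]) (simp_all add: carrier)

lemma vecs_eqI:
  assumes "x \<in> vecs N n" "y \<in> vecs N n" "\<And>i. i < n \<Longrightarrow> x i = y i"
  shows "x = y"
  by (rule PiE_ext[OF assms(1,2)[unfolded vecs_def]]) (simp add: assms(3))

lemma finite_vecs [simp]: "finite (vecs N n)"
  unfolding vecs_def by (simp add: finite_PiE carrier)

lemma restrict_in_vecs: "(\<lambda>i\<in>{..<n}. f i mod int N) \<in> vecs N n"
  unfolding vecs_def using N by (intro restrict_PiE_iff[THEN iffD2]) (simp add: carrier)

lemma bij_betw_to_nat: "bij_betw to_nat (vecs N n) (nvecs N n)"
proof (rule bij_betw_byWitness[where f' = "\<lambda>y. \<lambda>i\<in>{..<n}. int (y i)"])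
  show *: "to_nat ` vecs N n \<subseteq> nvecs N n"
  proof
    fix y assume "y \<in> to_nat ` vecs N n"
    then obtain x where x: "x \<in> vecs N n" "y = to_nat x" by blast
    have "nat (x i) < N" if "i < n" for i using vecsD[OF x(1) that] by linarith
    then show "y \<in> nvecs N n" unfolding x(2) to_nat_def by (intro restrict_in_nvecs)
  qed
  show **: "(\<lambda>y. \<lambda>i\<in>{..<n}. int (y i)) ` nvecs N n \<subseteq> vecs N n"
  proof
    fix x assume "x \<in> (\<lambda>y. \<lambda>i\<in>{..<n}. int (y i)) ` nvecs N n"
    then obtain y where y: "y \<in> nvecs N n" "x = (\<lambda>i\<in>{..<n}. int (y i))" by blast
    then have "x = (\<lambda>i\<in>{..<n}. int (y i) mod int N)" using nvecs_less[OF y(1)] by (intro ext) simp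
    then show "x \<in> vecs N n" using restrict_in_vecs by simp
  qed
  show "\<forall>x\<in>vecs N n. (\<lambda>i\<in>{..<n}. int (to_nat x i)) = x"
  proof
    fix x assume x: "x \<in> vecs N n"
    have "(\<lambda>i\<in>{..<n}. int (to_nat x i)) \<in> vecs N n" using * ** x by blast
    then show "(\<lambda>i\<in>{..<n}. int (to_nat x i)) = x"
      by (rule vecs_eqI[OF _ x]) (use vecsD[OF x] in \<open>simp add: to_nat_def\<close>)
  qed
  show "\<forall>y\<in>nvecs N n. to_nat (\<lambda>i\<in>{..<n}. int (y i)) = y"
  proof
    fix y assume y: "y \<in> nvecs N n"
    have "to_nat (\<lambda>i\<in>{..<n}. int (y i)) \<in> nvecs N n" using * ** y by blast
    then show "to_nat (\<lambda>i\<in>{..<n}. int (y i)) = y"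
      by (rule nvecs_eqI[OF _ y]) (simp add: to_nat_def)
  qed
qed

text \<open>A residue is a unit modulo a positive power of \<open>q\<close> exactly when
  \<open>q\<close> does not divide it, so the exponents drop out of the condition.\<close>

lemma direction_vecs_iff:
  "x \<in> direction_vecs N n \<longleftrightarrow> x \<in> vecs N n \<and> (\<forall>q. prime q \<longrightarrow> q dvd N \<longrightarrow> (\<exists>i<n. \<not> int q dvd x i))"
proof -
  have unit: "y mod int (q ^ multiplicity q N) \<in> Units (Zmod (q ^ multiplicity q N)) \<longleftrightarrow> \<not> int q dvd y"
    if q: "prime q" "q dvd N" for q y
  proof -
    define M where "M = q ^ multiplicity q N"
    have mult: "multiplicity q N > 0" using q N by (simp add: prime_multiplicity_gt_zero_iff)
    then have M: "M > 1" unfolding M_def by (rule one_less_power[OF prime_gt_1_nat[OF q(1)]])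
    then have "residues (int M)" by (simp add: residues_def)
    from residues.res_units_eq[OF this]
    have "y mod int M \<in> Units (Zmod M) \<longleftrightarrow> 0 < y mod int M \<and> coprime (y mod int M) (int M)" using M by simp
    also have "\<dots> \<longleftrightarrow> coprime y (int M)"
    proof -
      have "y mod int M \<ge> 0" using M by simp
      moreover have "y mod int M \<noteq> 0" if "coprime (y mod int M) (int M)" using that M by auto
      ultimately show ?thesis by (metis coprime_mod_left_iff M le_less not_one_less_zero of_nat_0 of_nat_eq_iff less_numeral_extra(3) not_less_zero)
    qed
    also have "\<dots> \<longleftrightarrow> \<not> int q dvd y"
    proof -
      have "coprime y (int M) \<longleftrightarrow> coprime y (int q)" using mult by (simp add: M_def)
      also have "\<dots> \<longleftrightarrow> \<not> int q dvd y"
        using q(1) by (metis coprime_commute not_coprimeI not_prime_unit prime_imp_coprime prime_nat_int_transfer dvd_refl)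
      finally show ?thesis .
    qed
    finally show ?thesis by (simp add: M_def)
  qed
  have "q \<in> prime_factors N \<longleftrightarrow> prime q \<and> q dvd N" for q using N by (auto simp: in_prime_factors_iff)
  then show ?thesis unfolding direction_vecs_def using unit by (simp add: Ball_def) blast
qed

lemma bij_betw_directions: "bij_betw to_nat (direction_vecs N n) (ndir N n)"
proof -
  have iff: "to_nat x \<in> ndir N n \<longleftrightarrow> x \<in> direction_vecs N n" if x: "x \<in> vecs N n" for x
  proof -
    have "q dvd to_nat x i \<longleftrightarrow> int q dvd x i" if "i < n" for q i
      using vecsD[OF x that] that by (simp add: to_nat_def flip: int_dvd_int_iff)
    then have "(\<exists>i<n. \<not> q dvd to_nat x i) \<longleftrightarrow> (\<exists>i<n. \<not> int q dvd x i)" for q by blast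
    then show ?thesis
      using bij_betw_apply[OF bij_betw_to_nat x] x by (simp add: ndir_def direction_vecs_iff)
  qed
  have sub: "direction_vecs N n \<subseteq> vecs N n" by (auto simp: direction_vecs_def)
  have "to_nat ` direction_vecs N n = ndir N n"
  proof
    show "to_nat ` direction_vecs N n \<subseteq> ndir N n" using iff sub by blast
    show "ndir N n \<subseteq> to_nat ` direction_vecs N n"
    proof
      fix y assume y: "y \<in> ndir N n"
      then obtain x where "x \<in> vecs N n" "y = to_nat x"
        using ndir_subset bij_betw_to_nat unfolding bij_betw_def by blast
      then show "y \<in> to_nat ` direction_vecs N n" using iff y by blast
    qed
  qed
  then show ?thesis
    using inj_on_subset[OF bij_betw_imp_inj_on[OF bij_betw_to_nat] sub] by (simp add: bij_betw_def)
qed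

interpretation R: residues "int N" "Zmod N"
  by (rule residues)

section \<open>Unit multiples and projective classes\<close>

lemma scale_vec_eq: "scale_vec N n c u = (\<lambda>i\<in>{..<n}. (c * u i) mod int N)"
  by (simp add: scale_vec_def mult_eq)

lemma scale_vec_in_vecs: "scale_vec N n c u \<in> vecs N n"
  unfolding scale_vec_eq by (rule restrict_in_vecs)

lemma direction_vecsD: "x \<in> direction_vecs N n \<Longrightarrow> x \<in> vecs N n"
  by (simp add: direction_vecs_iff)

lemma vecs_carrier: "x \<in> vecs N n \<Longrightarrow> i < n \<Longrightarrow> x i \<in> carrier (Zmod N)"
  unfolding vecs_def by (drule PiE_mem[of _ _ _ i]) simp_all

lemma scale_vec_scale_vec:
  assumes "x \<in> vecs N n" "c \<in> carrier (Zmod N)" "d \<in> carrier (Zmod N)"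
  shows "scale_vec N n d (scale_vec N n c x) = scale_vec N n (d \<otimes>\<^bsub>Zmod N\<^esub> c) x"
  unfolding scale_vec_def
  by (rule restrict_ext) (use vecs_carrier[OF assms(1)] assms in \<open>simp add: R.m_assoc\<close>)

lemma scale_vec_one: "x \<in> vecs N n \<Longrightarrow> scale_vec N n \<one>\<^bsub>Zmod N\<^esub> x = x"
  by (rule vecs_eqI[OF scale_vec_in_vecs]) (use vecs_carrier in \<open>simp_all add: scale_vec_def\<close>)

lemma scale_vec_direction:
  assumes "x \<in> direction_vecs N n" "c \<in> Units (Zmod N)"
  shows "scale_vec N n c x \<in> direction_vecs N n"
proof -
  have "\<not> int q dvd (c * x i) mod int N" if "prime q" "q dvd N" "\<not> int q dvd x i" for q i
  proof
    assume "int q dvd (c * x i) mod int N"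
    then have "int q dvd c * x i" using that(2) by (simp add: dvd_mod_iff)
    then have "int q dvd c" using that by (simp add: prime_dvd_mult_iff)
    moreover have "coprime c (int N)" using assms(2) by (simp add: units)
    ultimately have "is_unit (int q)" using that(2) by (meson coprime_common_divisor int_dvd_int_iff)
    then show False using that(1) by (auto dest: not_prime_unit)
  qed
  then have "\<exists>i<n. \<not> int q dvd scale_vec N n c x i" if "prime q" "q dvd N" for q
    using assms(1) that unfolding direction_vecs_iff scale_vec_eq by (metis lessThan_iff restrict_apply')
  then show ?thesis
    using scale_vec_in_vecs by (simp add: direction_vecs_iff)
qed

lemma equiv_unit_multiple_rel: "equiv (direction_vecs N n) (unit_multiple_rel N n)"
proof (rule equivI)
  show "unit_multiple_rel N n \<subseteq> direction_vecs N n \<times> direction_vecs N n"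
    by (auto simp: unit_multiple_rel_def)
  show "refl_on (direction_vecs N n) (unit_multiple_rel N n)"
  proof (rule refl_onI)
    fix x assume "x \<in> direction_vecs N n"
    then show "(x, x) \<in> unit_multiple_rel N n"
      using scale_vec_one[OF direction_vecsD] R.Units_one_closed
      by (auto simp: unit_multiple_rel_def intro!: bexI[of _ "\<one>\<^bsub>Zmod N\<^esub>"])
  qed
  show "sym (unit_multiple_rel N n)"
  proof (rule symI)
    fix x y assume "(x, y) \<in> unit_multiple_rel N n"
    then obtain c where xy: "x \<in> direction_vecs N n" "y \<in> direction_vecs N n"
      and c: "c \<in> Units (Zmod N)" "y = scale_vec N n c x" by (auto simp: unit_multiple_rel_def)
    have "x = scale_vec N n (inv\<^bsub>Zmod N\<^esub> c) y"
    proof -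
      have "scale_vec N n (inv\<^bsub>Zmod N\<^esub> c) y = scale_vec N n (inv\<^bsub>Zmod N\<^esub> c \<otimes>\<^bsub>Zmod N\<^esub> c) x"
        unfolding c(2) using c(1) xy(1)
        by (intro scale_vec_scale_vec direction_vecsD R.Units_closed R.Units_inv_closed)
      then show ?thesis
        using scale_vec_one[OF direction_vecsD[OF xy(1)]] R.Units_l_inv[OF c(1)] by (simp only:)
    qed
    then show "(y, x) \<in> unit_multiple_rel N n"
      using xy R.Units_inv_Units[OF c(1)] by (auto simp: unit_multiple_rel_def)
  qed
  show "trans (unit_multiple_rel N n)"
  proof (rule transI)
    fix x y z assume "(x, y) \<in> unit_multiple_rel N n" "(y, z) \<in> unit_multiple_rel N n"
    then obtain c d where xz: "x \<in> direction_vecs N n" "z \<in> direction_vecs N n"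
      and cd: "c \<in> Units (Zmod N)" "d \<in> Units (Zmod N)" "z = scale_vec N n d (scale_vec N n c x)"
      by (auto simp: unit_multiple_rel_def)
    have "z = scale_vec N n (d \<otimes>\<^bsub>Zmod N\<^esub> c) x"
      unfolding cd(3) using cd(1,2) xz(1) by (intro scale_vec_scale_vec direction_vecsD R.Units_closed)
    then show "(x, z) \<in> unit_multiple_rel N n"
      using xz R.Units_m_closed[OF cd(2,1)] by (auto simp: unit_multiple_rel_def)
  qed
qed

text \<open>If \<open>c x = d x\<close> with \<open>c \<noteq> d\<close>, every coordinate of \<open>x\<close> is divisible by
  \<open>N / gcd (c - d) N\<close>, so \<open>x\<close> is not a direction.\<close>

lemma inj_on_scale_vec:
  assumes x: "x \<in> direction_vecs N n"
  shows "inj_on (\<lambda>c. scale_vec N n c x) (Units (Zmod N))"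
proof (rule inj_onI)
  fix c d assume cd: "c \<in> Units (Zmod N)" "d \<in> Units (Zmod N)" "scale_vec N n c x = scale_vec N n d x"
  have dvd: "int N dvd (c - d) * x i" if "i < n" for i
    using fun_cong[OF cd(3), of i] that by (simp add: scale_vec_eq mod_eq_dvd_iff left_diff_distrib)
  define g where "g = gcd (c - d) (int N)"
  have g: "g > 0" using N by (simp add: g_def)
  define e where "e = int N div g"
  have Ng: "int N = e * g" by (simp add: e_def g_def)
  then have "e > 0" using N g by (metis of_nat_0_less_iff zero_less_mult_pos2 less_trans zero_less_one)
  have "e = 1"
  proof (rule ccontr)
    assume "e \<noteq> 1"
    then have "nat e \<noteq> 1" using \<open>e > 0\<close> by simp
    then obtain q where q: "prime q" "q dvd nat e" using prime_factor_nat by blast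
    then have qe: "int q dvd e" using \<open>e > 0\<close> by (metis int_dvd_int_iff int_nat_eq less_imp_le)
    then have "int q dvd int N" unfolding Ng by simp
    then have "q dvd N" by simp
    then obtain i where i: "i < n" "\<not> int q dvd x i" using x q(1) by (auto simp: direction_vecs_iff)
    have cop: "coprime ((c - d) div g) e"
      unfolding e_def g_def using N by (intro div_gcd_coprime) simp
    have "(c - d) = ((c - d) div g) * g" by (simp add: g_def)
    then have "e * g dvd (((c - d) div g) * x i) * g"
      using dvd[OF i(1)] Ng by (metis mult.assoc mult.commute)
    then have "e dvd ((c - d) div g) * x i" using g by simp
    then have "e dvd x i" using cop by (simp add: coprime_commute coprime_dvd_mult_right_iff)
    then show False using qe i(2) dvd_trans by blast
  qed
  then have "int N = g" using Ng by simp
  also have "g dvd c - d" by (simp add: g_def)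
  finally have "int N dvd c - d" .
  then have "c mod int N = d mod int N" by (simp add: mod_eq_dvd_iff)
  then show "c = d" using cd(1,2) by (simp add: units)
qed

lemma proj_space_class:
  assumes "D \<in> proj_space N n"
  shows "card D = card (Units (Zmod N))"
    and "\<And>u v. u \<in> D \<Longrightarrow> v \<in> D \<Longrightarrow> \<exists>c\<in>Units (Zmod N). v = scale_vec N n c u"
proof -
  obtain x where x: "x \<in> direction_vecs N n" "D = unit_multiple_rel N n `` {x}"
    using assms unfolding proj_space_def by (rule quotientE)
  have "D = (\<lambda>c. scale_vec N n c x) ` Units (Zmod N)"
    unfolding x(2) using x(1) scale_vec_direction[OF x(1)] by (auto simp: unit_multiple_rel_def)
  then show "card D = card (Units (Zmod N))" using card_image[OF inj_on_scale_vec[OF x(1)]] by simp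
  show "\<exists>c\<in>Units (Zmod N). v = scale_vec N n c u" if "u \<in> D" "v \<in> D" for u v
    using in_quotient_imp_in_rel[OF equiv_unit_multiple_rel assms[unfolded proj_space_def], of u v] that
    by (simp add: unit_multiple_rel_def)
qed

text \<open>The units act freely on direction vectors, so all classes have the same size and a
  fraction of the classes is the same fraction of the vectors.\<close>

lemma card_Union_classes:
  assumes "K \<subseteq> proj_space N n"
  shows "card (\<Union>K) = card (Units (Zmod N)) * card K"
proof -
  have fin: "finite (direction_vecs N n)"
    by (rule finite_subset[OF _ finite_vecs]) (auto simp: direction_vecsD)
  have sub: "\<Union>K \<subseteq> direction_vecs N n"
    using assms Union_quotient[OF equiv_unit_multiple_rel] by (auto simp: proj_space_def)
  have "finite K"
    using finite_UnionD[OF finite_subset[OF sub fin]] .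
  then have "card (Units (Zmod N)) * card K = card (\<Union>K)"
  proof (rule card_partition)
    show "finite (\<Union>K)" using finite_subset[OF sub fin] .
    show "card D = card (Units (Zmod N))" if "D \<in> K" for D using that assms proj_space_class(1) by blast
    show "D \<inter> D' = {}" if "D \<in> K" "D' \<in> K" "D \<noteq> D'" for D D'
      using that assms quotient_disj[OF equiv_unit_multiple_rel] unfolding proj_space_def by blast
  qed
  then show ?thesis by simp
qed

text \<open>Replacing the parameter \<open>t\<close> by \<open>t c\<close> turns a line in direction
  \<open>c u\<close> into points on a line in direction \<open>u\<close>. This transfers rich lines
  from the fixed representative to every vector of its class.\<close>

lemma card_line_le_kcount:
  assumes u: "u \<in> vecs N n" and L: "L \<in> lines_in_direction N n (scale_vec N n c u)" and S: "S \<subseteq> vecs N n"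
  shows "\<exists>a. card (L \<inter> S) \<le> kcount N n (to_nat ` S) a (to_nat u)"
proof -
  obtain b where b: "b \<in> vecs N n" "L = line N n b (scale_vec N n c u)"
    using L by (auto simp: lines_in_direction_def)
  let ?Q = "{t. t < N \<and> lin N n (to_nat b) t (to_nat u) \<in> to_nat ` S}"
  have "to_nat ` (L \<inter> S) \<subseteq> (\<lambda>t. lin N n (to_nat b) t (to_nat u)) ` ?Q"
  proof
    fix z assume "z \<in> to_nat ` (L \<inter> S)"
    then obtain t where z: "z = to_nat (add_vec N n b (scale_vec N n t (scale_vec N n c u)))" "z \<in> to_nat ` S"
      by (auto simp: b(2) line_def)
    define s where "s = nat ((t * c) mod int N)"
    have "int s = (t * c) mod int N" "s < N" using N by (simp_all add: s_def nat_less_iff)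
    have "z = lin N n (to_nat b) s (to_nat u)"
      unfolding z(1) to_nat_def lin_def
    proof (rule restrict_ext)
      fix i assume i: "i \<in> {..<n}"
      have nn: "int (nat (b i)) = b i" "int (nat (u i)) = u i"
        using vecsD[OF b(1), of i] vecsD[OF u, of i] i by simp_all
      have "add_vec N n b (scale_vec N n t (scale_vec N n c u)) i = (b i + t * (c * u i)) mod int N"
        using i by (simp add: add_vec_def add_eq scale_vec_eq mod_simps)
      also have "\<dots> = (b i + (t * c) mod int N * u i) mod int N"
      proof -
        have "[b i + t * c * u i = b i + (t * c) mod int N * u i] (mod int N)"
          by (intro cong_add cong_mult cong_refl) (simp add: cong_def)
        then show ?thesis by (simp only: cong_def mult.assoc)
      qed
      also have "\<dots> = int ((nat (b i) + s * nat (u i)) mod N)"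
        using nn \<open>int s = _\<close> by (simp add: of_nat_mod)
      finally show "nat (add_vec N n b (scale_vec N n t (scale_vec N n c u)) i)
          = ((\<lambda>i\<in>{..<n}. nat (b i)) i + s * (\<lambda>i\<in>{..<n}. nat (u i)) i) mod N"
        using i by simp
    qed
    then show "z \<in> (\<lambda>t. lin N n (to_nat b) t (to_nat u)) ` ?Q" using z(2) \<open>s < N\<close> by blast
  qed
  then have "card (to_nat ` (L \<inter> S)) \<le> card ?Q" by (intro surj_card_le) simp_all
  moreover have "card (to_nat ` (L \<inter> S)) = card (L \<inter> S)"
    using inj_on_subset[OF bij_betw_imp_inj_on[OF bij_betw_to_nat], of "L \<inter> S"] S by (intro card_image) blast
  ultimately show ?thesis unfolding kcount_def by metis
qed

lemma kakeya_bound: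
  assumes n: "n \<ge> 1" and const: "kakeya_const N n C" "C \<ge> 0" and \<epsilon>: "\<epsilon> \<ge> 0"
    and rep: "\<And>D. D \<in> proj_space N n \<Longrightarrow> rep D \<in> D"
    and kakeya: "kakeya N n rep m \<epsilon> S"
  shows "C * \<epsilon> * real m ^ n \<le> real (card S)"
proof -
  define K where "K = {D \<in> proj_space N n. \<exists>L\<in>lines_in_direction N n (rep D). m \<le> card (L \<inter> S)}"
  have S: "S \<subseteq> vecs N n" and K: "\<epsilon> * real (card (proj_space N n)) \<le> real (card K)"
    using kakeya by (simp_all add: kakeya_def K_def)
  define c where "c = card (Units (Zmod N))"
  have dirs: "\<Union>(proj_space N n) = direction_vecs N n"
    unfolding proj_space_def by (rule Union_quotient[OF equiv_unit_multiple_rel])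
  have K_sub: "K \<subseteq> proj_space N n" by (auto simp: K_def)
  then have UK: "\<Union>K \<subseteq> direction_vecs N n" using dirs by blast
  have card_dir: "card (ndir N n) = c * card (proj_space N n)"
    using card_Union_classes[of "proj_space N n"] bij_betw_same_card[OF bij_betw_directions]
    by (simp add: dirs c_def)
  define G where "G = to_nat ` \<Union>K"
  have inj: "inj_on to_nat (\<Union>K)"
    using bij_betw_imp_inj_on[OF bij_betw_directions] UK by (rule inj_on_subset)
  have card_G: "card G = c * card K"
    using card_image[OF inj] card_Union_classes[OF K_sub] by (simp add: G_def c_def)
  have G_sub: "G \<subseteq> ndir N n"
    using bij_betw_imp_surj_on[OF bij_betw_directions] UK unfolding G_def by blast
  \<comment> \<open>Outside \<open>G\<close> any base point will do, since those directions
    contribute nonnegative terms.\<close>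
  have "\<exists>a. v \<in> G \<longrightarrow> m \<le> kcount N n (to_nat ` S) a v" for v
  proof (cases "v \<in> G")
    case True
    then obtain u D where u: "v = to_nat u" "u \<in> D" "D \<in> K" by (auto simp: G_def)
    then have D: "D \<in> proj_space N n" using K_sub by blast
    obtain L where L: "L \<in> lines_in_direction N n (rep D)" "m \<le> card (L \<inter> S)"
      using u(3) by (auto simp: K_def)
    obtain c where "rep D = scale_vec N n c u" using proj_space_class(2)[OF D u(2) rep[OF D]] by blast
    moreover have "u \<in> vecs N n" using u(2,3) UK direction_vecsD by blast
    ultimately obtain a where "card (L \<inter> S) \<le> kcount N n (to_nat ` S) a v"
      using card_line_le_kcount[of u L c S] L(1) S u(1) by auto
    then show ?thesis using L(2) le_trans by blast
  qed blast
  then obtain a where a: "\<And>v. v \<in> G \<Longrightarrow> m \<le> kcount N n (to_nat ` S) (a v) v" by metis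
  have "to_nat ` S \<subseteq> nvecs N n"
    using bij_betw_imp_surj_on[OF bij_betw_to_nat] S by blast
  then have bound: "C * (\<Sum>v\<in>ndir N n. real (kcount N n (to_nat ` S) (a v) v) ^ n)
      \<le> real (card (to_nat ` S)) * real (card (ndir N n))"
    using const(1) unfolding kakeya_const_def by blast
  have "real (card G) * real m ^ n = (\<Sum>v\<in>G. real m ^ n)" by simp
  also have "\<dots> \<le> (\<Sum>v\<in>G. real (kcount N n (to_nat ` S) (a v) v) ^ n)"
    using a by (intro sum_mono power_mono) simp_all
  also have "\<dots> \<le> (\<Sum>v\<in>ndir N n. real (kcount N n (to_nat ` S) (a v) v) ^ n)"
    using G_sub by (intro sum_mono2) simp_all
  finally have sum: "real (card G) * real m ^ n \<le> (\<Sum>v\<in>ndir N n. real (kcount N n (to_nat ` S) (a v) v) ^ n)" .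
  have "\<epsilon> * real (card (ndir N n)) = real c * (\<epsilon> * real (card (proj_space N n)))" by (simp add: card_dir)
  also have "\<dots> \<le> real c * real (card K)" using K by (intro mult_left_mono) simp_all
  also have "\<dots> = real (card G)" by (simp add: card_G)
  finally have "\<epsilon> * real (card (ndir N n)) * real m ^ n \<le> real (card G) * real m ^ n"
    by (intro mult_right_mono) simp_all
  also note sum
  finally have "C * (\<epsilon> * real (card (ndir N n)) * real m ^ n)
      \<le> C * (\<Sum>v\<in>ndir N n. real (kcount N n (to_nat ` S) (a v) v) ^ n)"
    using const(2) by (intro mult_left_mono)
  also note bound
  also have "card (to_nat ` S) = card S"
    using inj_on_subset[OF bij_betw_imp_inj_on[OF bij_betw_to_nat] S] by (rule card_image)
  finally have "C * \<epsilon> * real m ^ n * real (card (ndir N n)) \<le> real (card S) * real (card (ndir N n))"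
    by (simp add: mult_ac)
  moreover have "card (ndir N n) > 0"
  proof -
    have "(\<lambda>i\<in>{..<n}. 1) \<in> ndir N n"
      unfolding ndir_def using N n by (auto intro!: restrict_in_nvecs exI[of _ 0] dest: not_prime_unit)
    then show ?thesis by (auto simp: card_gt_0_iff)
  qed
  ultimately show ?thesis by simp
qed

end

theorem corollary1p4:
  fixes n N r m :: nat
    and p k :: "nat \<Rightarrow> nat"
    and \<epsilon> :: real
    and rep :: "(nat \<Rightarrow> int) set \<Rightarrow> (nat \<Rightarrow> int)"
    and S :: "(nat \<Rightarrow> int) set"
  assumes "n \<ge> 1"
    and "r \<ge> 1"
    and "\<And>i. i \<in> {1..r} \<Longrightarrow> prime (p i)"
    and "\<And>i j. i \<in> {1..r} \<Longrightarrow> j \<in> {1..r} \<Longrightarrow> i < j \<Longrightarrow> p i > p j"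
    and "\<And>i. i \<in> {1..r} \<Longrightarrow> k i \<ge> 1"
    and "N = (\<Prod>i=1..r. p i ^ k i)"
    and "0 \<le> \<epsilon>" and "\<epsilon> \<le> 1"
    and "\<And>D. D \<in> proj_space N n \<Longrightarrow> rep D \<in> D"
    and "kakeya N n rep m \<epsilon> S"
  shows "real (card S) \<ge>
    ((\<Prod>j=1..r-1. 1 / (real (k j) * ln (real (p j)) + 1)) *
     (\<Prod>i=1..r. 1 / (2 * (real (k i) + real_of_int \<lceil>log (real (p i)) (real n)\<rceil>)))) ^ n
    * \<epsilon> * real m ^ n"
proof -
  have p1: "p i > 1" if "i \<in> {1..r}" for i using assms(3)[OF that] by (rule prime_gt_1_nat)
  have "1 < p i ^ k i" if "i \<in> {1..r}" for i
    using one_less_power[OF p1[OF that]] assms(5)[OF that] by simp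
  then have "1 < p 1 ^ k 1" using assms(2) by simp
  also have "p 1 ^ k 1 \<le> N"
    unfolding assms(6)
  proof (intro dvd_imp_le dvd_prodI prod_pos ballI)
    show "0 < p i ^ k i" if "i \<in> {1..r}" for i using p1[OF that] by simp
  qed (use assms(2) in simp_all)
  finally have "N > 1" .
  then interpret kakeya_modulus N n by unfold_locales
  show ?thesis
  proof (rule kakeya_bound)
    show "kakeya_const N n (((\<Prod>j=1..r-1. 1 / (real (k j) * ln (real (p j)) + 1)) *
     (\<Prod>i=1..r. 1 / (2 * (real (k i) + real_of_int \<lceil>log (real (p i)) (real n)\<rceil>)))) ^ n)"
      unfolding assms(6) using assms(1-5) by (rule kakeya_const_prod)
    have "real (k j) * ln (real (p j)) \<ge> 0" if "j \<in> {1..r-1}" for j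
    proof -
      have "j \<in> {1..r}" using that by auto
      then show ?thesis using p1[of j] by simp
    qed
    moreover have "real_of_int \<lceil>log (real (p i)) (real n)\<rceil> \<ge> 0" if "i \<in> {1..r}" for i
    proof -
      have "log (real (p i)) (real n) \<ge> 0" using p1[OF that] assms(1) by simp
      then show ?thesis by linarith
    qed
    ultimately show "((\<Prod>j=1..r-1. 1 / (real (k j) * ln (real (p j)) + 1)) *
     (\<Prod>i=1..r. 1 / (2 * (real (k i) + real_of_int \<lceil>log (real (p i)) (real n)\<rceil>)))) ^ n \<ge> 0"
      by (intro zero_le_power mult_nonneg_nonneg prod_nonneg) simp_all
  qed (use assms in simp_all)
qed

end
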